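(* For every integer $n\geq 5$, $\mathrm{ex}_{\mathcal{P}}(n,2\mathcal{C})=2n-1$. Moreover, the extremal graphs (the $n$-vertex $2\mathcal{C}$-free planar graphs with $2n-1$ edges) are exactly the graphs obtained from $2K_1+C_3$ and an independent set of size $n-5$ by joining each vertex of the independent set to any two vertices of the triangle $C_3$ (the choice of the two vertices being arbitrary and possibly different for different vertices of the independent set).
   Context: All graphs are finite and simple. $2\mathcal{C}$ denotes the family of all graphs that are the disjoint union of two cycles (of arbitrary, possibly different, lengths); a graph is $2\mathcal{C}$-free if it contains no member of this family as a subgraph, i.e. it has no two vertex-disjoint cycles. $\mathrm{ex}_{\mathcal{P}}(n,2\mathcal{C})$ is the maximum number of edges in an $n$-vertex $2\mathcal{C}$-free planar graph. $G+H$ denotes the join of $G$ and $H$; thus $2K_1+C_3$ is the 5-vertex graph formed by a triangle $C_3$ and two nonadjacent vertices, each adjacent to all three vertices of the triangle. *)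

theory Defs
  imports "HOL-Analysis.Analysis"
begin

datatype 'a graph = Graph (verts: "'a set") (edges: "'a set set")

definition simple_graph :: "'a graph \<Rightarrow> bool" where
  "simple_graph G \<longleftrightarrow> finite (verts G) \<and> (\<forall>e\<in>edges G. e \<subseteq> verts G \<and> card e = 2)"

definition subgraph :: "'a graph \<Rightarrow> 'a graph \<Rightarrow> bool" where
  "subgraph H G \<longleftrightarrow> verts H \<subseteq> verts G \<and> edges H \<subseteq> edges G"

definition join :: "'a graph \<Rightarrow> 'a graph \<Rightarrow> 'a graph" where
  "join G H = Graph (verts G \<union> verts H)
     (edges G \<union> edges H \<union> {{x, y} | x y. x \<in> verts G \<and> y \<in> verts H})"

definition is_cycle :: "'a graph \<Rightarrow> bool" where
  "is_cycle C \<longleftrightarrow> (\<exists>vs. 3 \<le> length vs \<and> distinct vs \<and> verts C = set vs \<and>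
     edges C = {{vs ! i, vs ! (Suc i mod length vs)} | i. i < length vs})"

definition two_cycles :: "'a graph set" where
  "two_cycles = {Graph (verts C \<union> verts D) (edges C \<union> edges D) | C D.
     is_cycle C \<and> is_cycle D \<and> verts C \<inter> verts D = {}}"

text \<open>Meant for families closed under isomorphism, so that containing a member of the family up
  to isomorphism is the same as containing one literally.\<close>

definition free_of :: "'a graph set \<Rightarrow> 'a graph \<Rightarrow> bool" where
  "free_of F G \<longleftrightarrow> \<not> (\<exists>H\<in>F. subgraph H G)"

text \<open>A drawing in the plane, which is identified with the complex numbers: vertices are distinct
  points, an edge is a simple arc joining its ends and passing through no other vertex, and two
  edges meet only at common ends.\<close>

definition planar :: "'a graph \<Rightarrow> bool" where
  "planar G \<longleftrightarrow> (\<exists>(p :: 'a \<Rightarrow> complex) (\<gamma> :: 'a set \<Rightarrow> real \<Rightarrow> complex).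
     inj_on p (verts G) \<and>
     (\<forall>e\<in>edges G. arc (\<gamma> e) \<and> {pathstart (\<gamma> e), pathfinish (\<gamma> e)} = p ` e \<and>
        path_image (\<gamma> e) \<inter> p ` verts G = p ` e) \<and>
     (\<forall>e\<in>edges G. \<forall>f\<in>edges G. e \<noteq> f \<longrightarrow>
        path_image (\<gamma> e) \<inter> path_image (\<gamma> f) = p ` (e \<inter> f)))"

text \<open>Every finite graph is isomorphic to one on natural numbers, so these suffice for the maximum.
  The set is finite, all its members being at most \<open>n choose 2\<close>.\<close>

definition ex_planar :: "nat \<Rightarrow> nat graph set \<Rightarrow> nat" where
  "ex_planar n F = Max {card (edges G) | G.
     simple_graph G \<and> card (verts G) = n \<and> planar G \<and> free_of F G}"

text \<open>\<open>S\<close> carries \<open>2K\<^sub>1\<close>, \<open>C\<close> is the triangle, \<open>I\<close> the independent set, and \<open>f v\<close> the pair of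
  triangle vertices joined to \<open>v\<close>.\<close>

definition extremal_graphs :: "nat \<Rightarrow> 'a graph set" where
  "extremal_graphs n = {Graph (verts (join (Graph S {}) C) \<union> I)
       (edges (join (Graph S {}) C) \<union> {{v, x} | v x. v \<in> I \<and> x \<in> f v}) | S C I f.
     card S = 2 \<and> is_cycle C \<and> card (verts C) = 3 \<and> finite I \<and> card I = n - 5 \<and>
     S \<inter> verts C = {} \<and> (S \<union> verts C) \<inter> I = {} \<and>
     (\<forall>v\<in>I. f v \<subseteq> verts C \<and> card (f v) = 2)}"

end

theory Submission
  imports Defs
begin

text \<open>The bound and the extremal graphs are obtained by induction on \<open>n\<close>. A vertex of degree at most
  two is deleted; if the remaining graph is extremal, then attaching a vertex of degree two anywhere
  but to two vertices of the triangle creates two disjoint cycles or a subdivision of \<open>K\<^sub>5\<close> or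
  \<open>K\<^sub>3\<^sub>,\<^sub>3\<close>. If all degrees are at least three, \<open>n \<ge> 6\<close> and there are \<open>2n - 1\<close> edges, then \<open>K\<^sub>3\<^sub>,\<^sub>3\<close> is a
  subgraph: a shortest cycle \<open>C\<close> has length three or four, \<open>G - C\<close> is independent or a tree, and
  counting the edges between \<open>C\<close> and the two halves of a split tree shows that this tree is a star.

  In the plane, three pairwise crossing chords cannot be placed on the two sides of a closed curve,
  which excludes \<open>K\<^sub>5\<close> and \<open>K\<^sub>3\<^sub>,\<^sub>3\<close>. The extremal graphs are drawn with straight lines, each new vertex
  being placed close to the midpoint of an edge of the triangle.\<close>

section \<open>Disjoint cycles in dense graphs of minimum degree three\<close>

text \<open>Deleting a vertex of degree at most two loses at most two edges, which is the slope of
  the bound; equality is therefore inherited by the smaller graph. With minimum degree three the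
  argument is pure counting, and planarity enters only by forbidding the resulting K_{3,3}. To count
  without handling cycles explicitly, a cycle is replaced by a vertex set that spans at least as
  many edges as it has vertices. Two trees joined by two edges form such a set, and two such sets
  are never disjoint. The centre of the star with two vertices of the short cycle is one side of
  K_{3,3}, and the leaves supply the other. With six vertices the count is too tight by one to rule
  out a leaf adjacent to the whole triangle, hence the finite check. On the topological side, a
  chord may be replaced by any connected set touching both halves of the closed curve: in K_5 the
  star at the fifth vertex plays the third chord. Subdivisions are treated by merging the two arcs
  at the vertex of degree two into a single edge.\<close>

locale ugraph =
  fixes V :: "'a set" and adj :: "'a \<Rightarrow> 'a \<Rightarrow> bool"
  assumes finite_V: "finite V"
    and adj_sym: "adj u v \<Longrightarrow> adj v u"
    and adj_irrefl: "\<not> adj v v"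
    and adj_V: "adj u v \<Longrightarrow> u \<in> V"
begin

section \<open>Edge counts between vertex sets, connected sets and trees\<close>

definition cnt :: "'a set \<Rightarrow> 'a set \<Rightarrow> nat" where
  "cnt U W = (\<Sum>u\<in>U. \<Sum>w\<in>W. of_bool (adj u w))"

text \<open>Since \<open>cnt W W\<close> is twice the number of edges inside \<open>W\<close>, the following says that \<open>W\<close> spans at
  least as many edges as vertices, which forces a cycle inside \<open>W\<close>.\<close>

definition cyclic :: "'a set \<Rightarrow> bool" where
  "cyclic W \<longleftrightarrow> W \<subseteq> V \<and> W \<noteq> {} \<and> 2 * card W \<le> cnt W W"

text \<open>Connected sets are grown one neighbour at a time, so that each step adds a vertex
  together with at least one edge and edge counts follow by induction.\<close>

inductive conn :: "'a set \<Rightarrow> bool" where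
  single: "v \<in> V \<Longrightarrow> conn {v}"
| step: "conn W \<Longrightarrow> u \<in> W \<Longrightarrow> adj u v \<Longrightarrow> v \<notin> W \<Longrightarrow> conn (insert v W)"

lemma card_le_1_singleton: "finite U \<Longrightarrow> u \<in> U \<Longrightarrow> card U \<le> 1 \<Longrightarrow> U = {u}"
  using card_le_Suc0_iff_eq[of U] by auto

lemma adj_commute: "adj u v \<longleftrightarrow> adj v u"
  using adj_sym by blast

lemma cnt_commute: "cnt U W = cnt W U"
  unfolding cnt_def by (subst sum.swap) (simp add: adj_commute)

lemma cnt_Un_left:
  assumes "finite U" "finite U'" "U \<inter> U' = {}"
  shows "cnt (U \<union> U') W = cnt U W + cnt U' W"
  using assms by (simp add: cnt_def sum.union_disjoint)

lemma cnt_Un_right: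
  assumes "finite W" "finite W'" "W \<inter> W' = {}"
  shows "cnt U (W \<union> W') = cnt U W + cnt U W'"
  using cnt_Un_left[OF assms] by (simp add: cnt_commute)

lemma cnt_insert_left:
  "finite U \<Longrightarrow> u \<notin> U \<Longrightarrow> cnt (insert u U) W = cnt {u} W + cnt U W"
  by (simp add: cnt_def)

lemma cnt_insert_right:
  "finite W \<Longrightarrow> w \<notin> W \<Longrightarrow> cnt U (insert w W) = cnt U {w} + cnt U W"
  by (metis cnt_commute cnt_insert_left)

lemma cnt_doubleton: "c \<noteq> r \<Longrightarrow> cnt U {c, r} = cnt U {c} + cnt U {r}"
  by (rule cnt_insert_right) auto

lemma cnt_empty [simp]: "cnt {} W = 0" "cnt U {} = 0"
  by (simp_all add: cnt_def)

lemma cnt_single [simp]: "cnt {u} {w} = of_bool (adj u w)"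
  by (simp add: cnt_def)

lemma cnt_sum: "cnt U W = (\<Sum>u\<in>U. cnt {u} W)"
  by (simp add: cnt_def)

lemma cnt_le_card_left: "cnt U {w} \<le> card U"
proof -
  have "cnt U {w} \<le> (\<Sum>u\<in>U. 1)" unfolding cnt_sum[of U] by (rule sum_mono) simp
  then show ?thesis by simp
qed

lemma cnt_le_card_right: "cnt {u} W \<le> card W"
  using cnt_le_card_left[of W u] by (simp add: cnt_commute)

lemma cnt_single_eq_card: "finite W \<Longrightarrow> cnt {u} W = card {w \<in> W. adj u w}"
  by (simp add: cnt_def of_bool_def sum.If_cases Int_def conj_commute)

lemma cnt_mono: "finite U' \<Longrightarrow> finite W' \<Longrightarrow> U \<subseteq> U' \<Longrightarrow> W \<subseteq> W' \<Longrightarrow> cnt U W \<le> cnt U' W'"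
proof -
  assume a: "finite U'" "finite W'" "U \<subseteq> U'" "W \<subseteq> W'"
  have "cnt U W \<le> cnt U' W" unfolding cnt_def using a by (intro sum_mono2) auto
  also have "\<dots> \<le> cnt U' W'" unfolding cnt_def using a by (intro sum_mono sum_mono2) auto
  finally show ?thesis .
qed

lemma cnt_pos_iff:
  assumes "finite U" "finite W"
  shows "1 \<le> cnt U W \<longleftrightarrow> (\<exists>u\<in>U. \<exists>w\<in>W. adj u w)"
  unfolding cnt_def using assms by (auto simp: Suc_le_eq sum_nonneg_eq_0_iff neq0_conv[symmetric] simp del: neq0_conv)

lemma cnt_zeroI: "(\<And>u w. u \<in> U \<Longrightarrow> w \<in> W \<Longrightarrow> \<not> adj u w) \<Longrightarrow> cnt U W = 0"
  by (simp add: cnt_def)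

lemma cnt_Un_self:
  assumes "finite U" "finite W" "U \<inter> W = {}"
  shows "cnt (U \<union> W) (U \<union> W) = cnt U U + cnt W W + 2 * cnt U W"
  using assms by (simp add: cnt_Un_left cnt_Un_right cnt_commute[of W U])

lemma cnt_insert_self:
  assumes "finite U" "v \<notin> U"
  shows "cnt (insert v U) (insert v U) = cnt U U + 2 * cnt {v} U"
  using assms cnt_Un_self[of "{v}" U] by (simp add: adj_irrefl)

lemma even_cnt_self: "finite U \<Longrightarrow> even (cnt U U)"
  by (induction U rule: finite_induct) (simp_all add: cnt_insert_self)

lemma adj_in_V: "adj u v \<Longrightarrow> u \<in> V \<and> v \<in> V"
  using adj_V adj_sym by blast

lemma conn_props: "conn W \<Longrightarrow> W \<subseteq> V \<and> W \<noteq> {} \<and> finite W"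
proof -
  assume c: "conn W"
  then have "W \<subseteq> V \<and> W \<noteq> {}" by induction (auto dest: adj_in_V)
  then show ?thesis using finite_V finite_subset by blast
qed

text \<open>Every vertex after the first brings an edge, so a connected set spans at least
  \<open>card W - 1\<close> edges; \<open>cnt W W\<close> sees each of them from both ends.\<close>

lemma conn_cnt: "conn W \<Longrightarrow> 2 * card W \<le> cnt W W + 2"
proof (induction rule: conn.induct)
  case (step W u v)
  have f: "finite W" using step conn_props by blast
  have "1 \<le> cnt {v} W" using step f adj_sym by (subst cnt_pos_iff) auto
  then show ?case using step f by (simp add: cnt_insert_self)
qed simp

lemma conn_closed:
  "conn F \<Longrightarrow> Z \<subseteq> F \<Longrightarrow> (\<And>z w. z \<in> Z \<Longrightarrow> w \<in> F - Z \<Longrightarrow> \<not> adj z w) \<Longrightarrow> Z = {} \<or> Z = F"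
proof (induction arbitrary: Z rule: conn.induct)
  case (step W u v)
  have "Z \<inter> W = {} \<or> Z \<inter> W = W"
    by (rule step.IH) (use step.prems in auto)
  then show ?case
  proof
    assume "Z \<inter> W = {}"
    then show ?case using step.prems step.hyps adj_sym[of u v] by blast
  next
    assume "Z \<inter> W = W"
    then show ?case using step.prems step.hyps by blast
  qed
qed auto

text \<open>A largest connected subset of \<open>W\<close> containing \<open>v\<close> is the
  component of \<open>v\<close> in the subgraph induced by \<open>W\<close>: an edge leaving it
  would enlarge it.\<close>

lemma maximal_conn:
  assumes "W \<subseteq> V" "v \<in> W"
  obtains U where "U \<subseteq> W" "conn U" "v \<in> U" "\<And>u w. u \<in> U \<Longrightarrow> w \<in> W - U \<Longrightarrow> \<not> adj u w"
proof -
  let ?P = "\<lambda>U. U \<subseteq> W \<and> conn U \<and> v \<in> U"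
  have "?P {v}" using assms single by auto
  moreover have "\<forall>U. ?P U \<longrightarrow> card U < Suc (card W)"
    using finite_subset[OF assms(1) finite_V] by (auto intro: card_mono simp: less_Suc_eq_le)
  ultimately have "\<exists>U. ?P U \<and> (\<forall>U'. ?P U' \<longrightarrow> card U' \<le> card U)"
    by (rule ex_has_greatest_nat)
  then obtain U where U: "?P U" and max: "\<And>U'. ?P U' \<Longrightarrow> card U' \<le> card U"
    by (elim exE conjE) auto
  have "\<not> adj u w" if "u \<in> U" "w \<in> W - U" for u w
  proof
    assume "adj u w"
    then have "?P (insert w U)" using U that step[of U u w] by auto
    then have "card (insert w U) \<le> card U" by (rule max)
    then show False using that U conn_props by auto
  qed
  then show thesis using that U by blast
qed

text \<open>Two trees together have two edges fewer than vertices, and two edges between them make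
  up the deficit. This produces nearly all the disjoint cycles used below.\<close>

lemma cyclic_join:
  assumes "U \<subseteq> V" "P \<subseteq> V" "U \<inter> P = {}" "U \<noteq> {}"
    and "2 * card U \<le> cnt U U + 2" "2 * card P \<le> cnt P P + 2" "2 \<le> cnt U P"
  shows "cyclic (U \<union> P)"
proof -
  have "finite U" "finite P" using assms finite_V finite_subset by blast+
  then show ?thesis using assms by (simp add: cyclic_def cnt_Un_self card_Un_disjoint)
qed

text \<open>Connectivity bounds the doubled edge count from below by \<open>2 * card F - 2\<close>,
  the absence of cyclic subsets bounds it from above by \<open>2 * card F - 1\<close>, and parity
  decides.\<close>

lemma tree_cnt:
  assumes "conn F" "\<And>U. U \<subseteq> F \<Longrightarrow> \<not> cyclic U"
  shows "cnt F F + 2 = 2 * card F"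
proof -
  have "cnt F F < 2 * card F" using assms conn_props[of F] unfolding cyclic_def by force
  moreover have "2 * card F \<le> cnt F F + 2" using assms conn_cnt by blast
  moreover have "even (cnt F F)" using assms even_cnt_self conn_props by blast
  ultimately obtain k where "cnt F F = 2 * k" "k < card F" "card F \<le> k + 1" by (auto elim: evenE)
  then show ?thesis by simp
qed

text \<open>Either some vertex \<open>x\<close> has a component \<open>K\<close> of \<open>F - x\<close> for which \<open>K\<close> and \<open>F - K\<close> both have
  at least two vertices, or every component of every \<open>F - x\<close> is a single vertex or all of \<open>F - x\<close>;
  in a tree the latter forces a star.\<close>

lemma tree_split_or_star:
  assumes F: "conn F" "\<And>U. U \<subseteq> F \<Longrightarrow> \<not> cyclic U" "3 \<le> card F"
  shows "(\<exists>F1 F2. conn F1 \<and> conn F2 \<and> F1 \<inter> F2 = {} \<and> F1 \<union> F2 = F \<and> 2 \<le> card F1 \<and> 2 \<le> card F2)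
    \<or> (\<exists>x\<in>F. \<forall>y\<in>F - {x}. adj x y)"
proof (cases "\<exists>x\<in>F. 2 \<le> cnt {x} F")
  case False
  have fF: "finite F" "F \<subseteq> V" using conn_props F by blast+
  have "cnt F F = (\<Sum>x\<in>F. cnt {x} F)" by (rule cnt_sum)
  also have "\<dots> \<le> (\<Sum>x\<in>F. 1)" by (rule sum_mono) (use False in force)
  finally have "cnt F F \<le> card F" by simp
  then show ?thesis using tree_cnt[OF F(1,2)] F(3) by linarith
next
  case True
  then obtain x where x: "x \<in> F" "2 \<le> cnt {x} F" by blast
  have fF: "finite F" "F \<subseteq> V" using conn_props F by blast+
  show ?thesis
  proof (cases "\<forall>y\<in>F - {x}. adj x y")
    case False
    then obtain y where y: "y \<in> F" "y \<noteq> x" "\<not> adj x y" by blast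
    obtain K where K: "K \<subseteq> F - {x}" "conn K" "y \<in> K"
      "\<And>u w. u \<in> K \<Longrightarrow> w \<in> F - {x} - K \<Longrightarrow> \<not> adj u w"
      using maximal_conn[of "F - {x}" y] fF y by blast
    have fK: "finite K" using K conn_props by blast
    obtain U where U: "U \<subseteq> F - K" "conn U" "x \<in> U"
      "\<And>u w. u \<in> U \<Longrightarrow> w \<in> F - K - U \<Longrightarrow> \<not> adj u w"
      using maximal_conn[of "F - K" x] fF x K by blast
    have "F - K - U = {} \<or> F - K - U = F"
    proof (rule conn_closed[OF F(1)])
      fix z w assume z: "z \<in> F - K - U" "w \<in> F - (F - K - U)"
      then have "z \<in> F - {x} - K" using U by auto
      then show "\<not> adj z w" using z K(4)[of w z] U(4)[of w z] adj_sym by blast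
    qed auto
    then have UK: "U = F - K" using U x by blast
    have "2 \<le> card K"
    proof (rule ccontr)
      assume "\<not> 2 \<le> card K"
      then have "K = {y}" using card_le_1_singleton[OF fK K(3)] by linarith
      then have "{y} = {} \<or> {y} = F"
        using K(4)[of y] y adj_sym[of y x] by (intro conn_closed[OF F(1)]) auto
      then show False using F(3) by auto
    qed
    \<comment> \<open>Were \<open>x\<close> alone outside \<open>K\<close>, the
      \<open>card K - 1\<close> edges of \<open>K\<close> would leave only one of the edges of the
      tree for \<open>x\<close>, against its two neighbours.\<close>
    moreover have "2 \<le> card U"
    proof (rule ccontr)
      assume "\<not> 2 \<le> card U"
      moreover have "finite U" using U conn_props by blast
      ultimately have "U = {x}" using card_le_1_singleton[OF _ U(3)] by linarith
      then have FK: "F = insert x K" "x \<notin> K" using UK K x by auto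
      have "cnt F F = cnt K K + 2 * cnt {x} K" using FK fK cnt_insert_self by simp
      moreover have "cnt {x} F = cnt {x} K"
        using FK fK cnt_insert_right[of K x "{x}"] by (simp add: adj_irrefl)
      ultimately show False
        using tree_cnt[OF F(1,2)] conn_cnt[OF K(2)] x FK fK by simp
    qed
    ultimately show ?thesis using UK K U by blast
  qed (use x in blast)
qed

section \<open>Passing between edge counts and actual cycles\<close>

definition cyc_list :: "'a list \<Rightarrow> bool" where
  "cyc_list vs \<longleftrightarrow> 3 \<le> length vs \<and> distinct vs \<and> (\<forall>i<length vs. adj (vs ! i) (vs ! (Suc i mod length vs)))"

lemma cyclicD: "cyclic W \<Longrightarrow> W \<subseteq> V \<and> W \<noteq> {} \<and> finite W \<and> 2 * card W \<le> cnt W W"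
  unfolding cyclic_def using finite_V finite_subset by blast

lemma cnt_Diff_self:
  assumes "finite U" "v \<in> U"
  shows "cnt U U = cnt (U - {v}) (U - {v}) + 2 * cnt {v} U"
proof -
  have U: "U = insert v (U - {v})" using assms by blast
  have "cnt {v} U = cnt {v} (U - {v})"
    using U cnt_insert_right[of "U - {v}" v "{v}"] assms by (simp add: adj_irrefl)
  then show ?thesis using U cnt_insert_self[of "U - {v}" v] assms by simp
qed

text \<open>In a smallest cyclic set every vertex has two neighbours, since deleting a vertex with
  fewer would leave a smaller cyclic set. All neighbours of the first vertex of a longest path lie
  on the path, and one that is not its successor closes a cycle.\<close>

lemma cyclic_imp_cyc_list:
  assumes "cyclic W"
  obtains vs where "cyc_list vs" "set vs \<subseteq> W"
proof -
  obtain W0 where W0: "W0 \<subseteq> W" "cyclic W0" and min: "\<And>U. U \<subseteq> W0 \<Longrightarrow> cyclic U \<Longrightarrow> U = W0"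
  proof -
    define P where "P U \<longleftrightarrow> U \<subseteq> W \<and> cyclic U" for U
    have "P W" using assms by (simp add: P_def)
    then obtain W0 where W0: "P W0" "\<And>U. card U < card W0 \<Longrightarrow> \<not> P U"
      using exists_least_iff[of "\<lambda>n. \<exists>U. P U \<and> card U = n"] by metis
    show thesis
    proof
      show "W0 \<subseteq> W" "cyclic W0" using W0(1) by (simp_all add: P_def)
      fix U assume "U \<subseteq> W0" "cyclic U"
      then show "U = W0"
        using W0 cyclicD[of W0] unfolding P_def by (metis order.trans psubset_card_mono psubsetI)
    qed
  qed
  have f0: "finite W0" "W0 \<subseteq> V" using W0 cyclicD by blast+
  have deg2: "2 \<le> cnt {v} W0" if v: "v \<in> W0" for v
  proof (rule ccontr)
    assume neg: "\<not> ?thesis"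
    have c: "card W0 = card (W0 - {v}) + 1" using v f0 by (metis Suc_eq_plus1 card.remove)
    have "W0 - {v} \<noteq> {}"
    proof
      assume "W0 - {v} = {}"
      then have "W0 = {v}" using v by blast
      then show False using cyclicD[OF W0(2)] by (simp add: adj_irrefl)
    qed
    then have "cyclic (W0 - {v})"
      using cnt_Diff_self[OF f0(1) v] neg cyclicD[OF W0(2)] c unfolding cyclic_def by auto
    then show False using min[of "W0 - {v}"] v by blast
  qed
  define P where "P vs \<longleftrightarrow> vs \<noteq> [] \<and> distinct vs \<and> set vs \<subseteq> W0 \<and> successively adj vs" for vs
  obtain w where "w \<in> W0" using W0 cyclicD by blast
  then have "P [w]" by (simp add: P_def)
  moreover have "\<forall>vs. P vs \<longrightarrow> length vs < Suc (card W0)"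
    unfolding P_def using f0 by (metis card_mono distinct_card less_Suc_eq_le)
  ultimately obtain vs where vs: "P vs" and max: "\<And>ws. P ws \<Longrightarrow> length ws \<le> length vs"
    using ex_has_greatest_nat[of P "[w]" length] by metis
  then obtain x xs where x: "vs = x # xs" unfolding P_def by (cases vs) auto
  have nb: "w \<in> set xs" if "w \<in> W0" "adj x w" for w
  proof (rule ccontr)
    assume "w \<notin> set xs"
    then have "P (w # vs)" using vs that adj_irrefl[of x] adj_sym[OF that(2)] unfolding P_def x by auto
    then show False using max[of "w # vs"] by simp
  qed
  have "x \<in> W0" using vs x by (simp add: P_def)
  then have "2 \<le> card {w \<in> W0. adj x w}" using deg2 f0 by (simp flip: cnt_single_eq_card)
  moreover have "finite {w \<in> W0. adj x w}" using f0 by simp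
  ultimately have "\<not> {w \<in> W0. adj x w} \<subseteq> {xs ! 0}"
    using card_mono[of "{xs ! 0}" "{w \<in> W0. adj x w}"] by auto
  then obtain w where w: "w \<in> W0" "adj x w" "w \<noteq> xs ! 0" by blast
  then obtain j where j: "j < length xs" "xs ! j = w" using nb in_set_conv_nth by metis
  then have "j \<noteq> 0" using w by (cases j) auto
  \<comment> \<open>\<open>xs ! j\<close> is \<open>vs ! (j + 1)\<close>, so the cycle consists of
    the first \<open>j + 2\<close> vertices; \<open>j \<noteq> 0\<close> makes these at least
    three.\<close>
  let ?c = "take (j + 2) vs"
  have len: "length ?c = j + 2" using j x by simp
  have "cyc_list ?c"
    unfolding cyc_list_def
  proof (intro conjI allI impI)
    show "3 \<le> length ?c" using len \<open>j \<noteq> 0\<close> by simp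
    show "distinct ?c" using vs by (simp add: P_def)
    fix i assume i: "i < length ?c"
    show "adj (?c ! i) (?c ! (Suc i mod length ?c))"
    proof (cases "Suc i = j + 2")
      case True
      then have "?c ! i = w" "?c ! (Suc i mod length ?c) = x" using len j x by simp_all
      then show ?thesis using w adj_sym by simp
    next
      case False
      then have "Suc i < j + 2" using i len by simp
      moreover have "adj (vs ! i) (vs ! Suc i)"
        using vs calculation j x unfolding P_def successively_conv_nth by simp
      ultimately show ?thesis using len by simp
    qed
  qed
  moreover have "set ?c \<subseteq> W" using vs W0(1) set_take_subset[of "j + 2" vs] unfolding P_def by blast
  ultimately show thesis using that by blast
qed

lemma path_conn: "ws \<noteq> [] \<Longrightarrow> distinct ws \<Longrightarrow> set ws \<subseteq> V \<Longrightarrow> successively adj ws \<Longrightarrow> conn (set ws)"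
proof (induction ws)
  case (Cons x ws)
  show ?case
  proof (cases ws)
    case Nil
    then show ?thesis using Cons single by simp
  next
    case (Cons y zs)
    have "conn (set ws)" using Cons.IH Cons.prems local.Cons by simp
    moreover have "y \<in> set ws" "adj y x" "x \<notin> set ws" using Cons.prems local.Cons adj_sym by auto
    ultimately show ?thesis using step by simp
  qed
qed simp

lemma attach1:
  assumes "U \<subseteq> V" "U \<noteq> {}" "2 * card U \<le> cnt U U + 2" "a \<in> V - U" "2 \<le> cnt U {a}"
  shows "cyclic (insert a U)"
  using cyclic_join[of U "{a}"] assms by auto

lemma attach2:
  assumes "U \<subseteq> V" "U \<noteq> {}" "2 * card U \<le> cnt U U + 2" "adj a b" "a \<notin> U" "b \<notin> U" "2 \<le> cnt U {a, b}"
  shows "cyclic (U \<union> {a, b})"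
proof (rule cyclic_join)
  have "a \<noteq> b" using assms(4) adj_irrefl by blast
  then show "2 * card {a, b} \<le> cnt {a, b} {a, b} + 2" using assms(4) by (simp add: cnt_insert_self)
  show "{a, b} \<subseteq> V" using assms adj_in_V by blast
  show "U \<inter> {a, b} = {}" using assms by blast
qed (use assms in auto)

lemma cyc_list_in_V: "cyc_list vs \<Longrightarrow> set vs \<subseteq> V"
  unfolding cyc_list_def using adj_V by (metis in_set_conv_nth subsetI)

lemma cyc_list_successively: "cyc_list vs \<Longrightarrow> successively adj vs"
  unfolding successively_conv_nth
proof (intro allI impI)
  fix i assume a: "cyc_list vs" "Suc i < length vs"
  then have "adj (vs ! i) (vs ! (Suc i mod length vs))" unfolding cyc_list_def by (meson Suc_lessD)
  then show "adj (vs ! i) (vs ! Suc i)" using a by simp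
qed

lemma cyc_list_wrap: "cyc_list vs \<Longrightarrow> adj (last vs) (hd vs)"
proof -
  assume c: "cyc_list vs"
  then have "vs \<noteq> []" "adj (vs ! (length vs - 1)) (vs ! (Suc (length vs - 1) mod length vs))"
    unfolding cyc_list_def by auto
  then show ?thesis by (simp add: last_conv_nth hd_conv_nth)
qed

lemma two_le_cnt:
  assumes "finite U" "u \<in> U" "v \<in> U" "u \<noteq> v" "adj u w" "adj v w"
  shows "2 \<le> cnt U {w}"
proof -
  have "cnt {u, v} {w} \<le> cnt U {w}" using assms by (intro cnt_mono) auto
  moreover have "cnt {u, v} {w} = 2"
    using assms cnt_doubleton[of u v "{w}"] by (simp add: cnt_commute[of "{u, v}"] adj_commute)
  ultimately show ?thesis by simp
qed

lemma cyc_list_cyclic: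
  assumes "cyc_list vs"
  shows "cyclic (set vs)"
proof -
  obtain x y zs where vs: "vs = x # y # zs" "zs \<noteq> []"
    using assms unfolding cyc_list_def by (cases vs; cases "tl vs"; cases "tl (tl vs)") auto
  have s: "successively adj vs" "distinct vs" "set vs \<subseteq> V" "adj (last vs) x"
    using cyc_list_successively[OF assms] cyc_list_wrap[OF assms] cyc_list_in_V[OF assms] assms vs
    by (auto simp: cyc_list_def)
  have c: "conn (set (y # zs))" by (rule path_conn) (use s vs in auto)
  have "cyclic (insert x (set (y # zs)))"
  proof (rule attach1)
    show "2 \<le> cnt (set (y # zs)) {x}"
    proof (rule two_le_cnt)
      show "last zs \<in> set (y # zs)" "y \<noteq> last zs" using s vs by auto
      show "adj y x" "adj (last zs) x" using s vs adj_sym by auto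
    qed auto
  qed (use conn_cnt[OF c] conn_props[OF c] s vs in auto)
  then show ?thesis using vs by simp
qed

lemma triangle_cyc_list: "adj a b \<Longrightarrow> adj b c \<Longrightarrow> adj c a \<Longrightarrow> cyc_list [a, b, c]"
  unfolding cyc_list_def using adj_irrefl[of a] adj_irrefl[of b] adj_irrefl[of c]
  by (auto simp: All_less_Suc)

lemma square_cyc_list:
  "adj a b \<Longrightarrow> adj b c \<Longrightarrow> adj c d \<Longrightarrow> adj d a \<Longrightarrow> a \<noteq> c \<Longrightarrow> b \<noteq> d \<Longrightarrow> cyc_list [a, b, c, d]"
  unfolding cyc_list_def using adj_irrefl[of a] adj_irrefl[of b] adj_irrefl[of c] adj_irrefl[of d]
  by (auto simp: All_less_Suc)

end

text \<open>For \<open>n = 6\<close>: a triangle \<open>abc\<close>, a path \<open>pqr\<close>, and \<open>pa\<close> for the adjacency of \<open>p\<close> and \<open>a\<close>.\<close>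

lemma six_vertex_check:
  "\<forall>pa pb pc qa qb qc ra rb rc.
    6 \<le> (of_bool pa + of_bool qa + of_bool ra) + (of_bool pb + of_bool qb + of_bool rb)
      + (of_bool pc + of_bool qc + of_bool rc :: nat) \<and>
    (pa \<and> pb \<or> pa \<and> pc \<or> pb \<and> pc) \<and> (ra \<and> rb \<or> ra \<and> rc \<or> rb \<and> rc) \<and>
    (qa \<or> qb \<or> qc) \<and> (pa \<or> qa \<or> ra) \<and> (pb \<or> qb \<or> rb) \<and> (pc \<or> qc \<or> rc) \<and>
    \<not> (qa \<and> pb \<and> pc \<and> rb \<and> rc) \<and> \<not> (qb \<and> pa \<and> pc \<and> ra \<and> rc) \<and> \<not> (qc \<and> pa \<and> pb \<and> ra \<and> rb) \<and>
    \<not> (pa \<and> qa \<and> rb \<and> rc) \<and> \<not> (pb \<and> qb \<and> ra \<and> rc) \<and> \<not> (pc \<and> qc \<and> ra \<and> rb) \<and>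
    \<not> (ra \<and> qa \<and> pb \<and> pc) \<and> \<not> (rb \<and> qb \<and> pa \<and> pc) \<and> \<not> (rc \<and> qc \<and> pa \<and> pb) \<longrightarrow> False"
  by (simp only: all_bool_eq of_bool_eq) simp

section \<open>Minimum degree three without disjoint cycles\<close>

locale dense_ugraph = ugraph +
  assumes cyclic_meet: "cyclic U \<Longrightarrow> cyclic W \<Longrightarrow> U \<inter> W \<noteq> {}"
    and deg3: "v \<in> V \<Longrightarrow> 3 \<le> cnt {v} V"
begin

definition K33 :: bool where
  "K33 \<longleftrightarrow> (\<exists>A B. A \<subseteq> V \<and> B \<subseteq> V \<and> A \<inter> B = {} \<and> card A = 3 \<and> card B = 3 \<and> (\<forall>a\<in>A. \<forall>b\<in>B. adj a b))"

lemma K33I: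
  assumes "card A = 3" "finite B" "3 \<le> card B" "\<And>a b. a \<in> A \<Longrightarrow> b \<in> B \<Longrightarrow> adj a b"
  shows K33
proof -
  obtain B' where B': "B' \<subseteq> B" "card B' = 3"
    using obtain_subset_with_card_n[OF assms(3)] by metis
  have "B' \<noteq> {}" "A \<noteq> {}" using B' assms by auto
  then obtain a0 b0 where "a0 \<in> A" "b0 \<in> B'" by blast
  have adj: "adj a b" if "a \<in> A" "b \<in> B'" for a b using assms(4) that B'(1) by blast
  have "A \<subseteq> V" "B' \<subseteq> V" using adj[of _ b0] adj[of a0] adj_in_V \<open>a0 \<in> A\<close> \<open>b0 \<in> B'\<close> by blast+
  moreover have "A \<inter> B' = {}" using adj adj_irrefl by (metis disjoint_iff)
  ultimately show ?thesis unfolding K33_def using assms(1) B'(2) adj by metis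
qed

text \<open>By averaging, not all vertices of \<open>F1\<close> can have two neighbours in
  \<open>F\<close>. With \<open>F1\<close> a part of a tree \<open>F\<close>, this finds a leaf of
  the whole tree inside that part.\<close>

lemma leaf_exists:
  assumes "finite F1" "cnt F1 F < 2 * card F1"
  obtains l where "l \<in> F1" "cnt {l} F \<le> 1"
proof -
  have "\<exists>l\<in>F1. cnt {l} F \<le> 1"
  proof (rule ccontr)
    assume "\<not> ?thesis"
    then have "(\<Sum>x\<in>F1. 2) \<le> (\<Sum>x\<in>F1. cnt {x} F)" by (intro sum_mono) force
    then show False using assms by (simp add: cnt_sum[of F1])
  qed
  then show thesis using that by blast
qed

lemma sum_deg3: "U \<subseteq> V \<Longrightarrow> 3 * card U \<le> cnt U V"
proof -
  assume "U \<subseteq> V"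
  then have "(\<Sum>v\<in>U. 3) \<le> (\<Sum>v\<in>U. cnt {v} V)" by (intro sum_mono deg3) blast
  then show ?thesis by (simp add: cnt_sum[of U])
qed

text \<open>Were \<open>F\<close> split into two subtrees with at least two vertices each, the many
  edges to \<open>a\<close> and \<open>b\<close> would give disjoint cyclic sets, one around each
  half. So \<open>F\<close> is a star, and its leaves are joined to \<open>a\<close>,
  \<open>b\<close> and the centre. In the applications \<open>R\<close> is the rest of the short
  cycle: one vertex of a triangle, two opposite vertices of a four-cycle.\<close>

lemma star_lemma:
  assumes F: "conn F" "\<And>U. U \<subseteq> F \<Longrightarrow> \<not> cyclic U" "4 \<le> card F"
    and V: "V = F \<union> {a, b} \<union> R" "a \<noteq> b" "a \<notin> F" "b \<notin> F" "R \<inter> (F \<union> {a, b}) = {}"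
    and R: "\<And>r. r \<in> R \<Longrightarrow> adj r a \<and> adj r b" "1 \<le> cnt F R"
    and leaves: "\<And>l. l \<in> F \<Longrightarrow> cnt {l} F \<le> 1 \<Longrightarrow> adj l a \<and> adj l b"
    and many: "card F + 2 \<le> cnt F {a} + cnt F {b}"
  shows K33
proof (rule disjE[OF tree_split_or_star[OF F(1,2)]])
  show "3 \<le> card F" using F by simp
next
  have fF: "finite F" using F conn_props by blast
  have fR: "finite R" using V finite_V by simp
  assume "\<exists>F1 F2. conn F1 \<and> conn F2 \<and> F1 \<inter> F2 = {} \<and> F1 \<union> F2 = F \<and> 2 \<le> card F1 \<and> 2 \<le> card F2"
  then obtain F1 F2 where S: "conn F1" "conn F2" "F1 \<inter> F2 = {}" "F1 \<union> F2 = F" "2 \<le> card F1" "2 \<le> card F2"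
    by blast
  have cyc1: "cyclic (insert c F')" if "conn F'" "F' \<subseteq> F" "2 \<le> cnt F' {c}" "c \<in> {a, b}" for F' c
  proof -
    have "cyclic (F' \<union> {c})"
    proof (rule cyclic_join)
      show "{c} \<subseteq> V" "F' \<inter> {c} = {}" using that V by blast+
    qed (use that conn_cnt[of F'] conn_props[of F'] in simp_all)
    then show ?thesis by simp
  qed
  have cyc2: "cyclic (F' \<union> {c, r})"
    if "conn F'" "F' \<subseteq> F" "1 \<le> cnt F' {c}" "1 \<le> cnt F' {r}" "c \<in> {a, b}" "r \<in> R" for F' c r
  proof (rule cyclic_join)
    have "c \<noteq> r" using that V by auto
    moreover have "adj c r" "adj r c" using that R adj_sym by blast+
    ultimately show "2 * card {c, r} \<le> cnt {c, r} {c, r} + 2"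
      by (simp add: cnt_insert_self)
    show "2 \<le> cnt F' {c, r}" using \<open>c \<noteq> r\<close> that by (simp add: cnt_doubleton)
    show "{c, r} \<subseteq> V" using that V(1) by blast
    show "F' \<inter> {c, r} = {}" using that V by blast
    show "2 * card F' \<le> cnt F' F' + 2" "F' \<subseteq> V" "F' \<noteq> {}"
      using that(1) conn_cnt[of F'] conn_props[of F'] by blast+
  qed
  \<comment> \<open>A half that reaches both \<open>c\<close> and some \<open>r\<close> in
    \<open>R\<close> closes a cycle through the edge \<open>c r\<close>; the other half may then
    send only one edge to \<open>d\<close>.\<close>
  have disj: "cnt F2 {d} \<le> 1"
    if S: "conn F1" "conn F2" "F1 \<inter> F2 = {}" "F1 \<union> F2 = F" and c: "1 \<le> cnt F1 {c}"
      and r: "r \<in> R" "1 \<le> cnt F1 {r}" and cd: "c \<noteq> d" "c \<in> {a, b}" "d \<in> {a, b}" for F1 F2 c d r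
  proof (rule ccontr)
    assume "\<not> ?thesis"
    then have "cyclic (insert d F2)" using cyc1 S cd by auto
    moreover have "cyclic (F1 \<union> {c, r})" using cyc2 S c r cd by blast
    moreover have "(F1 \<union> {c, r}) \<inter> insert d F2 = {}" using S r cd V by blast
    ultimately show False using cyclic_meet by blast
  qed
  \<comment> \<open>Either one half sends at most one edge to each of \<open>a\<close> and
    \<open>b\<close>, or one of \<open>a\<close>, \<open>b\<close> receives at most one edge from
    each half. By \<open>meet\<close> below, these cases are exhaustive up to exchanging the halves
    and exchanging \<open>a\<close> with \<open>b\<close>.\<close>
  have "False" if S: "conn F1" "conn F2" "F1 \<inter> F2 = {}" "F1 \<union> F2 = F" "2 \<le> card F1" "2 \<le> card F2"
      and ab: "{p, q} = {a, b}" and one: "cnt F1 {p} \<le> 1" and one': "cnt F1 {q} \<le> 1 \<or> cnt F2 {p} \<le> 1"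
    for F1 F2 p q
  proof -
    have fin: "finite F1" "finite F2" using S conn_props by blast+
    have S': "F2 \<inter> F1 = {}" "F2 \<union> F1 = F" using S by blast+
    have t: "cnt F' F' + 2 = 2 * card F'" if "conn F'" "F' \<subseteq> F" for F'
      by (rule tree_cnt[OF that(1)]) (use F that in blast)
    have cF: "card F = card F1 + card F2" using S fin card_Un_disjoint by blast
    have "cnt F F = cnt F1 F1 + cnt F2 F2 + 2 * cnt F1 F2" using cnt_Un_self S fin by blast
    moreover have sub: "F1 \<subseteq> F" "F2 \<subseteq> F" using S by blast+
    \<comment> \<open>All three sets are trees, so the edge counts leave exactly one edge between
      the halves.\<close>
    ultimately have "cnt F1 F2 = 1"
      using t[OF F(1) subset_refl] t[OF S(1) sub(1)] t[OF S(2) sub(2)] cF by linarith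
    moreover have "cnt F1 F = cnt F1 F1 + cnt F1 F2" "cnt F2 F = cnt F1 F2 + cnt F2 F2"
      using cnt_Un_right[OF fin S(3), of F1] cnt_Un_right[OF fin S(3), of F2]
      unfolding S(4) cnt_commute[of F2 F1] by blast+
    ultimately have cut: "cnt F1 F = 2 * card F1 - 1" "cnt F2 F = 2 * card F2 - 1"
      using t[OF S(1) sub(1)] t[OF S(2) sub(2)] by linarith+
    have pqab: "p = a \<and> q = b \<or> p = b \<and> q = a" using ab by (simp add: doubleton_eq_iff)
    then have pq: "p \<noteq> q" "p \<in> {a,b}" "q \<in> {a,b}" "p \<notin> F" "q \<notin> F"
      using V(2-4) by (elim disjE; simp)+
    \<comment> \<open>The degrees in \<open>F\<close> over one half sum to one less than twice its
      size. Hence each half contains a leaf of \<open>F\<close>, and leaves are adjacent to both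
      \<open>a\<close> and \<open>b\<close>.\<close>
    have leaf: "1 \<le> cnt F' {c}" if "F' = F1 \<or> F' = F2" "c = p \<or> c = q" for F' c
    proof -
      have "finite F'" "cnt F' F < 2 * card F'" "F' \<subseteq> F"
        using that(1) fin cut S(5,6) sub by (elim disjE; simp)+
      then obtain l where l: "l \<in> F'" "cnt {l} F \<le> 1" using leaf_exists by blast
      then have "adj l a \<and> adj l b" using leaves \<open>F' \<subseteq> F\<close> by blast
      then have "adj l c" using that(2) pqab by blast
      then show ?thesis using cnt_pos_iff[OF \<open>finite F'\<close>, of "{c}"] \<open>l \<in> F'\<close> by blast
    qed
    have many': "card F1 + card F2 + 2 \<le> cnt F1 {p} + cnt F2 {p} + cnt F1 {q} + cnt F2 {q}"
    proof -
      have "card F + 2 \<le> cnt F {p} + cnt F {q}" using many pqab by (elim disjE) simp_all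
      moreover have "cnt F {p} = cnt F1 {p} + cnt F2 {p}" "cnt F {q} = cnt F1 {q} + cnt F2 {q}"
        using cnt_Un_left[OF fin S(3)] S(4) by blast+
      ultimately show ?thesis using cF by linarith
    qed
    show False
    proof (cases "cnt F1 {q} \<le> 1")
      case True
      have "cnt F1 V = cnt F1 F + cnt F1 {a,b} + cnt F1 R"
      proof -
        have "F \<inter> {a, b} = {}" "(F \<union> {a, b}) \<inter> R = {}" using V by blast+
        then show ?thesis unfolding V(1)
          using fF fR cnt_Un_right[of F "{a, b}" F1] cnt_Un_right[of "F \<union> {a, b}" R F1] by simp
      qed
      moreover have "cnt F1 {a,b} = cnt F1 {p} + cnt F1 {q}"
        using cnt_doubleton[OF pq(1)] ab by simp
      moreover have "3 * card F1 \<le> cnt F1 V" by (rule sum_deg3) (use sub V(1) in blast)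
      \<comment> \<open>Of the degree sum, at least \<open>3 * card F1\<close>, at most
        \<open>2 * card F1 - 1\<close> stays in \<open>F\<close> and at most two go to
        \<open>a\<close> and \<open>b\<close>; since \<open>F1\<close> has two vertices, something
        is left for \<open>R\<close>.\<close>
      ultimately have "1 \<le> cnt F1 R" using one True cut(1) S(5) by linarith
      then obtain y r where "y \<in> F1" "r \<in> R" "adj y r" using cnt_pos_iff fin fR by blast
      then have r: "r \<in> R" "1 \<le> cnt F1 {r}" using cnt_pos_iff[of F1 "{r}"] fin by auto
      have "cnt F2 {q} \<le> 1"
        using disj[OF S(1-4) _ r, of p q] leaf[of F1 p] pq by auto
      moreover have "cnt F2 {p} \<le> 1"
        using disj[OF S(1-4) _ r, of q p] leaf[of F1 q] pq by auto
      ultimately show False using many' one True S by linarith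
    next
      case False
      then have "cnt F2 {p} \<le> 1" using one' by blast
      \<comment> \<open>Now \<open>p\<close> receives at most two edges from \<open>F\<close>, so at
        least \<open>card F\<close> arrive at \<open>q\<close>: every vertex of both halves is
        adjacent to \<open>q\<close>.\<close>
      then have full: "2 \<le> cnt F1 {q}" "2 \<le> cnt F2 {q}"
        using many' one S cnt_le_card_left[of F1 q] cnt_le_card_left[of F2 q] by linarith+
      obtain w r where w: "w \<in> F" "r \<in> R" "adj w r" using R cnt_pos_iff fF fR by blast
      then consider "1 \<le> cnt F1 {r}" | "1 \<le> cnt F2 {r}"
        using cnt_pos_iff[of F1 "{r}"] cnt_pos_iff[of F2 "{r}"] fin S by auto
      then show False
      proof cases
        case 1
        then show False
          using disj[OF S(1-4) _ w(2) 1, of p q] leaf[of F1 p] pq full by auto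
      next
        case 2
        then show False
          using disj[OF S(2,1) S' _ w(2) 2, of p q] leaf[of F2 p] pq full by auto
      qed
    qed
  qed note contra = this
  have meet: "cnt F1 {p} \<le> 1 \<or> cnt F2 {q} \<le> 1" if "{p, q} = {a, b}" for p q
  proof (rule ccontr)
    assume neg: "\<not> ?thesis"
    have pq: "p \<noteq> q" "p \<in> {a,b}" "q \<in> {a,b}" "p \<notin> F" "q \<notin> F" using that V by auto
    then have "cyclic (insert p F1)" "cyclic (insert q F2)" using neg cyc1 S by auto
    moreover have "insert p F1 \<inter> insert q F2 = {}" using pq S by blast
    ultimately show False using cyclic_meet by blast
  qed
  have ba: "{b, a} = {a, b}" by blast
  have S': "F2 \<inter> F1 = {}" "F2 \<union> F1 = F" using S by blast+
  show K33
    using meet[of a b] meet[OF ba]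
      contra[OF S, of a b] contra[OF S ba] contra[OF S(2,1) S' S(6,5), of a b]
      contra[OF S(2,1) S' S(6,5) ba] by blast
next
  have fF: "finite F" using F conn_props by blast
  assume "\<exists>x\<in>F. \<forall>y\<in>F - {x}. adj x y"
  then obtain x where x: "x \<in> F" "\<And>y. y \<in> F - {x} \<Longrightarrow> adj x y" by blast
  let ?L = "F - {x}"
  have FL: "F = insert x ?L" using x by blast
  have cx: "cnt {x} ?L = card ?L"
    using x(2) fF by (subst cnt_single_eq_card) (auto intro!: arg_cong[where f = card])
  have "cnt F F = cnt ?L ?L + 2 * cnt {x} ?L" using cnt_insert_self[of ?L x] FL fF by auto
  moreover have "card F = card ?L + 1" using x fF by (metis Suc_eq_plus1 card.remove)
  ultimately have "cnt ?L ?L = 0" using cx tree_cnt[OF F(1,2)] by linarith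
  have lL: "cnt {l} F \<le> 1" if "l \<in> ?L" for l
  proof -
    have "cnt {l} ?L \<le> cnt ?L ?L" using that fF by (intro cnt_mono) auto
    then have "cnt {l} ?L = 0" using \<open>cnt ?L ?L = 0\<close> by simp
    then show ?thesis using FL cnt_insert_right[of ?L x "{l}"] fF by auto
  qed
  show K33
  proof (rule K33I)
    have "x \<noteq> a" "x \<noteq> b" using V(3,4) x(1) by blast+
    then show "card {a, b, x} = 3" using V(2) by simp
    show "finite ?L" using fF by simp
    show "3 \<le> card ?L" using \<open>card F = card ?L + 1\<close> F by linarith
    fix u l assume "u \<in> {a, b, x}" "l \<in> ?L"
    then show "adj u l" using x leaves[of l] lL[of l] adj_sym by blast
  qed
qed

text \<open>The vertices off a shortest cycle span fewer edges than vertices, so one of them has at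
  most one neighbour off the cycle and two on it. It closes a cycle with either arc between these
  two; neither new cycle may be shorter, so the sum of the arc lengths is at most four.\<close>

lemma short_cycle:
  assumes dense: "4 * card V \<le> cnt V V + 2" and "V \<noteq> {}"
  obtains vs where "cyc_list vs" "length vs \<le> 4" "\<And>ws. cyc_list ws \<Longrightarrow> length vs \<le> length ws"
proof -
  have "2 * card V \<le> cnt V V"
    using sum_deg3[of V] by simp
  then have "cyclic V" using assms(2) by (simp add: cyclic_def)
  then obtain vs0 where "cyc_list vs0" using cyclic_imp_cyc_list by blast
  then obtain vs where vs: "cyc_list vs" and min: "\<And>ws. cyc_list ws \<Longrightarrow> length vs \<le> length ws"
    using exists_least_iff[of "\<lambda>n. \<exists>ws. cyc_list ws \<and> length ws = n"] by (metis not_less)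
  have minc: "length vs \<le> card U" if U: "cyclic U" for U
  proof -
    obtain ws where ws: "cyc_list ws" "set ws \<subseteq> U" using U cyclic_imp_cyc_list by blast
    then have "length ws \<le> card U"
      using cyclicD[OF U] card_mono[of U "set ws"] distinct_card[of ws] unfolding cyc_list_def by simp
    then show ?thesis using min[OF ws(1)] by simp
  qed
  have d: "distinct vs" "3 \<le> length vs" using vs by (simp_all add: cyc_list_def)
  have sv: "set vs \<subseteq> V" "successively adj vs" "adj (last vs) (hd vs)"
    using vs cyc_list_in_V cyc_list_successively cyc_list_wrap by auto
  define F where "F = V - set vs"
  have fF: "finite F" using finite_V by (simp add: F_def)
  have "F \<noteq> {}"
  proof
    assume "F = {}"
    then have Vs: "V = set vs" using sv F_def by blast
    obtain v where v: "v \<in> V" using assms(2) by blast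
    have cV: "card V = length vs" using Vs d distinct_card by metis
    have c: "card (V - {v}) + 1 = card V" using v finite_V by (metis Suc_eq_plus1 card.remove)
    \<comment> \<open>If the cycle covered \<open>V\<close>, the set without \<open>v\<close> would
      be too small to be cyclic and span fewer than \<open>card V - 1\<close> edges; the at most
      \<open>card V\<close> edges at \<open>v\<close> do not bring this up to
      \<open>2 * card V - 1\<close>.\<close>
    have "\<not> cyclic (V - {v})" using minc[of "V - {v}"] c cV by linarith
    moreover have "V - {v} \<noteq> {}"
    proof
      assume "V - {v} = {}"
      then have "card (V - {v}) = 0" by (metis card.empty)
      then show False using c cV d(2) by linarith
    qed
    ultimately have "cnt (V - {v}) (V - {v}) < 2 * card (V - {v})" by (simp add: cyclic_def)
    then show False
      using dense cnt_Diff_self[OF finite_V v] cnt_le_card_right[of v V] c by linarith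
  qed
  have "\<not> cyclic F" using cyclic_meet[OF cyc_list_cyclic[OF vs], of F] by (auto simp: F_def)
  then have "cnt F F < 2 * card F" using \<open>F \<noteq> {}\<close> by (auto simp: cyclic_def F_def)
  then obtain v where v: "v \<in> F" "cnt {v} F \<le> 1" using leaf_exists fF by blast
  have "V = set vs \<union> F" "set vs \<inter> F = {}" using sv by (auto simp: F_def)
  then have "cnt {v} V = cnt {v} (set vs) + cnt {v} F" using fF cnt_Un_right[of "set vs" F "{v}"] by simp
  then have "2 \<le> card {w \<in> set vs. adj v w}"
    using deg3[of v] v by (simp add: F_def flip: cnt_single_eq_card)
  then have "\<not> card {w \<in> set vs. adj v w} \<le> Suc 0" by simp
  then obtain x y where xy: "x \<in> set vs" "y \<in> set vs" "adj v x" "adj v y" "x \<noteq> y"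
    using card_le_Suc0_iff_eq[of "{w \<in> set vs. adj v w}"] by auto
  obtain i j where ij: "i < j" "j < length vs" "adj v (vs ! i)" "adj v (vs ! j)"
  proof -
    obtain k l where "k < length vs" "vs ! k = x" "l < length vs" "vs ! l = y"
      using xy by (metis in_set_conv_nth)
    then show thesis using that[of k l] that[of l k] xy by (metis linorder_neqE_nat)
  qed
  have short: "length vs \<le> length ws + 1"
    if ws: "successively adj ws" "distinct ws" "set ws \<subseteq> set vs" "2 \<le> length ws"
      "adj v (hd ws)" "adj v (last ws)" for ws
  proof -
    have "ws \<noteq> []" using ws(4) by auto
    then have c: "conn (set ws)" using path_conn ws sv by blast
    have "v \<notin> set ws" using v ws F_def by blast
    have "cyclic (insert v (set ws))"
    proof (rule attach1)
      show "2 \<le> cnt (set ws) {v}"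
      proof (rule two_le_cnt)
        show "hd ws \<noteq> last ws" using ws \<open>ws \<noteq> []\<close> by (cases ws) auto
        show "adj (hd ws) v" "adj (last ws) v" using ws adj_sym by blast+
      qed (use \<open>ws \<noteq> []\<close> in auto)
    qed (use conn_cnt[OF c] conn_props[OF c] v F_def ws in auto)
    then have "length vs \<le> card (insert v (set ws))" by (rule minc)
    then show ?thesis using \<open>v \<notin> set ws\<close> distinct_card[OF ws(2)] by simp
  qed
  have suc: "adj (vs ! k) (vs ! Suc k)" if "Suc k < length vs" for k
    using sv(2) that by (simp add: successively_conv_nth)
  have "length vs \<le> length (drop i (take (Suc j) vs)) + 1"
  proof (rule short)
    show "successively adj (drop i (take (Suc j) vs))"
      unfolding successively_conv_nth using suc ij by auto
    show "set (drop i (take (Suc j) vs)) \<subseteq> set vs"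
      by (meson set_drop_subset set_take_subset subset_trans)
    show "adj v (hd (drop i (take (Suc j) vs)))" using ij by (simp add: hd_drop_conv_nth)
    show "adj v (last (drop i (take (Suc j) vs)))" using ij by (simp add: take_Suc_conv_app_nth)
  qed (use ij d in auto)
  then have 1: "length vs \<le> j - i + 2" using ij by simp
  have 2: "length vs \<le> length vs - (j - i) + 2"
  proof -
    let ?ws = "drop j vs @ take (Suc i) vs"
    have "length vs \<le> length ?ws + 1"
    proof (rule short)
      have "successively adj (drop j vs)" "successively adj (take (Suc i) vs)"
        unfolding successively_conv_nth using suc ij by auto
      moreover have "last (drop j vs) = last vs" "hd (take (Suc i) vs) = hd vs"
        using ij by (auto simp: hd_take)
      ultimately show "successively adj ?ws" using sv(3) ij by (auto simp: successively_append_iff)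
      show "distinct ?ws"
        using d(1) ij by (auto simp: set_take_disj_set_drop_if_distinct inf_commute)
          (metis Suc_leI disjoint_iff set_take_disj_set_drop_if_distinct)
      show "set ?ws \<subseteq> set vs" using set_drop_subset set_take_subset by fastforce
      show "adj v (hd ?ws)" using ij by (simp add: hd_drop_conv_nth hd_append)
      show "adj v (last ?ws)" using ij by (simp add: take_Suc_conv_app_nth)
      show "2 \<le> length ?ws" using ij by simp
    qed
    then show ?thesis using ij by simp
  qed
  have "length vs \<le> 4" using 1 2 ij by linarith
  then show thesis using that vs min by blast
qed

text \<open>The degree sum over the component is at least \<open>3 * card K\<close>, but a tree
  absorbs only \<open>2 * card K - 2\<close> of it; the rest must go to
  \<open>V - F\<close>.\<close>

lemma component_edges:
  assumes "F \<subseteq> V" "K \<subseteq> F" "conn K" "\<And>U. U \<subseteq> F \<Longrightarrow> \<not> cyclic U"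
    and closed: "\<And>u w. u \<in> K \<Longrightarrow> w \<in> F - K \<Longrightarrow> \<not> adj u w"
  shows "card K + 2 \<le> cnt K (V - F)"
proof -
  have fin: "finite V" "finite F" "finite K"
    using finite_V finite_subset[OF assms(1) finite_V] finite_subset[OF assms(2)] by blast+
  have V: "V = (K \<union> (F - K)) \<union> (V - F)" using assms(1,2) by blast
  have "cnt K V = cnt K (K \<union> (F - K)) + cnt K (V - F)"
    using cnt_Un_right[of "K \<union> (F - K)" "V - F" K] V fin assms(2) by auto
  also have "cnt K (K \<union> (F - K)) = cnt K K + cnt K (F - K)"
    using cnt_Un_right[of K "F - K" K] fin by blast
  also have "cnt K (F - K) = 0" by (rule cnt_zeroI) (use closed in blast)
  finally have "cnt K V = cnt K K + cnt K (V - F)" by simp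
  moreover have "cnt K K + 2 = 2 * card K" by (rule tree_cnt[OF assms(3)]) (use assms in blast)
  moreover have "3 * card K \<le> cnt K V" using sum_deg3 assms by blast
  ultimately show ?thesis by linarith
qed

lemma conn_or_two_components:
  assumes F: "F \<subseteq> V" "u \<in> F" and acyclic: "\<And>U. U \<subseteq> F \<Longrightarrow> \<not> cyclic U" and "\<not> conn F"
  obtains K K' where "conn K" "conn K'" "K \<subseteq> F" "K' \<subseteq> F" "K \<inter> K' = {}" "u \<in> K"
    "\<And>v. v \<in> F \<Longrightarrow> adj u v \<Longrightarrow> v \<in> K"
    "card K + 2 \<le> cnt K (V - F)" "card K' + 2 \<le> cnt K' (V - F)"
proof -
  obtain K where K: "K \<subseteq> F" "conn K" "u \<in> K" "\<And>x w. x \<in> K \<Longrightarrow> w \<in> F - K \<Longrightarrow> \<not> adj x w"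
    using maximal_conn[OF F] by blast
  have "K \<noteq> F" using K(2) assms(4) by blast
  then obtain w where w: "w \<in> F" "w \<notin> K" using K(1) by blast
  obtain K' where K': "K' \<subseteq> F" "conn K'" "w \<in> K'" "\<And>x w. x \<in> K' \<Longrightarrow> w \<in> F - K' \<Longrightarrow> \<not> adj x w"
    using maximal_conn[OF F(1) w(1)] by blast
  have "K \<inter> K' = {} \<or> K \<inter> K' = K'"
    by (rule conn_closed[OF K'(2)]) (use K(4) K'(1) in blast)+
  then have "K \<inter> K' = {}" using w K'(3) by blast
  moreover have "card K + 2 \<le> cnt K (V - F)" by (rule component_edges[OF F(1) K(1,2) acyclic K(4)])
  moreover have "card K' + 2 \<le> cnt K' (V - F)" by (rule component_edges[OF F(1) K'(1,2) acyclic K'(4)])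
  moreover have "v \<in> K" if "v \<in> F" "adj u v" for v using K(3,4) that by blast
  ultimately show thesis using that[of K K'] K(1-3) K'(1,2) by blast
qed

section \<open>The complement of a triangle or of a four-cycle\<close>

lemma cnt_three: "a \<noteq> b \<Longrightarrow> b \<noteq> c \<Longrightarrow> a \<noteq> c \<Longrightarrow> cnt U {a, b, c} = cnt U {a} + cnt U {b} + cnt U {c}"
  using cnt_insert_right[of "{b, c}" a U] cnt_doubleton[of b c U] by simp

lemma cnt_four:
  "distinct [a, b, c, d] \<Longrightarrow> cnt U {a, b, c, d} = cnt U {a} + cnt U {b} + cnt U {c} + cnt U {d}"
  using cnt_insert_right[of "{b, c, d}" a U] cnt_three[of b c d U] by simp

text \<open>Deleting a leaf loses at most one edge, so the edge count of a tree is preserved. This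
  count is exactly what \<open>attach1\<close> asks of the remaining set.\<close>

lemma Diff_leaf:
  assumes "conn F" "l \<in> F" "cnt {l} F \<le> 1" "2 \<le> card F"
  shows "F - {l} \<subseteq> V" "F - {l} \<noteq> {}" "2 * card (F - {l}) \<le> cnt (F - {l}) (F - {l}) + 2"
proof -
  have f: "finite F" "F \<subseteq> V" using assms conn_props by blast+
  have c: "card F = card (F - {l}) + 1" using assms f by (metis Suc_eq_plus1 card.remove)
  show "F - {l} \<subseteq> V" using f by blast
  show "2 * card (F - {l}) \<le> cnt (F - {l}) (F - {l}) + 2"
    using cnt_Diff_self[OF f(1) assms(2)] conn_cnt[OF assms(1)] c assms(3) by linarith
  show "F - {l} \<noteq> {}"
  proof
    assume "F - {l} = {}"
    then have "card (F - {l}) = 0" by (metis card.empty)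
    then show False using c assms(4) by linarith
  qed
qed

lemma cnt_Diff_leaf: "finite F \<Longrightarrow> l \<in> F \<Longrightarrow> cnt F W = cnt {l} W + cnt (F - {l}) W"
  using cnt_insert_left[of "F - {l}" l W] by (simp add: insert_absorb)

text \<open>Let \<open>K\<close> be the component of the given edge and \<open>K'\<close> another
  one. If \<open>K\<close> sent two edges to a vertex \<open>x\<close> of the triangle, then
  \<open>K\<close> with \<open>x\<close> would be cyclic; at most \<open>card K'\<close> of the
  \<open>card K' + 2\<close> edges from \<open>K'\<close> go to \<open>x\<close>, so
  \<open>K'\<close> with the other two vertices would be cyclic too. So \<open>K\<close> sends at
  most three edges, while its two vertices demand four.\<close>

lemma triangle_compl_conn:
  assumes tri: "adj a b" "adj b c" "adj a c" and uw: "u \<in> V - {a, b, c}" "w \<in> V - {a, b, c}" "adj u w"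
  shows "conn (V - {a, b, c})"
proof (rule ccontr)
  assume neg: "\<not> ?thesis"
  let ?F = "V - {a, b, c}"
  have T: "cyclic {a, b, c}" using cyc_list_cyclic[OF triangle_cyc_list[of a b c]] tri adj_sym by simp
  have dist: "a \<noteq> b" "b \<noteq> c" "a \<noteq> c" using tri adj_irrefl by blast+
  have VT: "V - ?F = {a, b, c}" using tri adj_in_V by blast
  have "?F \<subseteq> V" by blast
  moreover have "\<not> cyclic U" if "U \<subseteq> ?F" for U using cyclic_meet[OF T, of U] that by blast
  ultimately obtain K K' where K: "conn K" "conn K'" "K \<subseteq> ?F" "K' \<subseteq> ?F" "K \<inter> K' = {}" "u \<in> K"
    "\<And>v. v \<in> ?F \<Longrightarrow> adj u v \<Longrightarrow> v \<in> K"
    "card K + 2 \<le> cnt K {a, b, c}" "card K' + 2 \<le> cnt K' {a, b, c}"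
    using conn_or_two_components[OF _ uw(1) _ neg] unfolding VT by metis
  have fin: "finite K" "finite K'" using K conn_props by blast+
  have "u \<noteq> w" using uw adj_irrefl by blast
  then have "card {u, w} = 2" by simp
  moreover have "{u, w} \<subseteq> K" using K(6) K(7)[OF uw(2,3)] by blast
  ultimately have "2 \<le> card K" using card_mono[OF fin(1)] by metis
  have step: "cnt K {x} \<le> 1" if xyz: "{x, y, z} = {a, b, c}" "x \<noteq> y" "y \<noteq> z" "x \<noteq> z" "adj y z" for x y z
  proof (rule ccontr)
    assume two: "\<not> ?thesis"
    have xV: "x \<in> V" "x \<notin> ?F" "y \<notin> ?F" "z \<notin> ?F" using xyz(1) VT by blast+
    have "cyclic (insert x K)"
    proof (rule attach1)
      show "x \<in> V - K" using xV K(3) by blast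
    qed (use K(1) conn_cnt[OF K(1)] conn_props[OF K(1)] two in auto)
    moreover have "cyclic (K' \<union> {y, z})"
    proof (rule attach2)
      show "2 \<le> cnt K' {y, z}"
        using K(9) cnt_three[OF xyz(2-4), of K'] cnt_doubleton[OF xyz(3), of K'] cnt_le_card_left[of K' x]
        unfolding xyz(1) by linarith
      show "y \<notin> K'" "z \<notin> K'" using xV K(4) by blast+
    qed (use K(2) conn_cnt[OF K(2)] conn_props[OF K(2)] xyz in auto)
    moreover have "insert x K \<inter> (K' \<union> {y, z}) = {}" using xV K(3-5) xyz(2,4) by blast
    ultimately show False using cyclic_meet by blast
  qed
  have "cnt K {a} \<le> 1" by (rule step[of a b c]) (use dist tri in auto)
  moreover have "cnt K {b} \<le> 1" by (rule step[of b a c]) (use dist tri in auto)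
  moreover have "cnt K {c} \<le> 1" by (rule step[of c a b]) (use dist tri in auto)
  ultimately show False using K(8) cnt_three[OF dist, of K] \<open>2 \<le> card K\<close> by linarith
qed

lemma triangle_compl_indep:
  assumes tri: "adj a b" "adj b c" "adj a c" and "6 \<le> card V"
    and indep: "\<And>u w. u \<in> V - {a, b, c} \<Longrightarrow> w \<in> V - {a, b, c} \<Longrightarrow> \<not> adj u w"
  shows K33
proof (rule K33I)
  have dist: "a \<noteq> b" "b \<noteq> c" "a \<noteq> c" using tri adj_irrefl by blast+
  have sub: "{a, b, c} \<subseteq> V" using tri adj_in_V by blast
  show c3: "card {a, b, c} = 3" using dist by simp
  show "finite (V - {a, b, c})" using finite_V by simp
  show "3 \<le> card (V - {a, b, c})" using assms(4) c3 card_Diff_subset[OF _ sub] by simp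
  fix x u assume x: "x \<in> {a, b, c}" and u: "u \<in> V - {a, b, c}"
  have "cnt {u} V = cnt {u} {a, b, c} + cnt {u} (V - {a, b, c})"
  proof -
    have "V = {a, b, c} \<union> (V - {a, b, c})" using sub by blast
    moreover have "cnt {u} ({a, b, c} \<union> (V - {a, b, c})) = cnt {u} {a, b, c} + cnt {u} (V - {a, b, c})"
      by (rule cnt_Un_right) (auto simp: finite_V)
    ultimately show ?thesis by argo
  qed
  moreover have "cnt {u} (V - {a, b, c}) = 0" by (rule cnt_zeroI) (use indep u in blast)
  ultimately have "3 \<le> cnt {u} {a} + cnt {u} {b} + cnt {u} {c}"
    using deg3[of u] u cnt_three[OF dist, of "{u}"] by simp
  then have "adj u a" "adj u b" "adj u c" by (simp_all add: of_bool_def split: if_splits)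
  then show "adj x u" using x adj_sym by blast
qed

text \<open>With \<open>m\<close> vertices in the tree \<open>F\<close> and \<open>c\<close> edges
  from it to the triangle, density reads 4 (m + 3) \<le> (2 m - 2) + 6 + 2 c + 2, whence c \<ge> m +
  3.\<close>

lemma triangle_dense:
  assumes tri: "adj a b" "adj b c" "adj a c" and F: "F = V - {a, b, c}" "conn F"
    and dense: "4 * card V \<le> cnt V V + 2"
  shows "card F + 3 \<le> cnt F {a} + cnt F {b} + cnt F {c}" "card V = card F + 3"
    "cnt F F + 2 = 2 * card F" "\<And>U. U \<subseteq> F \<Longrightarrow> \<not> cyclic U"
    "\<And>v. v \<in> V \<Longrightarrow> 3 \<le> cnt {v} F + cnt {v} {a} + cnt {v} {b} + cnt {v} {c}"
proof -
  have dist: "a \<noteq> b" "b \<noteq> c" "a \<noteq> c" using tri adj_irrefl by blast+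
  have sub: "{a, b, c} \<subseteq> V" using tri adj_in_V by blast
  have fF: "finite F" using F finite_V by simp
  have V: "V = F \<union> {a, b, c}" "F \<inter> {a, b, c} = {}" using sub F by blast+
  have c3: "card {a, b, c} = 3" using dist by simp
  then show cV: "card V = card F + 3" using V fF card_Un_disjoint[of F "{a, b, c}"] by simp
  have T: "cyclic {a, b, c}" using cyc_list_cyclic[OF triangle_cyc_list[of a b c]] tri adj_sym by simp
  show ac: "\<not> cyclic U" if "U \<subseteq> F" for U using cyclic_meet[OF T, of U] that F by blast
  show tF: "cnt F F + 2 = 2 * card F" by (rule tree_cnt[OF F(2) ac])
  have "cnt {a, b, c} {a, b, c} = 6"
    using tri dist cnt_insert_self[of "{b, c}" a] cnt_insert_self[of "{c}" b] cnt_doubleton[of b c "{a}"]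
    by (simp add: adj_irrefl)
  moreover have "cnt V V = cnt F F + cnt {a, b, c} {a, b, c} + 2 * cnt F {a, b, c}"
    using cnt_Un_self[OF fF _ V(2)] V(1) by simp
  ultimately show "card F + 3 \<le> cnt F {a} + cnt F {b} + cnt F {c}"
    using dense cV tF cnt_three[OF dist, of F] by linarith
  fix v assume "v \<in> V"
  then show "3 \<le> cnt {v} F + cnt {v} {a} + cnt {v} {b} + cnt {v} {c}"
    using deg3[of v] cnt_Un_right[OF fF _ V(2), of "{v}"] V(1) cnt_three[OF dist, of "{v}"] by simp
qed

text \<open>The leaf closes a triangle with \<open>y\<close> and \<open>z\<close>, so the rest of
  the tree sends at most one edge to \<open>x\<close>. Nearly all of the \<open>card F + 3\<close>
  edges then end in \<open>y\<close> and \<open>z\<close>, which is the surplus that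
  \<open>star_lemma\<close> consumes.\<close>

lemma K33_of_triangle_leaf:
  assumes tri: "adj x y" "adj y z" "adj x z" and F: "F = V - {x, y, z}" "conn F"
    and dense: "4 * card V \<le> cnt V V + 2" and "7 \<le> card V"
    and l0: "l0 \<in> F" "cnt {l0} F \<le> 1" "adj l0 y" "adj l0 z"
  shows K33
proof -
  note D = triangle_dense[OF tri F dense]
  have dist: "x \<noteq> y" "y \<noteq> z" "x \<noteq> z" using tri adj_irrefl by blast+
  have sub: "{x, y, z} \<subseteq> V" using tri adj_in_V by blast
  have fF: "finite F" using F finite_V by simp
  have m: "4 \<le> card F" using D(2) assms(7) by linarith
  have pair: "cnt (F - {l}) {p} \<le> 1"
    if l: "l \<in> F" "cnt {l} F \<le> 1" and pqr: "adj l q" "adj l r" "adj q r" "{p, q, r} = {x, y, z}" "p \<noteq> q" "p \<noteq> r"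
    for l p q r
  proof (rule ccontr)
    assume two: "\<not> ?thesis"
    have out: "p \<in> V" "p \<notin> F" "q \<notin> F" "r \<notin> F" using pqr(4) F(1) sub by blast+
    have c: "2 \<le> card F" using m by linarith
    have "cyclic (insert p (F - {l}))"
      by (rule attach1[OF Diff_leaf[OF F(2) l c]]) (use out two in auto)
    moreover have "cyclic {l, q, r}"
      using cyc_list_cyclic[OF triangle_cyc_list[of l q r]] pqr adj_sym[of l r] by simp
    moreover have "insert p (F - {l}) \<inter> {l, q, r} = {}" using out l pqr by blast
    ultimately show False using cyclic_meet by blast
  qed
  \<comment> \<open>A leaf adjacent to the whole triangle would leave each of its vertices at most
    two edges from \<open>F\<close>, six in all; with seven vertices in \<open>V\<close> there are
    at least seven.\<close>
  have not3: "\<not> (adj l x \<and> adj l y \<and> adj l z)" if l: "l \<in> F" "cnt {l} F \<le> 1" for l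
  proof
    assume a: "adj l x \<and> adj l y \<and> adj l z"
    have "cnt (F - {l}) {x} \<le> 1" by (rule pair[OF l, of y z]) (use a tri dist in auto)
    moreover have "cnt (F - {l}) {y} \<le> 1" by (rule pair[OF l, of x z]) (use a tri dist in auto)
    moreover have "cnt (F - {l}) {z} \<le> 1" by (rule pair[OF l, of x y]) (use a tri dist in auto)
    moreover have le: "cnt F {p} \<le> 1 + cnt (F - {l}) {p}" for p
      using cnt_Diff_leaf[OF fF l(1), of "{p}"] by (simp add: of_bool_def split: if_splits)
    ultimately show False using D(1) m le[of x] le[of y] le[of z] by linarith
  qed
  have miss: "cnt F {p} \<le> 1"
    if l: "l \<in> F" "cnt {l} F \<le> 1" and pqr: "adj l q" "adj l r" "adj q r" "{p, q, r} = {x, y, z}" "p \<noteq> q" "p \<noteq> r"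
    for l p q r
  proof -
    have "\<not> adj l p"
    proof
      assume "adj l p"
      then have "\<forall>t\<in>{p, q, r}. adj l t" using pqr(1,2) by simp
      then show False using not3[OF l] unfolding pqr(4) by simp
    qed
    then show ?thesis using pair[OF l pqr] cnt_Diff_leaf[OF fF l(1), of "{p}"] by simp
  qed
  have cx: "cnt F {x} \<le> 1" by (rule miss[OF l0(1,2), of y z]) (use l0 tri dist in auto)
  show K33
  proof (rule star_lemma[of F y z "{x}"])
    show "V = F \<union> {y, z} \<union> {x}" using F(1) sub by blast
    show "card F + 2 \<le> cnt F {y} + cnt F {z}" using D(1) cx by linarith
    show "1 \<le> cnt F {x}"
      using D(5)[of x] sub tri dist cnt_commute[of F "{x}"] adj_irrefl[of x] by simp
    fix l assume l: "l \<in> F" "cnt {l} F \<le> 1"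
    have lV: "l \<in> V" using l F by blast
    have two: "adj l x \<and> adj l y \<or> adj l x \<and> adj l z \<or> adj l y \<and> adj l z"
      using D(5)[OF lV] l(2) by (simp add: of_bool_def split: if_splits)
    \<comment> \<open>A leaf on another pair would limit a second triangle vertex to one edge, and
      the third cannot receive more than \<open>card F\<close>: at most \<open>card F + 2\<close> in
      total.\<close>
    show "adj l y \<and> adj l z"
    proof (rule ccontr)
      assume "\<not> ?thesis"
      then have "adj l x \<and> adj l y \<or> adj l x \<and> adj l z" using two by blast
      then show False
      proof
        assume a: "adj l x \<and> adj l y"
        have "cnt F {z} \<le> 1" by (rule miss[OF l, of x y]) (use a tri dist in auto)
        then show False using D(1) cx cnt_le_card_left[of F y] by linarith
      next
        assume a: "adj l x \<and> adj l z"
        have "cnt F {y} \<le> 1" by (rule miss[OF l, of x z]) (use a tri dist in auto)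
        then show False using D(1) cx cnt_le_card_left[of F z] by linarith
      qed
    qed
  next
    fix r assume "r \<in> {x}" then show "adj r y \<and> adj r z" using tri by simp
  qed (use F(1) D(4) m dist F(2) in auto)
qed

lemma K33_of_triangle:
  assumes tri: "adj a b" "adj b c" "adj a c"
    and dense: "4 * card V \<le> cnt V V + 2" and "7 \<le> card V"
  shows K33
proof (cases "\<exists>u\<in>V - {a, b, c}. \<exists>w\<in>V - {a, b, c}. adj u w")
  case False
  show ?thesis by (rule triangle_compl_indep[OF tri]) (use assms(5) False in auto)
next
  case True
  then obtain u w where uw: "u \<in> V - {a, b, c}" "w \<in> V - {a, b, c}" "adj u w" by blast
  define F where "F = V - {a, b, c}"
  have cF: "conn F" unfolding F_def by (rule triangle_compl_conn[OF tri uw])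
  note D = triangle_dense[OF tri F_def cF dense]
  have fF: "finite F" using F_def finite_V by simp
  obtain l where l: "l \<in> F" "cnt {l} F \<le> 1" using leaf_exists[OF fF, of F] D(3) by auto
  then have "l \<in> V" by (simp add: F_def)
  then have "adj l a \<and> adj l b \<or> adj l a \<and> adj l c \<or> adj l b \<and> adj l c"
    using D(5)[of l] l(2) by (simp add: of_bool_def split: if_splits)
  moreover have sym: "adj b a" "adj c b" "adj c a" using tri adj_sym by blast+
  moreover have "F = V - {b, a, c}" "F = V - {c, a, b}" unfolding F_def by blast+
  ultimately show ?thesis
    using K33_of_triangle_leaf[OF tri F_def cF dense assms(5) l]
      K33_of_triangle_leaf[OF _ _ _ _ cF dense assms(5) l, of b a c]
      K33_of_triangle_leaf[OF _ _ _ _ cF dense assms(5) l, of c a b] tri by blast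
qed

text \<open>The tree outside the triangle is a path with middle vertex \<open>q\<close>, which
  leaves nine unknown adjacencies to the triangle. Six patterns are excluded by disjoint triangles,
  three yield K_{3,3}, and every other one violates a degree or the edge count.\<close>

lemma K33_of_triangle_six:
  assumes tri: "adj a b" "adj b c" "adj a c"
    and dense: "4 * card V \<le> cnt V V + 2" and "card V = 6"
  shows K33
proof (cases "\<exists>u\<in>V - {a, b, c}. \<exists>w\<in>V - {a, b, c}. adj u w")
  case False
  show ?thesis by (rule triangle_compl_indep[OF tri]) (use assms(5) False in auto)
next
  case True
  then obtain u w where uw: "u \<in> V - {a, b, c}" "w \<in> V - {a, b, c}" "adj u w" by blast
  define F where "F = V - {a, b, c}"
  have cF: "conn F" unfolding F_def by (rule triangle_compl_conn[OF tri uw])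
  note D = triangle_dense[OF tri F_def cF dense]
  have fF: "finite F" using F_def finite_V by simp
  have c3: "card F = 3" using D(2) assms(5) by linarith
  have nosplit: False if "F1 \<inter> F2 = {}" "F1 \<union> F2 = F" "2 \<le> card F1" "2 \<le> card F2" for F1 F2
  proof -
    have "finite F1" "finite F2" using that(2) fF by auto
    then have "card F = card F1 + card F2" using card_Un_disjoint that by blast
    then show False using that c3 by linarith
  qed
  have "3 \<le> card F" using c3 by simp
  from tree_split_or_star[OF cF D(4) this] obtain q where q: "q \<in> F" "\<And>y. y \<in> F - {q} \<Longrightarrow> adj q y"
    using nosplit by blast
  have "card (F - {q}) = 2" using q fF c3 by simp
  then obtain p r where pr: "F - {q} = {p, r}" "p \<noteq> r" by (meson card_2_iff)
  have Fq: "F = {p, q, r}" "p \<noteq> q" "q \<noteq> r" using pr q by auto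
  have qp: "adj q p" "adj q r" using q(2) pr by auto
  have "\<not> adj p r"
  proof
    assume "adj p r"
    then have "cyclic {p, q, r}"
      using cyc_list_cyclic[OF triangle_cyc_list[of p q r]] qp adj_sym[of q p] adj_sym[of p r] by simp
    then show False using D(4)[of "{p, q, r}"] Fq by simp
  qed
  then have nrp: "\<not> adj p r" "\<not> adj r p" using adj_sym[of r p] by blast+
  have pq: "adj p q" "adj r q" using qp adj_sym by blast+
  have out: "{p, q, r} \<inter> {a, b, c} = {}" using Fq F_def by blast
  have dist: "a \<noteq> b" "b \<noteq> c" "a \<noteq> c" using tri adj_irrefl by blast+
  have inV: "p \<in> V" "q \<in> V" "r \<in> V" "a \<in> V" "b \<in> V" "c \<in> V" using Fq F_def tri adj_in_V by blast+
  have cF3: "cnt U F = cnt U {p} + cnt U {q} + cnt U {r}" for U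
    using cnt_three[of p q r U] Fq pr by simp
  have cF3': "cnt F {t} = of_bool (adj p t) + of_bool (adj q t) + of_bool (adj r t)" for t
    using cF3[of "{t}"] by (simp add: cnt_commute[of F] adj_commute[of t])
  have sum: "6 \<le> cnt F {a} + cnt F {b} + cnt F {c}" using D(1) c3 by linarith
  have degs: "2 \<le> cnt {p} {a} + cnt {p} {b} + cnt {p} {c}" "2 \<le> cnt {r} {a} + cnt {r} {b} + cnt {r} {c}"
    "1 \<le> cnt {q} {a} + cnt {q} {b} + cnt {q} {c}" "1 \<le> cnt F {a}" "1 \<le> cnt F {b}" "1 \<le> cnt F {c}"
    using D(5)[of p] D(5)[of r] D(5)[of q] D(5)[of a] D(5)[of b] D(5)[of c] inV qp pq nrp tri
      adj_sym[OF tri(1)] adj_sym[OF tri(2)] adj_sym[OF tri(3)]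
    by (simp_all add: cF3 adj_irrefl cnt_commute[of F])
  have cyc: "\<not> (adj e x \<and> adj q x \<and> adj f y \<and> adj f z)"
    if ef: "{e, f} = {p, r}" and xyz: "{x, y, z} = {a, b, c}" "adj y z" "x \<noteq> y" "x \<noteq> z" for e f x y z
  proof
    assume h: "adj e x \<and> adj q x \<and> adj f y \<and> adj f z"
    have ef': "adj e q" "e \<noteq> f" "q \<noteq> f" "e \<in> F" "f \<in> F" using ef pq pr Fq by (auto simp: doubleton_eq_iff)
    have "cyclic {e, q, x}"
      using cyc_list_cyclic[OF triangle_cyc_list[of e q x]] h ef' adj_sym[of e x] by simp
    moreover have "cyclic {f, y, z}"
      using cyc_list_cyclic[OF triangle_cyc_list[of f y z]] h xyz adj_sym[of f z] by simp
    moreover have "{e, q, x} \<inter> {f, y, z} = {}"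
    proof -
      have "{e, q} \<inter> {y, z} = {}" "x \<notin> {f}" using xyz(1) ef' q(1) F_def by blast+
      then show ?thesis using ef' xyz by auto
    qed
    ultimately show False using cyclic_meet by blast
  qed
  have sym: "adj b a" "adj c b" "adj c a" using tri adj_sym by blast+
  have perms: "{b, a, c} = {a, b, c}" "{c, a, b} = {a, b, c}" "{r, p} = {p, r}" by blast+
  \<comment> \<open>The sides are \<open>p\<close>, \<open>r\<close>, \<open>x\<close> and
    \<open>q\<close>, \<open>y\<close>, \<open>z\<close>: the path joins \<open>q\<close> to
    \<open>p\<close> and \<open>r\<close>, the triangle joins \<open>x\<close> to \<open>y\<close>
    and \<open>z\<close>, and the other five edges are assumed.\<close>
  have K: K33 if xyz: "{x, y, z} = {a, b, c}" "x \<noteq> y" "y \<noteq> z" "x \<noteq> z" "adj x y" "adj x z" "adj q x"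
      "adj p y" "adj p z" "adj r y" "adj r z" for x y z
  proof (rule K33I)
    have n: "x \<notin> F" "y \<notin> F" "z \<notin> F" using xyz(1) F_def by blast+
    then have "x \<notin> {p, r}" "q \<notin> {y, z}" unfolding Fq(1) by auto
    then show "card {p, r, x} = 3" using pr(2) by auto
    have "card {q, y, z} = 3" using \<open>q \<notin> {y, z}\<close> xyz(3) by simp
    then show "3 \<le> card {q, y, z}" by simp
    fix s t assume "s \<in> {p, r, x}" "t \<in> {q, y, z}"
    then show "adj s t" using pq xyz adj_sym[of q x] by auto
  qed simp
  have H: "adj q a \<Longrightarrow> adj p b \<Longrightarrow> adj p c \<Longrightarrow> adj r b \<Longrightarrow> adj r c \<Longrightarrow> K33"
    "adj q b \<Longrightarrow> adj p a \<Longrightarrow> adj p c \<Longrightarrow> adj r a \<Longrightarrow> adj r c \<Longrightarrow> K33"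
    "adj q c \<Longrightarrow> adj p a \<Longrightarrow> adj p b \<Longrightarrow> adj r a \<Longrightarrow> adj r b \<Longrightarrow> K33"
    using K[OF refl dist tri(1,3)] K[OF perms(1) dist(1)[symmetric] dist(3) dist(2) sym(1) tri(2)]
      K[OF perms(2) dist(3)[symmetric] dist(1) dist(2)[symmetric] sym(3,2)] by blast+
  have C': "\<not> (adj p a \<and> adj q a \<and> adj r b \<and> adj r c)" "\<not> (adj p b \<and> adj q b \<and> adj r a \<and> adj r c)"
    "\<not> (adj p c \<and> adj q c \<and> adj r a \<and> adj r b)" "\<not> (adj r a \<and> adj q a \<and> adj p b \<and> adj p c)"
    "\<not> (adj r b \<and> adj q b \<and> adj p a \<and> adj p c)" "\<not> (adj r c \<and> adj q c \<and> adj p a \<and> adj p b)"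
    using cyc[OF _ refl tri(2) dist(1,3)] cyc[OF _ perms(1) tri(3) dist(1)[symmetric] dist(2)]
      cyc[OF _ perms(2) tri(1) dist(3)[symmetric] dist(2)[symmetric]] perms(3) by blast+
  have degs': "adj p a \<and> adj p b \<or> adj p a \<and> adj p c \<or> adj p b \<and> adj p c"
    "adj r a \<and> adj r b \<or> adj r a \<and> adj r c \<or> adj r b \<and> adj r c"
    using degs(1,2) by (auto simp: of_bool_def split: if_splits)
  have sum': "6 \<le> (of_bool (adj p a) + of_bool (adj q a) + of_bool (adj r a)) +
      (of_bool (adj p b) + of_bool (adj q b) + of_bool (adj r b)) +
      (of_bool (adj p c) + of_bool (adj q c) + of_bool (adj r c) :: nat)"
    using sum unfolding cF3' .
  have degs'': "adj q a \<or> adj q b \<or> adj q c" "adj p a \<or> adj q a \<or> adj r a" "adj p b \<or> adj q b \<or> adj r b"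
    "adj p c \<or> adj q c \<or> adj r c"
    using degs(3-6) unfolding cF3' cnt_single by (auto simp: of_bool_def split: if_splits)
  show ?thesis
  proof (rule ccontr)
    assume nK: "\<not> K33"
    have H': "\<not> (adj q a \<and> adj p b \<and> adj p c \<and> adj r b \<and> adj r c)"
      "\<not> (adj q b \<and> adj p a \<and> adj p c \<and> adj r a \<and> adj r c)"
      "\<not> (adj q c \<and> adj p a \<and> adj p b \<and> adj r a \<and> adj r b)"
      using H nK by blast+
    show False
      using six_vertex_check[rule_format, OF conjI[OF sum' conjI[OF degs'(1) conjI[OF degs'(2)
              conjI[OF degs''(1) conjI[OF degs''(2) conjI[OF degs''(3) conjI[OF degs''(4)
                conjI[OF H'(1) conjI[OF H'(2) conjI[OF H'(3) conjI[OF C'(1) conjI[OF C'(2)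
                  conjI[OF C'(3) conjI[OF C'(4) conjI[OF C'(5) C'(6)]]]]]]]]]]]]]]]] .
  qed
qed

text \<open>Without triangles a vertex sees at most two vertices of the four-cycle, and then
  opposite ones. A leaf on one opposite pair starves the other pair, so all leaves use the same
  pair.\<close>

lemma K33_of_square:
  assumes notri: "\<And>x y z. adj x y \<Longrightarrow> adj y z \<Longrightarrow> \<not> adj x z"
    and sq: "adj a b" "adj b c" "adj c d" "adj d a" "a \<noteq> c" "b \<noteq> d"
    and dense: "4 * card V \<le> cnt V V + 2" and "6 \<le> card V"
  shows K33
proof -
  define F where "F = V - {a, b, c, d}"
  have fF: "finite F" using F_def finite_V by simp
  have sub: "{a, b, c, d} \<subseteq> V" using sq adj_in_V by blast
  have V: "V = F \<union> {a, b, c, d}" "F \<inter> {a, b, c, d} = {}" "V - F = {a, b, c, d}" "F \<subseteq> V"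
    using sub F_def by blast+
  have dist: "distinct [a, b, c, d]" using sq adj_irrefl by auto
  have c4: "card {a, b, c, d} = 4" using dist by simp
  have cV: "card V = card F + 4" using V fF card_Un_disjoint[of F "{a, b, c, d}"] c4 by simp
  have C: "cyclic {a, b, c, d}" using cyc_list_cyclic[OF square_cyc_list[OF sq]] by simp
  have ac: "\<not> cyclic U" if "U \<subseteq> F" for U using cyclic_meet[OF C, of U] that V by blast
  \<comment> \<open>Of two components each could send only one edge to any vertex of the four-cycle,
    and the degree count forces exactly one to each. Then one component closes a cycle with the side
    \<open>a b\<close> and the other with the side \<open>c d\<close>.\<close>
  have cF: "conn F"
  proof (rule ccontr)
    assume neg: "\<not> ?thesis"
    have "F \<noteq> {}" using cV assms(9) by (intro notI) simp
    then obtain u where "u \<in> F" by blast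
    then obtain K K' where K: "conn K" "conn K'" "K \<subseteq> F" "K' \<subseteq> F" "K \<inter> K' = {}"
      "card K + 2 \<le> cnt K {a, b, c, d}" "card K' + 2 \<le> cnt K' {a, b, c, d}"
      using conn_or_two_components[OF V(4) _ ac neg] unfolding V(3) by metis
    have one: "cnt K {p} \<le> 1"
      if K: "conn K" "conn K'" "K \<subseteq> F" "K' \<subseteq> F" "K \<inter> K' = {}" "card K' + 2 \<le> cnt K' {a, b, c, d}"
        and pqr: "{p, q, r, s} = {a, b, c, d}" "distinct [p, q, r, s]" "adj q r" "adj r s" for K K' p q r s
    proof (rule ccontr)
      assume two: "\<not> ?thesis"
      have out: "p \<in> V" "p \<notin> F" "q \<notin> F" "r \<notin> F" "s \<notin> F" using pqr(1) V by blast+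
      have "cyclic (insert p K)"
        by (rule attach1) (use conn_cnt[OF K(1)] conn_props[OF K(1)] out K(3) two in auto)
      moreover have "cyclic (K' \<union> {q, r, s})"
      proof (rule cyclic_join)
        have "adj r q" "adj s r" using pqr(3,4) adj_sym by blast+
        moreover have "conn {r, s}" using step[OF single[of s], of s r] calculation adj_V pqr by auto
        then have "conn {q, r, s}" using step[of "{r, s}" r q] calculation pqr by auto
        then show "2 * card {q, r, s} \<le> cnt {q, r, s} {q, r, s} + 2" "{q, r, s} \<subseteq> V"
          using conn_cnt conn_props by blast+
        show "2 \<le> cnt K' {q, r, s}"
          using K(6) cnt_insert_right[of "{q, r, s}" p K'] pqr(2) cnt_le_card_left[of K' p]
          unfolding pqr(1)[symmetric] by simp
        show "K' \<inter> {q, r, s} = {}" using out K(4) by blast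
      qed (use conn_cnt[OF K(2)] conn_props[OF K(2)] in auto)
      moreover have "insert p K \<inter> (K' \<union> {q, r, s}) = {}" using out K(3-5) pqr(2) by auto
      ultimately show False using cyclic_meet by blast
    qed
    have ones: "cnt K {a} = 1 \<and> cnt K {b} = 1 \<and> cnt K {c} = 1 \<and> cnt K {d} = 1"
      if K: "conn K" "conn K'" "K \<subseteq> F" "K' \<subseteq> F" "K \<inter> K' = {}" "card K' + 2 \<le> cnt K' {a, b, c, d}"
        and KC: "card K + 2 \<le> cnt K {a, b, c, d}" for K K'
    proof -
      have fK: "finite K" "K \<noteq> {}" using K conn_props by blast+
      have "cnt K {a} \<le> 1" by (rule one[OF K, of a b c d]) (use sq dist in auto)
      moreover have "cnt K {b} \<le> 1" by (rule one[OF K, of b c d a]) (use sq dist in auto)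
      moreover have "cnt K {c} \<le> 1" by (rule one[OF K, of c d a b]) (use sq dist in auto)
      moreover have "cnt K {d} \<le> 1" by (rule one[OF K, of d a b c]) (use sq dist in auto)
      moreover have s: "cnt K {a, b, c, d} = cnt K {a} + cnt K {b} + cnt K {c} + cnt K {d}"
        by (rule cnt_four[OF dist])
      moreover have "2 \<le> card K"
      proof (rule ccontr)
        assume "\<not> 2 \<le> card K"
        then obtain v where v: "K = {v}" using card_le_1_singleton[OF fK(1)] fK(2) by force
        have "\<not> (adj v a \<and> adj v b)" "\<not> (adj v c \<and> adj v d)" using notri sq(1,3) by blast+
        then have "cnt {v} {a} + cnt {v} {b} + cnt {v} {c} + cnt {v} {d} \<le> 2" by (auto simp: of_bool_def)
        then have "cnt K {a, b, c, d} \<le> 2" using s v by simp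
        then show False using KC v by simp
      qed
      ultimately show ?thesis using KC by linarith
    qed
    have "cyclic (K \<union> {a, b})"
    proof (rule attach2)
      show "2 \<le> cnt K {a, b}" using ones[OF K(1-5,7,6)] cnt_doubleton[of a b K] dist by simp
    qed (use conn_cnt[OF K(1)] conn_props[OF K(1)] sq K(3) V in auto)
    moreover have "cyclic (K' \<union> {c, d})"
    proof (rule attach2)
      have "K' \<inter> K = {}" using K(5) by blast
      then show "2 \<le> cnt K' {c, d}" using ones[OF K(2,1,4,3) _ K(6,7)] cnt_doubleton[of c d K'] dist by simp
    qed (use conn_cnt[OF K(2)] conn_props[OF K(2)] sq K(4) V in auto)
    moreover have "(K \<union> {a, b}) \<inter> (K' \<union> {c, d}) = {}" using K(3-5) V(2) dist by auto
    ultimately show False using cyclic_meet by blast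
  qed
  have tF: "cnt F F + 2 = 2 * card F" by (rule tree_cnt[OF cF ac])
  have cnt4: "cnt U {a, b, c, d} = cnt U {a} + cnt U {b} + cnt U {c} + cnt U {d}" for U
    by (rule cnt_four[OF dist])
  have two: "cnt {v} {a, b, c, d} \<le> 2" for v
  proof -
    have "\<not> (adj v a \<and> adj v b)" "\<not> (adj v c \<and> adj v d)" using notri sq(1,3) by blast+
    then show ?thesis unfolding cnt4 by (auto simp: of_bool_def)
  qed
  have sum2: "cnt U {a, b, c, d} \<le> 2 * card U" for U
  proof -
    have "(\<Sum>v\<in>U. cnt {v} {a, b, c, d}) \<le> (\<Sum>v\<in>U. 2)" by (rule sum_mono) (rule two)
    then show ?thesis by (simp add: cnt_sum[of U])
  qed
  have "cnt V V = cnt F F + cnt {a, b, c, d} {a, b, c, d} + 2 * cnt F {a, b, c, d}"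
    using cnt_Un_self[OF fF _ V(2)] V(1) by simp
  \<comment> \<open>With \<open>m = card F\<close> and \<open>c\<close> edges to the four-cycle,
    density reads 4 (m + 4) \<le> (2 m - 2) + 8 + 2 c + 2, so c \<ge> m + 4. As c \<le> 2 m, this
    also gives m \<ge> 4.\<close>
  then have FC: "card F + 4 \<le> cnt F {a, b, c, d}"
    using dense cV tF sum2[of "{a, b, c, d}"] c4 by linarith
  then have m: "4 \<le> card F" using sum2[of F] by linarith
  have degF: "3 \<le> cnt {v} F + cnt {v} {a, b, c, d}" if "v \<in> V" for v
    using deg3[OF that] cnt_Un_right[OF fF _ V(2), of "{v}"] V(1) by simp
  have leaf: "adj l a \<and> adj l c \<or> adj l b \<and> adj l d" if "l \<in> F" "cnt {l} F \<le> 1" for l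
  proof -
    have "2 \<le> cnt {l} {a, b, c, d}" using degF[of l] that V by auto
    moreover have "\<not> (adj l a \<and> adj l b)" "\<not> (adj l c \<and> adj l d)" "\<not> (adj l b \<and> adj l c)" "\<not> (adj l d \<and> adj l a)"
      using notri sq(1-4) by blast+
    ultimately show ?thesis unfolding cnt4 by (auto simp: of_bool_def split: if_splits)
  qed
  \<comment> \<open>The leaf with \<open>p\<close>, \<open>q\<close>, \<open>r\<close> is a
    four-cycle, so the rest of the tree sends at most one edge to \<open>s\<close>; the leaf sends
    none, as \<open>l\<close>, \<open>r\<close>, \<open>s\<close> would be a triangle.\<close>
  have miss: "cnt F {s} \<le> 1"
    if l: "l \<in> F" "cnt {l} F \<le> 1" and pqr: "adj l p" "adj l r" "adj p q" "adj q r" "adj r s"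
      "{p, q, r, s} = {a, b, c, d}" "distinct [p, q, r, s]" for l p q r s
  proof (rule ccontr)
    assume neg: "\<not> ?thesis"
    have out: "s \<in> V" "s \<notin> F" "p \<notin> F" "q \<notin> F" "r \<notin> F" using pqr(6) V by blast+
    have "\<not> adj l s" using notri[of l r s] pqr by blast
    then have "cnt (F - {l}) {s} = cnt F {s}" using cnt_Diff_leaf[OF fF l(1), of "{s}"] by simp
    then have "cyclic (insert s (F - {l}))"
      using attach1[OF Diff_leaf[OF cF l]] m neg out by auto
    moreover have "cyclic {l, p, q, r}"
      using cyc_list_cyclic[OF square_cyc_list[of l p q r]] pqr adj_sym[of l r] l out by auto
    moreover have "insert s (F - {l}) \<inter> {l, p, q, r} = {}" using out l pqr(7) by auto
    ultimately show False using cyclic_meet by blast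
  qed
  have finish: K33
    if l0: "l0 \<in> F" "cnt {l0} F \<le> 1" "adj l0 p" "adj l0 r"
      and pqr: "adj p q" "adj q r" "adj r s" "adj s p" "{p, q, r, s} = {a, b, c, d}" "distinct [p, q, r, s]"
      and leafs: "\<And>l. l \<in> F \<Longrightarrow> cnt {l} F \<le> 1 \<Longrightarrow> adj l p \<and> adj l r \<or> adj l q \<and> adj l s" for l0 p q r s
  proof -
    have sym: "adj q p" "adj r q" "adj s r" "adj p s" using pqr(1-4) adj_sym by blast+
    have cs: "cnt F {s} \<le> 1" by (rule miss[OF l0 pqr(1,2,3,5,6)])
    have perm: "{p, s, r, q} = {a, b, c, d}" "{q, r, s, p} = {a, b, c, d}" "{q, p, s, r} = {a, b, c, d}"
      using pqr(5) by blast+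
    \<comment> \<open>The same bound for \<open>q\<close>, reading the four-cycle in the other
      direction.\<close>
    have cq: "cnt F {q} \<le> 1" by (rule miss[OF l0 sym(4,3,2) perm(1)]) (use pqr(6) in auto)
    have many: "card F + 2 \<le> cnt F {p} + cnt F {r}"
      using FC cnt_four[OF pqr(6), of F] cs cq unfolding pqr(5) by linarith
    show K33
    proof (rule star_lemma[of F p r "{q, s}"])
      show "card F + 2 \<le> cnt F {p} + cnt F {r}" by (rule many)
      show "V = F \<union> {p, r} \<union> {q, s}" using V(1) pqr(5) by blast
      show "p \<notin> F" "r \<notin> F" using V(2) pqr(5) by blast+
      show "{q, s} \<inter> (F \<union> {p, r}) = {}" using V(2) pqr(5,6) by auto
      have "q \<in> V" using pqr adj_in_V by blast
      then have "1 \<le> cnt {q} F" using degF[of q] two[of q] by linarith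
      then show "1 \<le> cnt F {q, s}" using cnt_doubleton[of q s F] pqr(6) cnt_commute[of F "{q}"] by simp
      show "adj t p \<and> adj t r" if "t \<in> {q, s}" for t using that pqr sym by blast
      fix l assume l: "l \<in> F" "cnt {l} F \<le> 1"
      show "adj l p \<and> adj l r"
      proof (rule ccontr)
        assume "\<not> ?thesis"
        then have ls: "adj l q" "adj l s" using leafs[OF l] by blast+
        have "cnt F {p} \<le> 1" by (rule miss[OF l ls pqr(2-4) perm(2)]) (use pqr(6) in auto)
        moreover have "cnt F {r} \<le> 1" by (rule miss[OF l ls sym(1) sym(4) sym(3) perm(3)]) (use pqr(6) in auto)
        ultimately show False using many m by linarith
      qed
    qed (use cF ac m pqr(6) in auto)
  qed
  obtain l where l: "l \<in> F" "cnt {l} F \<le> 1" using leaf_exists[OF fF, of F] tF by auto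
  have perm: "{b, c, d, a} = {a, b, c, d}" by blast
  from leaf[OF l] show K33
  proof
    assume "adj l a \<and> adj l c"
    then show K33 using finish[OF l _ _ sq(1-4) refl dist] leaf by blast
  next
    assume h: "adj l b \<and> adj l d"
    show K33
    proof (rule finish[OF l _ _ sq(2-4,1) perm])
      show "adj l b" "adj l d" using h by auto
      show "adj l b \<and> adj l d \<or> adj l c \<and> adj l a" if "l \<in> F" "cnt {l} F \<le> 1" for l using leaf[OF that] by blast
    qed (use dist in auto)
  qed
qed

theorem dense_K33:
  assumes "6 \<le> card V" and dense: "4 * card V \<le> cnt V V + 2"
  shows K33
proof -
  have "V \<noteq> {}" using assms(1) by auto
  then obtain vs where vs: "cyc_list vs" "length vs \<le> 4" "\<And>ws. cyc_list ws \<Longrightarrow> length vs \<le> length ws"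
    using short_cycle[OF dense] by blast
  show K33
  proof (cases "\<exists>a b c. adj a b \<and> adj b c \<and> adj a c")
    case True
    then obtain a b c where tri: "adj a b" "adj b c" "adj a c" by blast
    show ?thesis
    proof (cases "card V = 6")
      case True
      show ?thesis by (rule K33_of_triangle_six[OF tri dense True])
    next
      case False
      show ?thesis by (rule K33_of_triangle[OF tri dense]) (use False assms(1) in simp)
    qed
  next
    case False
    have "length vs = 4"
    proof (rule ccontr)
      assume "length vs \<noteq> 4"
      then have "length vs = 3" using vs(1,2) unfolding cyc_list_def by linarith
      then obtain a b c where "vs = [a, b, c]" by (auto simp: length_Suc_conv numeral_eq_Suc)
      then have "adj a b" "adj b c" "adj c a" using vs(1) by (auto simp: cyc_list_def All_less_Suc)
      then show False using False adj_sym by blast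
    qed
    then obtain a b c d where v4: "vs = [a, b, c, d]" by (auto simp: length_Suc_conv numeral_eq_Suc)
    then have sq: "adj a b" "adj b c" "adj c d" "adj d a" "a \<noteq> c" "b \<noteq> d"
      using vs(1) by (auto simp: cyc_list_def All_less_Suc)
    show ?thesis by (rule K33_of_square[OF _ sq dense assms(1)]) (use False in blast)
  qed
qed

end

section \<open>Theta curves\<close>

text \<open>Arcs are kept as point sets: an edge is then the same from either end, and concatenation
  is a union.\<close>

definition arc_btw :: "complex set \<Rightarrow> complex \<Rightarrow> complex \<Rightarrow> bool" where
  "arc_btw S a b \<longleftrightarrow> (\<exists>g. arc g \<and> pathstart g = a \<and> pathfinish g = b \<and> path_image g = S)"

lemma arc_btw_sym: "arc_btw S a b \<Longrightarrow> arc_btw S b a"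
  unfolding arc_btw_def using arc_reversepath by (metis path_image_reversepath pathfinish_reversepath pathstart_reversepath)

lemma arc_btw_join:
  assumes "arc_btw S a b" "arc_btw T b c" "S \<inter> T \<subseteq> {b}"
  shows "arc_btw (S \<union> T) a c"
proof -
  obtain g h where "arc g" "pathstart g = a" "pathfinish g = b" "path_image g = S"
    "arc h" "pathstart h = b" "pathfinish h = c" "path_image h = T"
    using assms unfolding arc_btw_def by blast
  then show ?thesis unfolding arc_btw_def
    using assms(3) by (intro exI[of _ "g +++ h"]) (auto simp: arc_join path_image_join)
qed

lemma arc_btw_basic:
  assumes "arc_btw S a b"
  shows "a \<noteq> b" "a \<in> S" "b \<in> S" "closed S" "connected (S - {a, b})" "S - {a, b} \<noteq> {}"
    "S \<subseteq> closure (S - {a, b})" "connected (S - {a})"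
proof -
  obtain g where g: "arc g" "pathstart g = a" "pathfinish g = b" "path_image g = S"
    using assms unfolding arc_btw_def by blast
  have sp: "simple_path g" using g arc_imp_simple_path by blast
  show "a \<noteq> b" using g arc_distinct_ends by blast
  show "a \<in> S" "b \<in> S" using g pathstart_in_path_image pathfinish_in_path_image by blast+
  show "closed S" using g closed_arc_image by blast
  show c: "connected (S - {a, b})" using connected_simple_path_endless[OF sp] g by simp
  show "S - {a, b} \<noteq> {}" using nonempty_simple_path_endless[OF sp] g by simp
  have e: "g ` {0<..<1} = S - {a, b}" using simple_path_endless[OF sp] g by simp
  have "g ` closure {0<..<1} \<subseteq> closure (S - {a, b})"
  proof (rule image_closure_subset)
    show "continuous_on (closure {0<..<1}) g" using g(1) by (simp add: arc_def path_def)
    show "g ` {0<..<1} \<subseteq> closure (S - {a, b})" using e closure_subset by auto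
  qed simp
  then show cl: "S \<subseteq> closure (S - {a, b})" using g(4) by (auto simp: path_image_def)
  show "connected (S - {a})" by (rule connected_intermediate_closure[OF c]) (use cl in auto)
qed

lemma arc_btw_image:
  assumes "arc_btw S a b" "continuous_on S f" "inj_on f S"
  shows "arc_btw (f ` S) (f a) (f b)"
proof -
  obtain g where g: "arc g" "pathstart g = a" "pathfinish g = b" "path_image g = S"
    using assms unfolding arc_btw_def by blast
  have "arc (f \<circ> g)"
    unfolding arc_def
  proof
    show "path (f \<circ> g)" using g assms(2) path_continuous_image arc_imp_path by blast
    show "inj_on (f \<circ> g) {0..1}"
      using g assms(3) by (intro comp_inj_on) (auto simp: arc_def path_image_def)
  qed
  then show ?thesis unfolding arc_btw_def using g
    by (intro exI[of _ "f \<circ> g"]) (auto simp: pathstart_def pathfinish_def path_image_def)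
qed

lemma jordan_two_arcs:
  assumes "arc_btw S a b" "arc_btw T a b" "S \<inter> T = {a, b}"
  shows "inside (S \<union> T) \<noteq> {}" "open (inside (S \<union> T))" "connected (inside (S \<union> T))"
    "open (outside (S \<union> T))" "connected (outside (S \<union> T))" "bounded (inside (S \<union> T))"
    "inside (S \<union> T) \<inter> outside (S \<union> T) = {}" "inside (S \<union> T) \<union> outside (S \<union> T) = - (S \<union> T)"
    "frontier (inside (S \<union> T)) = S \<union> T" "frontier (outside (S \<union> T)) = S \<union> T"
proof -
  obtain g h where g: "arc g" "pathstart g = a" "pathfinish g = b" "path_image g = S"
    and h: "arc h" "pathstart h = a" "pathfinish h = b" "path_image h = T"
    using assms unfolding arc_btw_def by blast
  let ?c = "g +++ reversepath h"
  have "simple_path ?c"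
    using g h assms(3) arc_reversepath by (subst simple_path_join_loop_eq) auto
  moreover have "pathfinish ?c = pathstart ?c" "path_image ?c = S \<union> T"
    using g h by (simp_all add: path_image_join)
  ultimately show "inside (S \<union> T) \<noteq> {}" "open (inside (S \<union> T))" "connected (inside (S \<union> T))"
    "open (outside (S \<union> T))" "connected (outside (S \<union> T))" "bounded (inside (S \<union> T))"
    "inside (S \<union> T) \<inter> outside (S \<union> T) = {}" "inside (S \<union> T) \<union> outside (S \<union> T) = - (S \<union> T)"
    "frontier (inside (S \<union> T)) = S \<union> T" "frontier (outside (S \<union> T)) = S \<union> T"
    using Jordan_inside_outside[of ?c] by simp_all
qed

lemma connected_one_side:
  assumes "connected D" "open A" "open B" "A \<inter> B = {}" "D \<subseteq> A \<union> B"
  shows "D \<subseteq> A \<or> D \<subseteq> B"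
  using connectedD[OF assms(1-3)] assms(4,5) by blast

text \<open>The arc \<open>S3\<close> cuts the inside of the closed curve into a region bounded by
  \<open>S1\<close> and \<open>S3\<close> and one bounded by \<open>S2\<close> and
  \<open>S3\<close>. A connected \<open>D\<close> stays in one of them, and its closure then misses
  the inner points of the remaining arc.\<close>

lemma theta_inside:
  assumes arcs: "arc_btw S1 a b" "arc_btw S2 a b" "arc_btw S3 a b"
    and int: "S1 \<inter> S2 = {a, b}" "S1 \<inter> S3 = {a, b}" "S2 \<inter> S3 = {a, b}"
    and inside: "S3 - {a, b} \<subseteq> inside (S1 \<union> S2)"
    and D: "connected D" "D \<subseteq> inside (S1 \<union> S2)" "D \<inter> S3 = {}"
    and x: "x \<in> closure D" "x \<in> S1 - {a, b}" and y: "y \<in> closure D" "y \<in> S2 - {a, b}"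
  shows False
proof -
  obtain g1 g2 g3 where g: "arc g1" "pathstart g1 = a" "pathfinish g1 = b" "path_image g1 = S1"
    "arc g2" "pathstart g2 = a" "pathfinish g2 = b" "path_image g2 = S2"
    "arc g3" "pathstart g3 = a" "pathfinish g3 = b" "path_image g3 = S3"
    using arcs unfolding arc_btw_def by blast
  have ne: "a \<noteq> b" using arc_btw_basic(1) arcs by blast
  have "S3 \<inter> inside (S1 \<union> S2) \<noteq> {}" using inside arc_btw_basic(6)[OF arcs(3)] by blast
  then have split: "inside (S1 \<union> S3) \<inter> inside (S2 \<union> S3) = {}"
    "inside (S1 \<union> S3) \<union> inside (S2 \<union> S3) \<union> (S3 - {a, b}) = inside (S1 \<union> S2)"
    using split_inside_simple_closed_curve[of g1 a b g2 g3] g int ne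
    by (auto simp: arc_imp_simple_path)
  note J13 = jordan_two_arcs[OF arcs(1,3) int(2)] and J23 = jordan_two_arcs[OF arcs(2,3) int(3)]
  have "D \<subseteq> inside (S1 \<union> S3) \<union> inside (S2 \<union> S3)" using D split by blast
  then have "D \<subseteq> inside (S1 \<union> S3) \<or> D \<subseteq> inside (S2 \<union> S3)"
    by (rule connected_one_side[OF D(1) J13(2) J23(2) split(1)])
  then show False
  proof
    assume "D \<subseteq> inside (S1 \<union> S3)"
    then have "closure D \<subseteq> inside (S1 \<union> S3) \<union> (S1 \<union> S3)"
      using closure_mono closure_Un_frontier[of "inside (S1 \<union> S3)"] J13(9) by metis
    moreover have "inside (S1 \<union> S2) \<inter> S2 = {}" using inside_no_overlap[of "S1 \<union> S2"] by blast
    ultimately show False using y split(2) int by blast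
  next
    assume "D \<subseteq> inside (S2 \<union> S3)"
    then have "closure D \<subseteq> inside (S2 \<union> S3) \<union> (S2 \<union> S3)"
      using closure_mono closure_Un_frontier[of "inside (S2 \<union> S3)"] J23(9) by metis
    moreover have "inside (S1 \<union> S2) \<inter> S1 = {}" using inside_no_overlap[of "S1 \<union> S2"] by blast
    ultimately show False using x split(2) int by blast
  qed
qed

text \<open>An inversion centred inside the closed curve turns its exterior into part of the interior of
  the image curve.\<close>

lemma inversion_outside:
  assumes arcs: "arc_btw S a b" "arc_btw T a b" "S \<inter> T = {a, b}"
    and p: "p \<in> inside (S \<union> T)"
  defines "f \<equiv> \<lambda>z. inverse (z - p)"
  shows "arc_btw (f ` S) (f a) (f b)" "arc_btw (f ` T) (f a) (f b)"
    "f ` outside (S \<union> T) \<subseteq> inside (f ` S \<union> f ` T)"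
proof -
  note J = jordan_two_arcs[OF arcs]
  have pJ: "p \<notin> S" "p \<notin> T" "p \<notin> outside (S \<union> T)"
    using p J(7) inside_no_overlap[of "S \<union> T"] by blast+
  \<comment> \<open>Because \<open>inverse 0 = 0\<close>, the map \<open>f\<close> is injective on
    the whole plane, with \<open>p\<close> going to 0; only continuity fails at
    \<open>p\<close>.\<close>
  have inj: "inj f" unfolding f_def by (rule injI) simp
  have cont: "continuous_on A f" if "p \<notin> A" for A
    unfolding f_def using that by (intro continuous_intros) auto
  show fS: "arc_btw (f ` S) (f a) (f b)" and fT: "arc_btw (f ` T) (f a) (f b)"
    using arc_btw_image cont pJ arcs inj by (metis inj_on_subset subset_UNIV)+
  have "f ` S \<inter> f ` T = {f a, f b}" using inj arcs(3) by (metis image_Int image_insert image_empty)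
  note J' = jordan_two_arcs[OF fS fT this]
  let ?A = "f ` outside (S \<union> T)" and ?B = "f ` (inside (S \<union> T) - {p})" and ?J = "f ` S \<union> f ` T"
  have conn: "connected ?A" "connected ?B"
    using J(2,3,5) cont pJ by (auto intro!: connected_continuous_image connected_open_delete)
  have disj: "?A \<inter> ?J = {}" "?B \<inter> ?J = {}"
  proof -
    have "outside (S \<union> T) \<inter> (S \<union> T) = {}" "(inside (S \<union> T) - {p}) \<inter> (S \<union> T) = {}"
      using J(8) by blast+
    then show "?A \<inter> ?J = {}" "?B \<inter> ?J = {}"
      using inj by (metis image_Int image_Un image_empty)+
  qed
  have A: "?A \<subseteq> inside ?J \<or> ?A \<subseteq> outside ?J"
    by (rule connected_one_side[OF conn(1) J'(2,4,7)]) (use disj in \<open>unfold J'(8), blast\<close>)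
  have B: "?B \<subseteq> inside ?J \<or> ?B \<subseteq> outside ?J"
    by (rule connected_one_side[OF conn(2) J'(2,4,7)]) (use disj in \<open>unfold J'(8), blast\<close>)
  have "\<not> bounded ?B"
  proof
    assume "bounded ?B"
    then obtain M where M: "M > 0" "\<And>w. w \<in> ?B \<Longrightarrow> norm w \<le> M" using bounded_pos by metis
    obtain e where e: "e > 0" "ball p e \<subseteq> inside (S \<union> T)" using J(2) p openE by blast
    \<comment> \<open>Close enough to \<open>p\<close> to stay inside the curve, and small enough
      that the image has norm \<open>1 / r\<close>, at least \<open>2 * M\<close>.\<close>
    define r where "r = min (e / 2) (1 / (2 * M))"
    have r: "r > 0" "r < e" "r \<le> 1 / (2 * M)" using e M by (auto simp: r_def)
    define z where "z = p + complex_of_real r"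
    have "z \<in> inside (S \<union> T) - {p}" using e r by (auto simp: z_def dist_norm)
    then have "norm (f z) \<le> M" using M by blast
    moreover have "f z = inverse (complex_of_real r)" by (simp add: f_def z_def)
    then have "norm (f z) = 1 / r" using r(1) by (simp add: norm_inverse divide_inverse)
    moreover have "1 / r \<ge> 2 * M" using r M by (simp add: field_simps)
    ultimately show False using M by linarith
  qed
  then have B': "?B \<subseteq> outside ?J" using B J'(6) bounded_subset by blast
  show "?A \<subseteq> inside ?J"
  proof (rule ccontr)
    assume "\<not> ?thesis"
    then have A': "?A \<subseteq> outside ?J" using A by blast
    \<comment> \<open>Every nonzero point is the image of a point other than \<open>p\<close>, hence
      lies on the image curve or in one of the two images. If both images lay outside, at most 0
      would be left for the inside, which is open and nonempty.\<close>
    have "inside ?J \<subseteq> {0}"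
    proof
      fix w assume w: "w \<in> inside ?J"
      show "w \<in> {0}"
      proof (rule ccontr)
        assume "w \<notin> {0}"
        then have fw: "f (p + inverse w) = w" "p + inverse w \<noteq> p" by (auto simp: f_def)
        have "p + inverse w \<in> S \<union> T \<union> outside (S \<union> T) \<union> (inside (S \<union> T) - {p})"
          using J(8) fw(2) by blast
        then have "w \<in> ?J \<union> ?A \<union> ?B" using fw(1) by (metis (no_types, lifting) UnE UnI1 UnI2 imageI)
        then show False using w A' B' J'(7) inside_no_overlap[of ?J] by blast
      qed
    qed
    then have "inside ?J = {} \<or> inside ?J = {0}" by blast
    then show False using J'(1,2) not_open_singleton[of "0::complex"] by auto
  qed
qed

text \<open>Both on the inside contradicts \<open>theta_inside\<close>, and an inversion carries the
  case of both on the outside to it. Only connectedness of \<open>D\<close> and contact with both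
  arcs are asked for, so \<open>D\<close> can be a chord or a star.\<close>

lemma theta_cross:
  assumes arcs: "arc_btw S1 a b" "arc_btw S2 a b" "arc_btw S3 a b"
    and int: "S1 \<inter> S2 = {a, b}" "S1 \<inter> S3 = {a, b}" "S2 \<inter> S3 = {a, b}"
    and D: "connected D" "D \<inter> (S1 \<union> S2 \<union> S3) = {}"
    and x: "x \<in> closure D" "x \<in> S1 - {a, b}" and y: "y \<in> closure D" "y \<in> S2 - {a, b}"
  shows "S3 - {a, b} \<subseteq> inside (S1 \<union> S2) \<and> D \<subseteq> outside (S1 \<union> S2) \<or>
    S3 - {a, b} \<subseteq> outside (S1 \<union> S2) \<and> D \<subseteq> inside (S1 \<union> S2)"
proof -
  note J = jordan_two_arcs[OF arcs(1,2) int(1)]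
  have c3: "connected (S3 - {a, b})" by (rule arc_btw_basic(5)[OF arcs(3)])
  have S3: "S3 - {a, b} \<subseteq> inside (S1 \<union> S2) \<or> S3 - {a, b} \<subseteq> outside (S1 \<union> S2)"
    by (rule connected_one_side[OF c3 J(2,4,7)]) (use int in \<open>unfold J(8), blast\<close>)
  have DD: "D \<subseteq> inside (S1 \<union> S2) \<or> D \<subseteq> outside (S1 \<union> S2)"
    by (rule connected_one_side[OF D(1) J(2,4,7)]) (use D(2) in \<open>unfold J(8), blast\<close>)
  have "\<not> (S3 - {a, b} \<subseteq> inside (S1 \<union> S2) \<and> D \<subseteq> inside (S1 \<union> S2))"
    using theta_inside[OF arcs int _ D(1) _ _ x y] D(2) by blast
  moreover have False if out: "S3 - {a, b} \<subseteq> outside (S1 \<union> S2)" "D \<subseteq> outside (S1 \<union> S2)"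
  proof -
    obtain p where p: "p \<in> inside (S1 \<union> S2)" using J(1) by blast
    define f where "f = (\<lambda>z. inverse (z - p))"
    have inv: "arc_btw (f ` S1) (f a) (f b)" "arc_btw (f ` S2) (f a) (f b)"
      "f ` outside (S1 \<union> S2) \<subseteq> inside (f ` S1 \<union> f ` S2)"
      using inversion_outside[OF arcs(1,2) int(1) p] unfolding f_def by auto
    have inj: "inj f" unfolding f_def by (rule injI) simp
    have cont: "continuous_on A f" if "p \<notin> A" for A
      unfolding f_def using that by (intro continuous_intros) auto
    have pn: "p \<notin> S1" "p \<notin> S2" "p \<notin> outside (S1 \<union> S2)"
      using p J(7) inside_no_overlap[of "S1 \<union> S2"] by blast+
    have p3: "p \<notin> S3" using pn out(1) int by blast
    have "closure D \<subseteq> outside (S1 \<union> S2) \<union> (S1 \<union> S2)"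
      using out(2) closure_mono closure_Un_frontier[of "outside (S1 \<union> S2)"] J(10) by metis
    then have pD: "p \<notin> closure D" "p \<notin> D" using pn closure_subset by blast+
    have f3: "arc_btw (f ` S3) (f a) (f b)"
      using arc_btw_image[OF arcs(3) cont[OF p3]] inj inj_on_subset by blast
    have im: "f ` (A \<inter> B) = f ` A \<inter> f ` B" "f ` (A - B) = f ` A - f ` B" for A B
      using inj by (auto simp: image_Int image_set_diff)
    have cl: "f ` closure D \<subseteq> closure (f ` D)"
      by (rule image_closure_subset[OF cont[OF pD(1)]]) (auto intro: closure_subset[THEN subsetD])
    show False
    proof (rule theta_inside[OF inv(1,2) f3])
      show "f ` S1 \<inter> f ` S2 = {f a, f b}" "f ` S1 \<inter> f ` S3 = {f a, f b}" "f ` S2 \<inter> f ` S3 = {f a, f b}"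
        using int by (simp_all flip: im)
      show "f ` S3 - {f a, f b} \<subseteq> inside (f ` S1 \<union> f ` S2)"
        using image_mono[OF out(1), of f] inv(3) by (auto simp: im)
      show "connected (f ` D)" using D(1) cont[OF pD(2)] connected_continuous_image by blast
      show "f ` D \<subseteq> inside (f ` S1 \<union> f ` S2)" using out(2) inv(3) by blast
      have "D \<inter> S3 = {}" using D(2) by blast
      then show "f ` D \<inter> f ` S3 = {}" by (simp flip: im)
      show "f x \<in> closure (f ` D)" "f y \<in> closure (f ` D)" using cl x y by blast+
      show "f x \<in> f ` S1 - {f a, f b}" "f y \<in> f ` S2 - {f a, f b}" using x y inj by (auto simp: inj_eq)
    qed
  qed
  ultimately show ?thesis using S3 DD by blast
qed

section \<open>Plane drawings\<close>

fun path_edges :: "'a list \<Rightarrow> 'a set set" where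
  "path_edges (x # y # zs) = insert {x, y} (path_edges (y # zs))"
| "path_edges _ = {}"

lemma path_edges_subset: "e \<in> path_edges ws \<Longrightarrow> e \<subseteq> set ws"
  by (induction ws rule: path_edges.induct) auto

lemma Union_path_edges: "2 \<le> length ws \<Longrightarrow> \<Union> (path_edges ws) = set ws"
proof (induction ws rule: path_edges.induct)
  case (1 x y zs)
  then show ?case by (cases zs) auto
qed auto

text \<open>Edges are drawn as point sets, so that two consecutive edges can be replaced by one edge
  whose picture is their union.\<close>

locale drawing =
  fixes V :: "'a set" and E :: "'a set set" and p :: "'a \<Rightarrow> complex" and S :: "'a set \<Rightarrow> complex set"
  assumes edge_subset: "e \<in> E \<Longrightarrow> e \<subseteq> V"
    and inj: "inj_on p V"
    and arc: "{u, v} \<in> E \<Longrightarrow> arc_btw (S {u, v}) (p u) (p v)"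
    and vertex: "e \<in> E \<Longrightarrow> S e \<inter> p ` V = p ` e"
    and meet: "e \<in> E \<Longrightarrow> f \<in> E \<Longrightarrow> e \<noteq> f \<Longrightarrow> S e \<inter> S f = p ` (e \<inter> f)"
begin

lemma Union_meet:
  assumes "F1 \<subseteq> E" "F2 \<subseteq> E" "F1 \<inter> F2 = {}"
  shows "\<Union> (S ` F1) \<inter> \<Union> (S ` F2) = p ` (\<Union> F1 \<inter> \<Union> F2)"
proof -
  have "\<Union> (S ` F1) \<inter> \<Union> (S ` F2) = (\<Union>e\<in>F1. \<Union>f\<in>F2. S e \<inter> S f)" by blast
  also have "\<dots> = (\<Union>e\<in>F1. \<Union>f\<in>F2. p ` (e \<inter> f))"
  proof (intro SUP_cong refl)
    fix e f assume "e \<in> F1" "f \<in> F2"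
    then show "S e \<inter> S f = p ` (e \<inter> f)" using assms by (intro meet) auto
  qed
  also have "\<dots> = p ` (\<Union> F1 \<inter> \<Union> F2)" by blast
  finally show ?thesis .
qed

lemma path_arc:
  "distinct ws \<Longrightarrow> 2 \<le> length ws \<Longrightarrow> path_edges ws \<subseteq> E \<Longrightarrow>
    arc_btw (\<Union> (S ` path_edges ws)) (p (hd ws)) (p (last ws))"
proof (induction ws rule: path_edges.induct)
  case (1 x y zs)
  have e: "{x, y} \<in> E" using 1 by simp
  show ?case
  proof (cases zs)
    case Nil
    then show ?thesis using arc[OF e] by simp
  next
    case (Cons z zs')
    have "arc_btw (\<Union> (S ` path_edges (y # zs))) (p y) (p (last (y # zs)))"
      using 1 Cons by simp
    moreover have "S {x, y} \<inter> \<Union> (S ` path_edges (y # zs)) \<subseteq> {p y}"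
    proof -
      have "{x, y} \<notin> path_edges (y # zs)" using 1(2) path_edges_subset by force
      then have "\<Union> (S ` {{x, y}}) \<inter> \<Union> (S ` path_edges (y # zs)) = p ` (\<Union> {{x, y}} \<inter> \<Union> (path_edges (y # zs)))"
        using 1(4) by (intro Union_meet) auto
      moreover have "\<Union> (path_edges (y # zs)) = set (y # zs)" using Cons by (intro Union_path_edges) simp
      ultimately show ?thesis using 1(2) by auto
    qed
    ultimately have "arc_btw (S {x, y} \<union> \<Union> (S ` path_edges (y # zs))) (p x) (p (last (y # zs)))"
      using arc_btw_join[OF arc[OF e]] by blast
    then show ?thesis by simp
  qed
qed auto

lemma inj_eq_V: "u \<in> V \<Longrightarrow> v \<in> V \<Longrightarrow> p u = p v \<longleftrightarrow> u = v"
  using inj by (auto simp: inj_on_eq_iff)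

text \<open>Two drawn paths and the chord form a theta curve. Leaving \<open>D\<close> a general
  connected set covers both a second chord and the star used for K_5.\<close>

lemma chord_sides:
  assumes ws1: "distinct ws1" "2 \<le> length ws1" "path_edges ws1 \<subseteq> E" "hd ws1 = a" "last ws1 = b"
    and ws2: "distinct ws2" "2 \<le> length ws2" "path_edges ws2 \<subseteq> E" "hd ws2 = a" "last ws2 = b"
    and int: "set ws1 \<inter> set ws2 = {a, b}"
    and ab: "{a, b} \<in> E" "{a, b} \<notin> path_edges ws1" "{a, b} \<notin> path_edges ws2"
      "path_edges ws1 \<inter> path_edges ws2 = {}"
    and H: "H = path_edges ws1 \<union> path_edges ws2"
    and D: "connected D" "D \<inter> \<Union> (S ` insert {a, b} H) = {}"
    and x: "p x \<in> closure D" "x \<in> set ws1 - {a, b}" and y: "p y \<in> closure D" "y \<in> set ws2 - {a, b}"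
  shows "S {a, b} - {p a, p b} \<subseteq> inside (\<Union> (S ` H)) \<and> D \<subseteq> outside (\<Union> (S ` H)) \<or>
    S {a, b} - {p a, p b} \<subseteq> outside (\<Union> (S ` H)) \<and> D \<subseteq> inside (\<Union> (S ` H))"
proof -
  let ?S1 = "\<Union> (S ` path_edges ws1)" and ?S2 = "\<Union> (S ` path_edges ws2)"
  have sets: "\<Union> (path_edges ws1) = set ws1" "\<Union> (path_edges ws2) = set ws2"
    using Union_path_edges ws1 ws2 by blast+
  have HU: "\<Union> (S ` H) = ?S1 \<union> ?S2" using H by blast
  have sub: "set ws1 \<subseteq> V" "set ws2 \<subseteq> V" using sets edge_subset ws1(3) ws2(3) by blast+
  have abV: "a \<in> V" "b \<in> V" "a \<in> set ws1" "b \<in> set ws1" "a \<in> set ws2" "b \<in> set ws2" using sub int by blast+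
  have xS: "p x \<in> ?S1" "p y \<in> ?S2"
  proof -
    obtain e f where e: "e \<in> path_edges ws1" "x \<in> e" and f: "f \<in> path_edges ws2" "y \<in> f"
      using sets x y by blast
    have "p x \<in> S e" "p y \<in> S f" using vertex e f ws1(3) ws2(3) by blast+
    then show "p x \<in> ?S1" "p y \<in> ?S2" using e f by blast+
  qed
  show ?thesis unfolding HU
  proof (rule theta_cross)
    show "arc_btw ?S1 (p a) (p b)" using path_arc ws1 by blast
    show "arc_btw ?S2 (p a) (p b)" using path_arc ws2 by blast
    show "arc_btw (S {a, b}) (p a) (p b)" using arc ab by blast
    show "?S1 \<inter> ?S2 = {p a, p b}" using Union_meet[OF ws1(3) ws2(3) ab(4)] sets int by simp
    have "?S1 \<inter> \<Union> (S ` {{a, b}}) = p ` (set ws1 \<inter> {a, b})"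
      using Union_meet[OF ws1(3), of "{{a, b}}"] ab sets by simp
    then show "?S1 \<inter> S {a, b} = {p a, p b}" using abV by auto
    have "?S2 \<inter> \<Union> (S ` {{a, b}}) = p ` (set ws2 \<inter> {a, b})"
      using Union_meet[OF ws2(3), of "{{a, b}}"] ab sets by simp
    then show "?S2 \<inter> S {a, b} = {p a, p b}" using abV by auto
    show "D \<inter> (?S1 \<union> ?S2 \<union> S {a, b}) = {}" using D(2) H by blast
    show "p x \<in> ?S1 - {p a, p b}" "p y \<in> ?S2 - {p a, p b}"
      using xS x y sub abV inj_eq_V by auto
  qed (use D x y in auto)
qed

lemma edge_interior:
  assumes "{x, y} \<in> E"
  shows "connected (S {x, y} - {p x, p y})" "S {x, y} - {p x, p y} \<noteq> {}"
    "p x \<in> closure (S {x, y} - {p x, p y})" "p y \<in> closure (S {x, y} - {p x, p y})"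
    "F \<subseteq> E \<Longrightarrow> {x, y} \<notin> F \<Longrightarrow> (S {x, y} - {p x, p y}) \<inter> \<Union> (S ` F) = {}"
proof -
  note B = arc_btw_basic[OF arc[OF assms]]
  show "connected (S {x, y} - {p x, p y})" "S {x, y} - {p x, p y} \<noteq> {}"
    "p x \<in> closure (S {x, y} - {p x, p y})" "p y \<in> closure (S {x, y} - {p x, p y})"
    using B by blast+
  assume "F \<subseteq> E" "{x, y} \<notin> F"
  then have "\<Union> (S ` {{x, y}}) \<inter> \<Union> (S ` F) = p ` ({x, y} \<inter> \<Union> F)"
    using Union_meet[of "{{x, y}}" F] assms by simp
  then show "(S {x, y} - {p x, p y}) \<inter> \<Union> (S ` F) = {}" by auto
qed

text \<open>Long diagonals of a hexagon interlace: \<open>w2\<close> and \<open>w5\<close> are inner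
  vertices of the two different paths from \<open>w0\<close> to \<open>w3\<close>.\<close>

lemma hexagon_chords:
  assumes dist: "distinct [w0, w1, w2, w3, w4, w5]"
    and H: "H = {{w0, w1}, {w1, w2}, {w2, w3}, {w3, w4}, {w4, w5}, {w5, w0}}" "H \<subseteq> E"
    and ch: "{w0, w3} \<in> E" "{w2, w5} \<in> E"
  shows "S {w0, w3} - {p w0, p w3} \<subseteq> inside (\<Union> (S ` H)) \<and> S {w2, w5} - {p w2, p w5} \<subseteq> outside (\<Union> (S ` H)) \<or>
    S {w0, w3} - {p w0, p w3} \<subseteq> outside (\<Union> (S ` H)) \<and> S {w2, w5} - {p w2, p w5} \<subseteq> inside (\<Union> (S ` H))"
proof (rule chord_sides[of "[w0, w1, w2, w3]" w0 w3 "[w0, w5, w4, w3]" H _ w2 w5])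
  show "H = path_edges [w0, w1, w2, w3] \<union> path_edges [w0, w5, w4, w3]"
    unfolding H by (auto simp: insert_commute)
  then show "path_edges [w0, w1, w2, w3] \<subseteq> E" "path_edges [w0, w5, w4, w3] \<subseteq> E"
    using H(2) by blast+
  show "path_edges [w0, w1, w2, w3] \<inter> path_edges [w0, w5, w4, w3] = {}"
    using dist by (auto simp: doubleton_eq_iff)
  have "{w2, w5} \<notin> insert {w0, w3} H" using dist unfolding H by (auto simp: doubleton_eq_iff)
  then show "(S {w2, w5} - {p w2, p w5}) \<inter> \<Union> (S ` insert {w0, w3} H) = {}"
    using edge_interior(5)[OF ch(2), of "insert {w0, w3} H"] H(2) ch(1) by blast
qed (use dist ch edge_interior[OF ch(2)] in \<open>auto simp: doubleton_eq_iff\<close>)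

text \<open>K_{3,3} is a six-cycle with its three long diagonals. Starting the six-cycle two
  vertices later permutes the diagonals, so \<open>hexagon_chords\<close> applies to each
  pair.\<close>

lemma no_K33:
  assumes dist: "distinct [u1, u2, u3, v1, v2, v3]"
    and E: "\<And>u v. u \<in> {u1, u2, u3} \<Longrightarrow> v \<in> {v1, v2, v3} \<Longrightarrow> {u, v} \<in> E"
  shows False
proof -
  define H where "H = {{u1, v1}, {v1, u2}, {u2, v2}, {v2, u3}, {u3, v3}, {v3, u1}}"
  have HE: "H \<subseteq> E" unfolding H_def using E by (auto simp: insert_commute)
  have H1: "H = {{u2, v2}, {v2, u3}, {u3, v3}, {v3, u1}, {u1, v1}, {v1, u2}}"
    and H2: "H = {{u3, v3}, {v3, u1}, {u1, v1}, {v1, u2}, {u2, v2}, {v2, u3}}"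
    unfolding H_def by (simp_all add: insert_commute)
  have d: "distinct [u1, v1, u2, v2, u3, v3]" "distinct [u2, v2, u3, v3, u1, v1]" "distinct [u3, v3, u1, v1, u2, v2]"
    using dist by auto
  have c: "{u1, v2} \<in> E" "{u2, v3} \<in> E" "{u3, v1} \<in> E" using E by auto
  have "S {u1, v2} - {p u1, p v2} \<noteq> {}" "S {u2, v3} - {p u2, p v3} \<noteq> {}" "S {u3, v1} - {p u3, p v1} \<noteq> {}"
    using edge_interior(2) c by blast+
  moreover have "inside (\<Union> (S ` H)) \<inter> outside (\<Union> (S ` H)) = {}" by (rule inside_Int_outside)
  ultimately show False
    using hexagon_chords[OF d(1) H_def HE c(1,2)] hexagon_chords[OF d(2) H1 HE c(2,3)]
      hexagon_chords[OF d(3) H2 HE c(3,1)] by blast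
qed

text \<open>The four-cycle \<open>a c b d\<close> has the chords \<open>a b\<close> and
  \<open>c d\<close>; the star at \<open>z\<close> touches all four corners and so must be opposite
  to each chord, while the chords are opposite to each other.\<close>

lemma no_K5:
  assumes dist: "distinct [a, b, c, d, z]"
    and E: "\<And>u v. u \<in> {a, b, c, d, z} \<Longrightarrow> v \<in> {a, b, c, d, z} \<Longrightarrow> u \<noteq> v \<Longrightarrow> {u, v} \<in> E"
  shows False
proof -
  define H where "H = {{a, c}, {c, b}, {a, d}, {d, b}}"
  have HE: "H \<subseteq> E" "{a, b} \<in> E" "{c, d} \<in> E" unfolding H_def using E dist by auto
  have V: "a \<in> V" "b \<in> V" "c \<in> V" "d \<in> V" "z \<in> V" using edge_subset E[of a] E[of z] dist by auto
  have H1: "H = path_edges [a, c, b] \<union> path_edges [a, d, b]" unfolding H_def by auto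
  have H2: "H = path_edges [c, a, d] \<union> path_edges [c, b, d]" unfolding H_def by (auto simp: insert_commute)
  \<comment> \<open>Only the tips on the four-cycle are removed; the point \<open>p z\<close>
    belongs to all four pieces and keeps the star connected.\<close>
  define D where "D = (\<Union>t\<in>{a, b, c, d}. S {t, z} - {p t})"
  have tz: "{t, z} \<in> E" if "t \<in> {a, b, c, d}" for t using E that dist by auto
  have "connected D" unfolding D_def
  proof (rule connected_Union)
    show "connected X" if "X \<in> (\<lambda>t. S {t, z} - {p t}) ` {a, b, c, d}" for X
      using that arc_btw_basic(8) arc[OF tz] by blast
    have "p z \<in> S {t, z} - {p t}" if "t \<in> {a, b, c, d}" for t
      using arc_btw_basic(1,3)[OF arc[OF tz[OF that]]] by auto
    then show "\<Inter> ((\<lambda>t. S {t, z} - {p t}) ` {a, b, c, d}) \<noteq> {}" by blast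
  qed
  have cl: "p t \<in> closure D" if t: "t \<in> {a, b, c, d}" for t
  proof -
    have "S {t, z} - {p t, p z} \<subseteq> D" unfolding D_def using t by blast
    then show ?thesis using closure_mono edge_interior(3)[OF tz[OF t]] by blast
  qed
  have avoid: "D \<inter> \<Union> (S ` F) = {}" if F: "F \<subseteq> E" "\<Union> F \<subseteq> {a, b, c, d}" for F
  proof -
    have "(S {t, z} - {p t}) \<inter> \<Union> (S ` F) = {}" if t: "t \<in> {a, b, c, d}" for t
    proof -
      have "z \<notin> \<Union> F" using F(2) dist by auto
      then have "{t, z} \<notin> F" by blast
      then have "\<Union> (S ` {{t, z}}) \<inter> \<Union> (S ` F) = p ` ({t, z} \<inter> \<Union> F)"
        using Union_meet[of "{{t, z}}" F] F(1) tz[OF t] by simp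
      then show ?thesis using \<open>z \<notin> \<Union> F\<close> by auto
    qed
    then show ?thesis unfolding D_def by blast
  qed
  let ?J = "\<Union> (S ` H)"
  have ne: "D \<noteq> {}" using cl[of a] by auto
  have ab: "S {a, b} - {p a, p b} \<subseteq> inside ?J \<and> D' \<subseteq> outside ?J \<or>
      S {a, b} - {p a, p b} \<subseteq> outside ?J \<and> D' \<subseteq> inside ?J"
    if D': "connected D'" "D' \<inter> \<Union> (S ` insert {a, b} H) = {}" "p c \<in> closure D'" "p d \<in> closure D'" for D'
    by (rule chord_sides[of "[a, c, b]" a b "[a, d, b]" H D' c d])
      (use dist D' HE H1 in \<open>auto simp: doubleton_eq_iff H_def\<close>)
  have cd: "S {c, d} - {p c, p d} \<subseteq> inside ?J \<and> D \<subseteq> outside ?J \<or>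
      S {c, d} - {p c, p d} \<subseteq> outside ?J \<and> D \<subseteq> inside ?J"
  proof (rule chord_sides[of "[c, a, d]" c d "[c, b, d]" H D a b])
    show "D \<inter> \<Union> (S ` insert {c, d} H) = {}" by (rule avoid) (use HE in \<open>auto simp: H_def\<close>)
    show "path_edges [c, a, d] \<subseteq> E" "path_edges [c, b, d] \<subseteq> E" using H2 HE(1) by blast+
  qed (use dist cl HE H2 \<open>connected D\<close> in \<open>auto simp: doubleton_eq_iff\<close>)
  have "{c, d} \<notin> insert {a, b} H" using dist by (auto simp: H_def doubleton_eq_iff)
  then have abcd: "S {a, b} - {p a, p b} \<subseteq> inside ?J \<and> S {c, d} - {p c, p d} \<subseteq> outside ?J \<or>
      S {a, b} - {p a, p b} \<subseteq> outside ?J \<and> S {c, d} - {p c, p d} \<subseteq> inside ?J"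
    using edge_interior[OF HE(3)] HE(1,2) by (intro ab) auto
  have abD: "S {a, b} - {p a, p b} \<subseteq> inside ?J \<and> D \<subseteq> outside ?J \<or>
      S {a, b} - {p a, p b} \<subseteq> outside ?J \<and> D \<subseteq> inside ?J"
  proof (rule ab)
    show "D \<inter> \<Union> (S ` insert {a, b} H) = {}" by (rule avoid) (use HE in \<open>auto simp: H_def\<close>)
  qed (use cl \<open>connected D\<close> in auto)
  have "inside ?J \<inter> outside ?J = {}" by (rule inside_Int_outside)
  then show False using abcd abD cd ne edge_interior(2)[OF HE(2)] edge_interior(2)[OF HE(3)] by blast
qed

text \<open>Merging the arcs \<open>a v\<close> and \<open>v b\<close> into one edge turns a drawing
  of a subdivision, with subdividing vertex \<open>v\<close>, into a drawing of the graph itself, so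
  \<open>no_K5\<close> and \<open>no_K33\<close> apply.\<close>

lemma suppress:
  assumes va: "{v, a} \<in> E" and vb: "{v, b} \<in> E" and "a \<noteq> b" "{a, b} \<notin> E"
  shows "drawing (V - {v}) (insert {a, b} {e \<in> E. v \<notin> e}) p (S({a, b} := S {v, a} \<union> S {v, b}))"
proof
  have ne: "v \<noteq> a" "v \<noteq> b" using arc_btw_basic(1)[OF arc[OF va]] arc_btw_basic(1)[OF arc[OF vb]] by auto
  have V: "v \<in> V" "a \<in> V" "b \<in> V" using edge_subset va vb by blast+
  have "S {v, a} \<inter> S {v, b} = p ` ({v, a} \<inter> {v, b})"
    using va vb assms(3) by (intro meet) (auto simp: doubleton_eq_iff)
  also have "{v, a} \<inter> {v, b} = {v}" using ne assms(3) by auto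
  finally have "S {v, a} \<inter> S {v, b} \<subseteq> {p v}" by simp
  then have J: "arc_btw (S {v, a} \<union> S {v, b}) (p a) (p b)"
    by (rule arc_btw_join[OF arc_btw_sym[OF arc[OF va]] arc[OF vb]])
  let ?S = "S({a, b} := S {v, a} \<union> S {v, b})"
  show "e \<subseteq> V - {v}" if "e \<in> insert {a, b} {e \<in> E. v \<notin> e}" for e using that V ne edge_subset by blast
  show "inj_on p (V - {v})" using inj inj_on_subset by blast
  show "arc_btw (?S {x, y}) (p x) (p y)" if "{x, y} \<in> insert {a, b} {e \<in> E. v \<notin> e}" for x y
  proof (cases "{x, y} = {a, b}")
    case True
    then show ?thesis using J arc_btw_sym[OF J] by (auto simp: doubleton_eq_iff)
  next
    case False
    then show ?thesis using that arc by auto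
  qed
  show "?S e \<inter> p ` (V - {v}) = p ` e" if e: "e \<in> insert {a, b} {e \<in> E. v \<notin> e}" for e
  proof (cases "e = {a, b}")
    case True
    have "p ` (V - {v}) = p ` V - {p v}" using inj V by (auto simp: inj_on_eq_iff)
    moreover have "S {v, a} \<inter> p ` V = {p v, p a}" "S {v, b} \<inter> p ` V = {p v, p b}"
      using vertex[OF va] vertex[OF vb] by auto
    moreover have "p v \<noteq> p a" "p v \<noteq> p b" using inj_eq_V V ne by auto
    ultimately show ?thesis using True by auto
  next
    case False
    then have "e \<in> E" "v \<notin> e" using e by auto
    then show ?thesis using False vertex[of e] edge_subset[of e] by auto
  qed
  have new: "(S {v, a} \<union> S {v, b}) \<inter> S f = p ` ({a, b} \<inter> f)" if f: "f \<in> E" "v \<notin> f" for f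
  proof -
    have "{v, a} \<noteq> f" "{v, b} \<noteq> f" using f(2) by blast+
    then have "S {v, a} \<inter> S f = p ` ({v, a} \<inter> f)" "S {v, b} \<inter> S f = p ` ({v, b} \<inter> f)"
      using meet va vb f(1) by blast+
    then show ?thesis using f(2) by auto
  qed
  show "?S e \<inter> ?S f = p ` (e \<inter> f)"
    if ef: "e \<in> insert {a, b} {e \<in> E. v \<notin> e}" "f \<in> insert {a, b} {e \<in> E. v \<notin> e}" "e \<noteq> f" for e f
  proof -
    consider "e = {a, b}" "f \<in> E" "v \<notin> f" | "f = {a, b}" "e \<in> E" "v \<notin> e"
      | "e \<in> E" "f \<in> E" "e \<noteq> {a, b}" "f \<noteq> {a, b}"
      using ef by blast
    then show ?thesis
    proof cases
      case 1
      then show ?thesis using new[of f] ef(3) by simp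
    next
      case 2
      then show ?thesis using new[of e] ef(3) by (simp add: Int_commute)
    next
      case 3
      then show ?thesis using meet ef(3) by simp
    qed
  qed
qed

end

lemma planar_drawing:
  assumes "simple_graph G" "planar G"
  obtains p S where "drawing (verts G) (edges G) p S"
proof -
  obtain p :: "'a \<Rightarrow> complex" and g where inj: "inj_on p (verts G)"
    and g: "\<forall>e\<in>edges G. arc (g e) \<and> {pathstart (g e), pathfinish (g e)} = p ` e \<and>
        path_image (g e) \<inter> p ` verts G = p ` e"
    and m: "\<forall>e\<in>edges G. \<forall>f\<in>edges G. e \<noteq> f \<longrightarrow> path_image (g e) \<inter> path_image (g f) = p ` (e \<inter> f)"
    using assms(2) unfolding planar_def by (elim exE conjE) (rule that)
  have "drawing (verts G) (edges G) p (\<lambda>e. path_image (g e))"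
  proof
    show "e \<subseteq> verts G" if "e \<in> edges G" for e using assms(1) that by (auto simp: simple_graph_def)
    show "arc_btw (path_image (g {u, v})) (p u) (p v)" if "{u, v} \<in> edges G" for u v
    proof -
      have "pathstart (g {u, v}) = p u \<and> pathfinish (g {u, v}) = p v \<or>
          pathstart (g {u, v}) = p v \<and> pathfinish (g {u, v}) = p u"
        using g that by (auto simp: doubleton_eq_iff dest!: bspec[of _ _ "{u, v}"])
      moreover have "arc (g {u, v})" using g that by blast
      ultimately show ?thesis using arc_btw_sym[of _ "p v" "p u"] unfolding arc_btw_def by blast
    qed
  qed (use inj g m in auto)
  then show thesis using that by blast
qed

lemma planar_subgraph:
  assumes "planar G" "subgraph H G" "simple_graph H"
  shows "planar H"
proof -
  obtain p :: "'a \<Rightarrow> complex" and g where inj: "inj_on p (verts G)"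
    and g: "\<forall>e\<in>edges G. arc (g e) \<and> {pathstart (g e), pathfinish (g e)} = p ` e \<and>
        path_image (g e) \<inter> p ` verts G = p ` e"
    and m: "\<forall>e\<in>edges G. \<forall>f\<in>edges G. e \<noteq> f \<longrightarrow> path_image (g e) \<inter> path_image (g f) = p ` (e \<inter> f)"
    using assms(1) unfolding planar_def by (elim exE conjE) (rule that)
  have sub: "verts H \<subseteq> verts G" "edges H \<subseteq> edges G" using assms(2) by (auto simp: subgraph_def)
  have "path_image (g e) \<inter> p ` verts H = p ` e" if e: "e \<in> edges H" for e
  proof -
    have "path_image (g e) \<inter> p ` verts G = p ` e" using g sub e by blast
    moreover have "e \<subseteq> verts H" using assms(3) e by (auto simp: simple_graph_def)
    ultimately show ?thesis using sub(1) by blast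
  qed
  then have "\<forall>e\<in>edges H. arc (g e) \<and> {pathstart (g e), pathfinish (g e)} = p ` e \<and>
      path_image (g e) \<inter> p ` verts H = p ` e"
    using g sub(2) by (meson subsetD)
  moreover have "\<forall>e\<in>edges H. \<forall>f\<in>edges H. e \<noteq> f \<longrightarrow> path_image (g e) \<inter> path_image (g f) = p ` (e \<inter> f)"
    using m sub(2) by (meson subsetD)
  ultimately show ?thesis unfolding planar_def
    using inj_on_subset[OF inj sub(1)] by (intro exI[of _ p] exI[of _ g]) (intro conjI)
qed

section \<open>Straight-line drawings\<close>

text \<open>The convex hull of the two ends is the segment between them, written without choosing an
  order of the ends.\<close>

definition straight :: "('a \<Rightarrow> complex) \<Rightarrow> 'a set \<Rightarrow> 'a set set \<Rightarrow> bool" where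
  "straight p V E \<longleftrightarrow> inj_on p V \<and> (\<forall>e\<in>E. convex hull (p ` e) \<inter> p ` V = p ` e) \<and>
    (\<forall>e\<in>E. \<forall>f\<in>E. e \<noteq> f \<longrightarrow> convex hull (p ` e) \<inter> convex hull (p ` f) = p ` (e \<inter> f))"

lemma straight_planar:
  assumes "simple_graph G" "straight p (verts G) (edges G)"
  shows "planar G"
proof -
  have inj: "inj_on p (verts G)" using assms(2) by (simp add: straight_def)
  have "\<exists>g. arc g \<and> {pathstart g, pathfinish g} = p ` e \<and> path_image g = convex hull (p ` e)"
    if e: "e \<in> edges G" for e
  proof -
    obtain a b where ab: "e = {a, b}" "a \<noteq> b" using assms(1) e by (auto simp: simple_graph_def card_2_iff)
    then have "p a \<noteq> p b" using inj assms(1) e by (auto simp: simple_graph_def inj_on_eq_iff)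
    then show ?thesis using ab by (intro exI[of _ "linepath (p a) (p b)"]) (auto simp: segment_convex_hull)
  qed
  then obtain g where g: "\<forall>e\<in>edges G. arc (g e) \<and> {pathstart (g e), pathfinish (g e)} = p ` e \<and>
      path_image (g e) = convex hull (p ` e)"
    by metis
  then show ?thesis unfolding planar_def using assms(2) inj
    by (intro exI[of _ p] exI[of _ g]) (auto simp: straight_def)
qed

text \<open>The apex of an isosceles triangle over \<open>X Y\<close>: the midpoint moved
  perpendicularly by \<open>s\<close> times the length of the base, with the sign of
  \<open>s\<close> selecting the side.\<close>

definition apex :: "complex \<Rightarrow> complex \<Rightarrow> real \<Rightarrow> complex" where
  "apex X Y s = X + (Y - X) * Complex (1 / 2) s"

lemma apex_swap: "apex X Y s = apex Y X (- s)"
  by (simp add: apex_def complex_eq_iff field_simps)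

text \<open>After division by \<open>Y - X\<close> the two directions are a number c and 1/2 + i s,
  parallel only if s = Im c / (2 Re c). For Re c = 0 that quotient is 0 by convention, a value
  already excluded.\<close>

lemma apex_ray:
  assumes "W \<noteq> X" "Y \<noteq> X" "s \<noteq> 0" "s \<noteq> Im ((W - X) / (Y - X)) / (2 * Re ((W - X) / (Y - X)))"
  shows "closed_segment X W \<inter> closed_segment X (apex X Y s) = {X}"
proof -
  define c where "c = (W - X) / (Y - X)"
  have W: "W - X = (Y - X) * c" using assms(2) by (simp add: c_def)
  have "w = X" if w: "w \<in> closed_segment X W" "w \<in> closed_segment X (apex X Y s)" for w
  proof (rule ccontr)
    assume ne: "w \<noteq> X"
    obtain u where u: "0 \<le> u" "u \<le> 1" "w = X + u *\<^sub>R (W - X)"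
      using w(1) by (auto simp: in_segment algebra_simps)
    obtain t where t: "0 \<le> t" "t \<le> 1" "w = X + t *\<^sub>R (apex X Y s - X)"
      using w(2) by (auto simp: in_segment algebra_simps)
    have "u *\<^sub>R ((Y - X) * c) = t *\<^sub>R ((Y - X) * Complex (1 / 2) s)" using u t W by (simp add: apex_def)
    then have "(Y - X) * (of_real u * c) = (Y - X) * (of_real t * Complex (1 / 2) s)"
      by (simp add: scaleR_conv_of_real mult_ac)
    then have "of_real u * c = of_real t * Complex (1 / 2) s" using assms(2) by simp
    then have e: "u * Re c = t / 2" "u * Im c = t * s" by (simp_all add: complex_eq_iff)
    have "u > 0" "t > 0" using u t ne by (auto simp: less_le)
    then have "Re c > 0" using e(1) by (metis half_gt_zero zero_less_mult_pos)
    moreover have "u * Im c = u * (2 * s * Re c)" using e by (simp add: field_simps)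
    then have "Im c = 2 * s * Re c" using \<open>u > 0\<close> by simp
    ultimately have "s = Im c / (2 * Re c)" by simp
    then show False using assms(4) by (simp add: c_def)
  qed
  then show ?thesis by auto
qed

lemma apex_meet:
  assumes "Y \<noteq> X" "s \<noteq> 0"
  shows "closed_segment X (apex X Y s) \<inter> closed_segment Y (apex X Y s) = {apex X Y s}"
proof -
  let ?q = "apex X Y s"
  have "w = ?q" if w: "w \<in> closed_segment X ?q" "w \<in> closed_segment Y ?q" for w
  proof -
    obtain u where u: "w = X + u *\<^sub>R (?q - X)" using w(1) by (auto simp: in_segment algebra_simps)
    obtain t where t: "w = Y + t *\<^sub>R (?q - Y)" using w(2) by (auto simp: in_segment algebra_simps)
    have "?q - X = (Y - X) * Complex (1 / 2) s" by (simp add: apex_def)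
    moreover have "?q - Y = (Y - X) * (Complex (1 / 2) s - 1)" by (simp add: apex_def algebra_simps)
    moreover have "of_real u * (?q - X) = (Y - X) + of_real t * (?q - Y)"
      using u t by (simp add: scaleR_conv_of_real algebra_simps)
    ultimately have "(Y - X) * (of_real u * Complex (1 / 2) s) = (Y - X) * (1 + of_real t * (Complex (1 / 2) s - 1))"
      by (simp only:) (simp add: algebra_simps)
    then have "of_real u * Complex (1 / 2) s = 1 + of_real t * (Complex (1 / 2) s - 1)" using assms(1) by simp
    then have "u / 2 = 1 - t / 2" "s = 0 \<or> u = t" by (auto simp: complex_eq_iff)
    then have "u = 1" using assms(2) by simp
    then show ?thesis using u by simp
  qed
  then show ?thesis by auto
qed

text \<open>As \<open>s\<close> tends to 0, the segment to the apex approaches the half-edge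
  uniformly: corresponding points differ by at most \<bar>s\<bar> times the length of
  \<open>X Y\<close>. A compact set at positive distance from the half-edge is therefore
  missed.\<close>

lemma apex_disjoint:
  assumes "compact K" "K \<inter> closed_segment X (midpoint X Y) = {}"
  obtains \<delta> where "\<delta> > 0" "\<And>s. \<bar>s\<bar> < \<delta> \<Longrightarrow> K \<inter> closed_segment X (apex X Y s) = {}"
proof -
  obtain d where d: "d > 0" "\<And>a b. a \<in> K \<Longrightarrow> b \<in> closed_segment X (midpoint X Y) \<Longrightarrow> d \<le> dist a b"
    using separate_compact_closed[OF assms(1) closed_segment assms(2)] by blast
  \<comment> \<open>Adding one keeps \<open>N\<close> positive when \<open>X\<close> and
    \<open>Y\<close> coincide.\<close>
  define N where "N = norm (Y - X) + 1"
  have N: "N > 0" by (simp add: N_def add_nonneg_pos)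
  have "K \<inter> closed_segment X (apex X Y s) = {}" if s: "\<bar>s\<bar> < d / N" for s
  proof (rule ccontr)
    assume "\<not> ?thesis"
    then obtain w where w: "w \<in> K" "w \<in> closed_segment X (apex X Y s)" by blast
    then obtain u where u: "0 \<le> u" "u \<le> 1" "w = X + u *\<^sub>R (apex X Y s - X)"
      by (auto simp: in_segment algebra_simps)
    define w' where "w' = X + u *\<^sub>R (midpoint X Y - X)"
    have "w' \<in> closed_segment X (midpoint X Y)"
      unfolding in_segment using u by (intro exI[of _ u]) (auto simp: w'_def algebra_simps)
    then have le: "d \<le> dist w w'" using d w by blast
    have "Complex (1 / 2) s = 1 / 2 + \<i> * s" by (auto simp: complex_eq_iff)
    then have "apex X Y s - midpoint X Y = (Y - X) * (\<i> * s)"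
      by (simp add: apex_def midpoint_def scaleR_conv_of_real field_simps)
    moreover have "w - w' = u *\<^sub>R (apex X Y s - midpoint X Y)"
      using u(3) by (simp add: w'_def algebra_simps)
    ultimately have "dist w w' = u * (norm (Y - X) * \<bar>s\<bar>)"
      using u(1) by (simp add: dist_norm norm_mult)
    also have "\<dots> \<le> norm (Y - X) * \<bar>s\<bar>" using u by (simp add: mult_left_le_one_le)
    also have "\<dots> \<le> N * \<bar>s\<bar>" by (simp add: N_def mult_right_mono)
    also have "\<dots> < d" using s N by (simp add: field_simps)
    finally show False using le by simp
  qed
  then show thesis using that[of "d / N"] d N by simp
qed

lemma eventually_apex_disjoint:
  assumes "compact K" "K \<inter> closed_segment X (midpoint X Y) = {}"
  shows "\<forall>\<^sub>F s in at_right 0. K \<inter> closed_segment X (apex X Y s) = {}"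
    and "\<forall>\<^sub>F s in at_right 0. K \<inter> closed_segment X (apex X Y (- s)) = {}"
proof -
  obtain \<delta> where \<delta>: "\<delta> > 0" "\<And>s. \<bar>s\<bar> < \<delta> \<Longrightarrow> K \<inter> closed_segment X (apex X Y s) = {}"
    using apex_disjoint[OF assms] by metis
  show "\<forall>\<^sub>F s in at_right 0. K \<inter> closed_segment X (apex X Y s) = {}"
    "\<forall>\<^sub>F s in at_right 0. K \<inter> closed_segment X (apex X Y (- s)) = {}"
    unfolding eventually_at_right_field
    using \<delta>(1) by (intro exI[of _ \<delta>] conjI allI impI; simp add: \<delta>(2))+
qed

lemma eventually_apex_ray:
  assumes "W \<noteq> X" "Y \<noteq> X"
  shows "\<forall>\<^sub>F s in at_right 0. closed_segment X W \<inter> closed_segment X (apex X Y s) = {X}"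
    and "\<forall>\<^sub>F s in at_right 0. closed_segment X W \<inter> closed_segment X (apex X Y (- s)) = {X}"
proof -
  have ev: "\<forall>\<^sub>F s in at_right (0::real). s \<noteq> k" for k
  proof (cases "k > 0")
    case True
    then show ?thesis unfolding eventually_at_right_field by (intro exI[of _ k]) auto
  next
    case False
    then show ?thesis unfolding eventually_at_right_field by (intro exI[of _ 1]) auto
  qed
  let ?k = "Im ((W - X) / (Y - X)) / (2 * Re ((W - X) / (Y - X)))"
  show "\<forall>\<^sub>F s in at_right 0. closed_segment X W \<inter> closed_segment X (apex X Y s) = {X}"
    using ev[of 0] ev[of ?k] by eventually_elim (rule apex_ray[OF assms])
  show "\<forall>\<^sub>F s in at_right 0. closed_segment X W \<inter> closed_segment X (apex X Y (- s)) = {X}"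
    using ev[of 0] ev[of "- ?k"] by eventually_elim (rule apex_ray[OF assms], auto)
qed

text \<open>The new vertex is the apex of a flat triangle over the edge \<open>x y\<close>. Each
  incidence to be avoided is avoided for all sufficiently small positive heights; since there are
  finitely many, one height serves all. Seen from \<open>y\<close>, the same apex has parameter
  \<open>- s\<close>.\<close>

lemma straight_extend:
  assumes st: "straight p V E" and fin: "finite V" and simple: "\<And>e. e \<in> E \<Longrightarrow> e \<subseteq> V \<and> card e = 2"
    and xy: "{x, y} \<in> E" "x \<noteq> y" and v: "v \<notin> V"
  obtains q where "straight (p(v := q)) (insert v V) (E \<union> {{v, x}, {v, y}})"
proof -
  have inj: "inj_on p V" and hv: "\<And>e. e \<in> E \<Longrightarrow> convex hull (p ` e) \<inter> p ` V = p ` e"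
    and hh: "\<And>e f. e \<in> E \<Longrightarrow> f \<in> E \<Longrightarrow> e \<noteq> f \<Longrightarrow> convex hull (p ` e) \<inter> convex hull (p ` f) = p ` (e \<inter> f)"
    using st by (simp_all add: straight_def)
  have xV: "x \<in> V" "y \<in> V" using simple[OF xy(1)] by auto
  have finE: "finite E" using simple fin by (intro finite_subset[of E "Pow V"]) auto
  have comp: "compact (convex hull (p ` e))" if "e \<in> E" for e
    using simple[OF that] fin by (intro compact_convex_hull finite_imp_compact) (auto intro: finite_subset)
  have seg: "convex hull (p ` {a, b}) = closed_segment (p a) (p b)" for a b
    by (simp add: segment_convex_hull)
  let ?M = "midpoint (p x) (p y)"
  have ne: "p x \<noteq> p y" using inj xV xy(2) by (simp add: inj_on_eq_iff)
  text \<open>Away from \<open>x\<close>, everything already drawn keeps a positive distance from the half of the edge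
    \<open>xy\<close> at \<open>x\<close>; the edges at \<open>x\<close> leave it in finitely many directions.\<close>
  have key: "(\<forall>\<^sub>F s in at_right 0. \<forall>z\<in>V - {a}. p z \<notin> closed_segment (p a) (apex (p a) (p b) (c * s))) \<and>
      (\<forall>\<^sub>F s in at_right 0. \<forall>e\<in>E. convex hull (p ` e) \<inter> closed_segment (p a) (apex (p a) (p b) (c * s)) = p ` ({a} \<inter> e))"
    if ab: "{a, b} = {x, y}" "a \<noteq> b" and c: "c = 1 \<or> c = - 1" for a b and c :: real
  proof -
    have abE: "{a, b} \<in> E" "a \<in> V" "b \<in> V" using ab xy xV by auto
    have nab: "p a \<noteq> p b" using inj abE ab(2) by (simp add: inj_on_eq_iff)
    \<comment> \<open>Stopping at the midpoint keeps the half-edge away from \<open>p b\<close>, so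
      the edges meeting \<open>x y\<close> only at \<open>b\<close> are also at positive distance
      from it.\<close>
    have half: "closed_segment (p a) (midpoint (p a) (p b)) \<subseteq> convex hull (p ` {a, b}) - {p b}"
    proof -
      have "closed_segment (p a) (midpoint (p a) (p b)) \<subseteq> closed_segment (p a) (p b)"
        by (simp add: subset_closed_segment)
      moreover have "p b \<notin> closed_segment (p a) (midpoint (p a) (p b))"
      proof
        assume "p b \<in> closed_segment (p a) (midpoint (p a) (p b))"
        then have "dist (p a) (p b) \<le> dist (p a) (midpoint (p a) (p b))"
          using dist_in_closed_segment[of "p b" "p a" "midpoint (p a) (p b)"] by (simp add: dist_commute)
        then show False using nab by (simp add: dist_midpoint)
      qed
      ultimately show ?thesis unfolding seg by blast
    qed
    have ev1: "\<forall>\<^sub>F s in at_right 0. p z \<notin> closed_segment (p a) (apex (p a) (p b) (c * s))"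
      if z: "z \<in> V - {a}" for z
    proof -
      have "{p z} \<inter> closed_segment (p a) (midpoint (p a) (p b)) = {}"
      proof (rule ccontr)
        assume "\<not> ?thesis"
        then have h: "p z \<in> convex hull (p ` {a, b})" "p z \<noteq> p b" using half by auto
        then have "p z \<in> p ` {a, b}" using hv[OF abE(1)] z by blast
        then show False using h inj abE z by (auto simp: inj_on_eq_iff)
      qed
      then show ?thesis using eventually_apex_disjoint[of "{p z}" "p a" "p b"] c by auto
    qed
    have ev2: "\<forall>\<^sub>F s in at_right 0. convex hull (p ` e) \<inter> closed_segment (p a) (apex (p a) (p b) (c * s)) = p ` ({a} \<inter> e)"
      if e: "e \<in> E" for e
    proof (cases "a \<in> e")
      case True
      then obtain w where w: "e = {a, w}" "w \<noteq> a" using simple[OF e] by (auto simp: card_2_iff)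
      then have "p w \<noteq> p a" using inj simple[OF e] by (auto simp: inj_on_eq_iff)
      moreover have "p ` ({a} \<inter> e) = {p a}" using w by auto
      ultimately show ?thesis
        using eventually_apex_ray[of "p w" "p a" "p b"] nab c w(1) by (auto simp: segment_convex_hull)
    next
      case False
      then have "e \<noteq> {a, b}" by blast
      then have "convex hull (p ` e) \<inter> convex hull (p ` {a, b}) = p ` (e \<inter> {a, b})" using hh e abE by blast
      moreover have "p ` (e \<inter> {a, b}) \<subseteq> {p b}" using False by auto
      ultimately have "convex hull (p ` e) \<inter> closed_segment (p a) (midpoint (p a) (p b)) = {}" using half by blast
      then have "\<forall>\<^sub>F s in at_right 0. convex hull (p ` e) \<inter> closed_segment (p a) (apex (p a) (p b) (c * s)) = {}"
        using eventually_apex_disjoint[OF comp[OF e], of "p a" "p b"] c by auto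
      moreover have "p ` ({a} \<inter> e) = {}" using False by simp
      ultimately show ?thesis by simp
    qed
    show ?thesis using ev1 ev2 fin finE by (simp add: eventually_ball_finite_distrib)
  qed
  have yx: "{y, x} = {x, y}" "y \<noteq> x" using xy(2) by blast+
  have "\<forall>\<^sub>F s in at_right (0::real). s > 0" by (simp add: eventually_at_right_less)
  then have "\<forall>\<^sub>F s in at_right 0. s > 0 \<and>
      (\<forall>z\<in>V - {x}. p z \<notin> closed_segment (p x) (apex (p x) (p y) (1 * s))) \<and>
      (\<forall>e\<in>E. convex hull (p ` e) \<inter> closed_segment (p x) (apex (p x) (p y) (1 * s)) = p ` ({x} \<inter> e)) \<and>
      (\<forall>z\<in>V - {y}. p z \<notin> closed_segment (p y) (apex (p y) (p x) (- 1 * s))) \<and>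
      (\<forall>e\<in>E. convex hull (p ` e) \<inter> closed_segment (p y) (apex (p y) (p x) (- 1 * s)) = p ` ({y} \<inter> e))"
    using key[OF refl xy(2), of 1] key[OF yx, of "- 1"] by (auto elim!: eventually_conj)
  then have "\<exists>s. s > 0 \<and>
      (\<forall>z\<in>V - {x}. p z \<notin> closed_segment (p x) (apex (p x) (p y) (1 * s))) \<and>
      (\<forall>e\<in>E. convex hull (p ` e) \<inter> closed_segment (p x) (apex (p x) (p y) (1 * s)) = p ` ({x} \<inter> e)) \<and>
      (\<forall>z\<in>V - {y}. p z \<notin> closed_segment (p y) (apex (p y) (p x) (- 1 * s))) \<and>
      (\<forall>e\<in>E. convex hull (p ` e) \<inter> closed_segment (p y) (apex (p y) (p x) (- 1 * s)) = p ` ({y} \<inter> e))"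
    by (rule eventually_happens'[rotated]) simp
  then obtain s where s: "s > 0"
    and Xv: "\<And>z. z \<in> V - {x} \<Longrightarrow> p z \<notin> closed_segment (p x) (apex (p x) (p y) s)"
    and Xe: "\<And>e. e \<in> E \<Longrightarrow> convex hull (p ` e) \<inter> closed_segment (p x) (apex (p x) (p y) s) = p ` ({x} \<inter> e)"
    and Yv: "\<And>z. z \<in> V - {y} \<Longrightarrow> p z \<notin> closed_segment (p y) (apex (p y) (p x) (- s))"
    and Ye: "\<And>e. e \<in> E \<Longrightarrow> convex hull (p ` e) \<inter> closed_segment (p y) (apex (p y) (p x) (- s)) = p ` ({y} \<inter> e)"
    by auto
  define q where "q = apex (p x) (p y) s"
  have qy: "apex (p y) (p x) (- s) = q" unfolding q_def by (rule apex_swap[symmetric])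
  let ?p = "p(v := q)"
  have pV: "?p ` A = p ` A" if "A \<subseteq> V" for A using that v by (auto simp: fun_upd_def)
  have pE: "?p ` e = p ` e" if "e \<in> E" for e using pV simple[OF that] by blast
  have hx: "convex hull (?p ` {v, x}) = closed_segment (p x) q"
    and hy: "convex hull (?p ` {v, y}) = closed_segment (p y) q"
  proof -
    have "x \<noteq> v" "y \<noteq> v" using v xV by blast+
    then show "convex hull (?p ` {v, x}) = closed_segment (p x) q" "convex hull (?p ` {v, y}) = closed_segment (p y) q"
      by (simp_all add: segment_convex_hull insert_commute)
  qed
  have qX: "q \<noteq> p z" if z: "z \<in> V" for z
  proof
    assume "q = p z"
    then have "p z \<in> closed_segment (p x) (apex (p x) (p y) s)" "p z \<in> closed_segment (p y) (apex (p y) (p x) (- s))"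
      using qy by (auto simp: q_def)
    then show False using Xv[of z] Yv[of z] z xy(2) by blast
  qed
  have qe: "q \<notin> convex hull (p ` e)" if e: "e \<in> E" for e
  proof
    assume "q \<in> convex hull (p ` e)"
    then have "q \<in> p ` ({x} \<inter> e)" using Xe[OF e] unfolding q_def[symmetric] by auto
    then show False using qX xV by auto
  qed
  have meet: "closed_segment (p x) q \<inter> closed_segment (p y) q = {q}"
    unfolding q_def using apex_meet[of "p y" "p x" s] ne s by auto
  have xq: "closed_segment (p x) q \<inter> ?p ` insert v V = {q, p x}"
  proof -
    have "closed_segment (p x) q \<inter> p ` V = {p x}" using Xv xV unfolding q_def[symmetric] by auto
    moreover have "?p ` insert v V = insert q (p ` V)" using pV[of V] by auto
    ultimately show ?thesis by auto
  qed
  have yq: "closed_segment (p y) q \<inter> ?p ` insert v V = {q, p y}"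
  proof -
    have "closed_segment (p y) q \<inter> p ` V = {p y}" using Yv xV unfolding qy by auto
    moreover have "?p ` insert v V = insert q (p ` V)" using pV[of V] by auto
    ultimately show ?thesis by auto
  qed
  have vE: "v \<notin> e" if "e \<in> E" for e using simple[OF that] v by blast
  have new: "convex hull (?p ` g) \<inter> convex hull (?p ` e) = ?p ` (g \<inter> e)"
    if e: "e \<in> E" and g: "g \<in> {{v, x}, {v, y}}" for e g
  proof -
    have "convex hull (p ` e) \<inter> closed_segment (p x) q = p ` ({x} \<inter> e)"
      "convex hull (p ` e) \<inter> closed_segment (p y) q = p ` ({y} \<inter> e)"
      using Xe[OF e] Ye[OF e] unfolding qy by (simp_all add: q_def)
    moreover have "{v, x} \<inter> e = {x} \<inter> e" "{v, y} \<inter> e = {y} \<inter> e" using vE[OF e] by auto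
    moreover have "?p ` ({x} \<inter> e) = p ` ({x} \<inter> e)" "?p ` ({y} \<inter> e) = p ` ({y} \<inter> e)"
      by (rule pV; use xV in blast)+
    ultimately show ?thesis using g hx hy pE[OF e] by (elim insertE) (simp_all only: Int_commute, blast)
  qed
  have "straight ?p (insert v V) (E \<union> {{v, x}, {v, y}})"
    unfolding straight_def
  proof (intro conjI ballI impI)
    have "inj_on ?p V" using inj v by (auto simp: inj_on_def)
    then show "inj_on ?p (insert v V)" using v qX pV[of V] by auto
  next
    fix e assume "e \<in> E \<union> {{v, x}, {v, y}}"
    then consider "e \<in> E" | "e = {v, x}" | "e = {v, y}" by blast
    then show "convex hull (?p ` e) \<inter> ?p ` insert v V = ?p ` e"
    proof cases
      case 1
      have i: "?p ` insert v V = insert q (p ` V)" using pV[of V] by auto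
      have "convex hull (p ` e) \<inter> insert q (p ` V) = p ` e" using qe[OF 1] hv[OF 1] by blast
      then show ?thesis unfolding i pE[OF 1] .
    next
      case 2
      then show ?thesis using xq hx v xV by auto
    next
      case 3
      then show ?thesis using yq hy v xV by auto
    qed
  next
    fix e f assume ef: "e \<in> E \<union> {{v, x}, {v, y}}" "f \<in> E \<union> {{v, x}, {v, y}}" "e \<noteq> f"
    then have "e \<in> E \<or> e = {v, x} \<or> e = {v, y}" "f \<in> E \<or> f = {v, x} \<or> f = {v, y}" by auto
    then consider "e \<in> E" "f \<in> E" | "e \<in> E" "f \<in> {{v, x}, {v, y}}" | "f \<in> E" "e \<in> {{v, x}, {v, y}}"
      | "e = {v, x}" "f = {v, y}" | "e = {v, y}" "f = {v, x}"
      using ef(3) by (elim disjE) simp_all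
    then show "convex hull (?p ` e) \<inter> convex hull (?p ` f) = ?p ` (e \<inter> f)"
    proof cases
      case 1
      have "e \<inter> f \<subseteq> V" using simple 1 by blast
      then show ?thesis using hh[OF 1 ef(3)] pE 1 pV by simp
    next
      case 2
      then show ?thesis using new[of e f] by (simp only: Int_commute)
    next
      case 3
      then show ?thesis using new[of f e] by simp
    next
      case 4
      have i: "{v, x} \<inter> {v, y} = {v}" using xy(2) v xV by auto
      show ?thesis unfolding 4 hx hy meet i by simp
    next
      case 5
      have i: "{v, y} \<inter> {v, x} = {v}" using xy(2) v xV by auto
      show ?thesis unfolding 5 hx hy i Int_commute[of "closed_segment (p y) q"] meet by simp
    qed
  qed
  then show thesis by (rule that)
qed

section \<open>A straight-line drawing of the five-vertex graph\<close>

definition base_edges :: "'a \<Rightarrow> 'a \<Rightarrow> 'a \<Rightarrow> 'a \<Rightarrow> 'a \<Rightarrow> 'a set set" where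
  "base_edges x y z s t = {{x, y}, {y, z}, {x, z}, {s, x}, {s, y}, {s, z}, {t, x}, {t, y}, {t, z}}"

lemma closed_segment_nonvertical:
  assumes "a < c"
  shows "closed_segment (Complex a b) (Complex c d) =
    {w. a \<le> Re w \<and> Re w \<le> c \<and> (Im w - b) * (c - a) = (d - b) * (Re w - a)}"
proof (intro set_eqI iffI)
  fix w assume "w \<in> closed_segment (Complex a b) (Complex c d)"
  then obtain u where u: "0 \<le> u" "u \<le> 1" "w = (1 - u) *\<^sub>R Complex a b + u *\<^sub>R Complex c d"
    by (auto simp: in_segment)
  have w: "Re w = a + u * (c - a)" "Im w = b + u * (d - b)" unfolding u(3) by (simp_all add: algebra_simps)
  have "0 \<le> u * (c - a)" "u * (c - a) \<le> c - a" using u assms by (simp_all add: mult_left_le_one_le)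
  then show "w \<in> {w. a \<le> Re w \<and> Re w \<le> c \<and> (Im w - b) * (c - a) = (d - b) * (Re w - a)}"
    using w by auto
next
  fix w assume w: "w \<in> {w. a \<le> Re w \<and> Re w \<le> c \<and> (Im w - b) * (c - a) = (d - b) * (Re w - a)}"
  define u where "u = (Re w - a) / (c - a)"
  have u: "0 \<le> u" "u \<le> 1" using w assms by (auto simp: u_def)
  have "u * (c - a) = Re w - a" using assms by (simp add: u_def)
  moreover have "u * (d - b) = Im w - b" using w assms by (simp add: u_def field_simps)
  ultimately have "w = (1 - u) *\<^sub>R Complex a b + u *\<^sub>R Complex c d"
    by (simp add: complex_eq_iff algebra_simps)
  then show "w \<in> closed_segment (Complex a b) (Complex c d)" using u by (auto simp: in_segment)
qed

lemma closed_segment_vertical: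
  assumes "b < d"
  shows "closed_segment (Complex a b) (Complex a d) = {w. Re w = a \<and> b \<le> Im w \<and> Im w \<le> d}"
proof (intro set_eqI iffI)
  fix w assume "w \<in> closed_segment (Complex a b) (Complex a d)"
  then obtain u where u: "0 \<le> u" "u \<le> 1" "w = (1 - u) *\<^sub>R Complex a b + u *\<^sub>R Complex a d"
    by (auto simp: in_segment)
  have w: "Re w = a" "Im w = b + u * (d - b)" unfolding u(3) by (simp_all add: algebra_simps)
  have "0 \<le> u * (d - b)" "u * (d - b) \<le> d - b" using u assms by (simp_all add: mult_left_le_one_le)
  then show "w \<in> {w. Re w = a \<and> b \<le> Im w \<and> Im w \<le> d}" using w by auto
next
  fix w assume w: "w \<in> {w. Re w = a \<and> b \<le> Im w \<and> Im w \<le> d}"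
  define u where "u = (Im w - b) / (d - b)"
  have u: "0 \<le> u" "u \<le> 1" using w assms by (auto simp: u_def)
  have "u * (d - b) = Im w - b" using assms by (simp add: u_def)
  then have "w = (1 - u) *\<^sub>R Complex a b + u *\<^sub>R Complex a d"
    using w by (simp add: complex_eq_iff algebra_simps)
  then show "w \<in> closed_segment (Complex a b) (Complex a d)" using u by (auto simp: in_segment)
qed

lemma straight_base:
  assumes "distinct [x, y, z, s, t]"
  obtains p where "straight p {x, y, z, s, t} (base_edges x y z s t)"
proof -
  \<comment> \<open>\<open>s\<close> is inside the triangle and \<open>t\<close> above its top
    vertex \<open>z\<close>, so the edges from \<open>t\<close> to \<open>x\<close> and
    \<open>y\<close> run outside the triangle. With \<open>z\<close>, \<open>s\<close>,
    \<open>t\<close> on the imaginary axis, every edge except \<open>x y\<close> is vertical or lies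
    on one side of that axis.\<close>
  define p :: "'a \<Rightarrow> complex" where "p = (\<lambda>_. 0)(x := Complex (-4) 0, y := Complex 4 0, z := Complex 0 4,
    s := Complex 0 1, t := Complex 0 8)"
  have p: "p x = Complex (-4) 0" "p y = Complex 4 0" "p z = Complex 0 4" "p s = Complex 0 1" "p t = Complex 0 8"
    using assms by (auto simp: p_def)
  have hull: "convex hull (p ` {u, v}) = closed_segment (p u) (p v)" "convex hull (p ` {u, v}) = closed_segment (p v) (p u)" for u v
    by (simp_all add: segment_convex_hull insert_commute)
  have h: "convex hull (p ` {x, y}) = {w. -4 \<le> Re w \<and> Re w \<le> 4 \<and> Im w = 0}"
    "convex hull (p ` {y, z}) = {w. 0 \<le> Re w \<and> Re w \<le> 4 \<and> Im w = 4 - Re w}"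
    "convex hull (p ` {x, z}) = {w. -4 \<le> Re w \<and> Re w \<le> 0 \<and> Im w = 4 + Re w}"
    "convex hull (p ` {s, x}) = {w. -4 \<le> Re w \<and> Re w \<le> 0 \<and> 4 * Im w = 4 + Re w}"
    "convex hull (p ` {s, y}) = {w. 0 \<le> Re w \<and> Re w \<le> 4 \<and> 4 * Im w = 4 - Re w}"
    "convex hull (p ` {s, z}) = {w. Re w = 0 \<and> 1 \<le> Im w \<and> Im w \<le> 4}"
    "convex hull (p ` {t, x}) = {w. -4 \<le> Re w \<and> Re w \<le> 0 \<and> Im w = 8 + 2 * Re w}"
    "convex hull (p ` {t, y}) = {w. 0 \<le> Re w \<and> Re w \<le> 4 \<and> Im w = 8 - 2 * Re w}"
    "convex hull (p ` {t, z}) = {w. Re w = 0 \<and> 4 \<le> Im w \<and> Im w \<le> 8}"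
    unfolding hull(1)[of x y] hull(2)[of y z] hull(1)[of x z] hull(2)[of s x] hull(1)[of s y] hull(1)[of s z]
      hull(2)[of t x] hull(1)[of t y] hull(2)[of t z] p
    by (auto simp: closed_segment_nonvertical closed_segment_vertical)
  have ne: "x \<noteq> y" "x \<noteq> z" "x \<noteq> s" "x \<noteq> t" "y \<noteq> z" "y \<noteq> s" "y \<noteq> t" "z \<noteq> s" "z \<noteq> t" "s \<noteq> t"
    "y \<noteq> x" "z \<noteq> x" "s \<noteq> x" "t \<noteq> x" "z \<noteq> y" "s \<noteq> y" "t \<noteq> y" "s \<noteq> z" "t \<noteq> z" "t \<noteq> s"
    using assms by auto
  have V: "p ` {x, y, z, s, t} = {Complex (-4) 0, Complex 4 0, Complex 0 4, Complex 0 1, Complex 0 8}"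
    using p by simp
  have "inj_on p {x, y, z, s, t}" using p by (auto simp: inj_on_def)
  moreover have "\<forall>e\<in>base_edges x y z s t. convex hull (p ` e) \<inter> p ` {x, y, z, s, t} = p ` e"
    unfolding base_edges_def ball_simps V h by (simp add: p; auto)
  moreover have "\<forall>e\<in>base_edges x y z s t. \<forall>f\<in>base_edges x y z s t. e \<noteq> f \<longrightarrow>
      convex hull (p ` e) \<inter> convex hull (p ` f) = p ` (e \<inter> f)"
  proof -
    \<comment> \<open>Being met correctly is a symmetric relation, so an ordered list reduces the
      check to the 36 unordered pairs of edges.\<close>
    define es where "es = [{x, y}, {y, z}, {x, z}, {s, x}, {s, y}, {s, z}, {t, x}, {t, y}, {t, z}]"
    define m where "m e f \<longleftrightarrow> convex hull (p ` e) \<inter> convex hull (p ` f) = p ` (e \<inter> f)" for e f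
    have "sorted_wrt m es"
      unfolding es_def sorted_wrt.simps list.set ball_simps m_def h
      by (intro conjI TrueI; simp add: ne p; auto simp: complex_eq_iff)
    moreover have "m f e" if "m e f" for e f using that by (simp add: m_def Int_commute)
    moreover have "set es = base_edges x y z s t" by (simp add: es_def base_edges_def)
    ultimately have "\<forall>e\<in>base_edges x y z s t. \<forall>f\<in>base_edges x y z s t. e \<noteq> f \<longrightarrow> m e f"
      by (metis in_set_conv_nth linorder_neqE_nat sorted_wrt_nth_less)
    then show ?thesis by (simp add: m_def)
  qed
  ultimately have "straight p {x, y, z, s, t} (base_edges x y z s t)" unfolding straight_def by blast
  then show thesis by (rule that)
qed

section \<open>The extremal graphs\<close>

text \<open>All parameters are explicit so that vertices can be added to \<open>I\<close> or removed
  from it with the triangle and \<open>s\<close>, \<open>t\<close> fixed.\<close>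

definition extremal_form :: "'a \<Rightarrow> 'a \<Rightarrow> 'a \<Rightarrow> 'a \<Rightarrow> 'a \<Rightarrow> 'a set \<Rightarrow> ('a \<Rightarrow> 'a set) \<Rightarrow> 'a graph \<Rightarrow> bool" where
  "extremal_form x y z s t I f G \<longleftrightarrow> distinct [x, y, z, s, t] \<and> finite I \<and> I \<inter> {x, y, z, s, t} = {} \<and>
    (\<forall>v\<in>I. f v \<subseteq> {x, y, z} \<and> card (f v) = 2) \<and>
    G = Graph ({x, y, z, s, t} \<union> I) (base_edges x y z s t \<union> {{v, u} | v u. v \<in> I \<and> u \<in> f v})"

lemma join_edges:
  "{{u, w} | u w. (u = s \<or> u = t) \<and> (w = x \<or> w = y \<or> w = z)} =
    {{s, x}, {s, y}, {s, z}, {t, x}, {t, y}, {t, z}}"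
  (is "?L = ?R")
proof
  have mem: "{u, w} \<in> ?L" if "u = s \<or> u = t" "w = x \<or> w = y \<or> w = z" for u w using that by blast
  show "?R \<subseteq> ?L" by (intro insert_subsetI empty_subsetI mem) simp_all
  show "?L \<subseteq> ?R"
  proof
    fix e assume "e \<in> ?L"
    then obtain u w where "e = {u, w}" "u = s \<or> u = t" "w = x \<or> w = y \<or> w = z" by blast
    then show "e \<in> ?R" by (elim disjE) simp_all
  qed
qed

lemma extremal_graphs_iff:
  "G \<in> extremal_graphs n \<longleftrightarrow> (\<exists>x y z s t I f. extremal_form x y z s t I f G \<and> card I = n - 5)"
proof
  assume "G \<in> extremal_graphs n"
  then obtain S C I f where G: "G = Graph (verts (join (Graph S {}) C) \<union> I)
       (edges (join (Graph S {}) C) \<union> {{v, x} | v x. v \<in> I \<and> x \<in> f v})"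
    and h: "card S = 2" "is_cycle C" "card (verts C) = 3" "finite I" "card I = n - 5"
     "S \<inter> verts C = {}" "(S \<union> verts C) \<inter> I = {}" "\<forall>v\<in>I. f v \<subseteq> verts C \<and> card (f v) = 2"
    unfolding extremal_graphs_def by blast
  obtain s t where S: "S = {s, t}" "s \<noteq> t" using h(1) by (meson card_2_iff)
  obtain vs where vs: "distinct vs" "verts C = set vs"
     "edges C = {{vs ! i, vs ! (Suc i mod length vs)} | i. i < length vs}"
    using h(2) unfolding is_cycle_def by blast
  have len: "length vs = 3" using h(3) vs distinct_card by metis
  then obtain x y z where v3: "vs = [x, y, z]" by (auto simp: length_Suc_conv numeral_eq_Suc)
  have C: "verts C = {x, y, z}" "distinct [x, y, z]" using vs v3 by auto
  have eC: "edges C = {{x, y}, {y, z}, {z, x}}"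
  proof -
    have "edges C = (\<lambda>i. {vs ! i, vs ! (Suc i mod length vs)}) ` {i. i < length vs}"
      unfolding vs(3) by (rule setcompr_eq_image)
    moreover have "{i. i < length vs} = {0, 1, 2}" using len by auto
    ultimately show ?thesis using v3 by (simp add: numeral_2_eq_2)
  qed
  have "edges (join (Graph S {}) C) = base_edges x y z s t"
    by (simp add: join_def eC C(1) S(1) join_edges base_edges_def insert_commute[of z x "{}"])
      (simp add: insert_commute)
  moreover have "verts (join (Graph S {}) C) = {x, y, z, s, t}"
    unfolding join_def C(1) S(1) by auto
  ultimately have "extremal_form x y z s t I f G"
    unfolding extremal_form_def using G h S C by auto
  then show "\<exists>x y z s t I f. extremal_form x y z s t I f G \<and> card I = n - 5" using h(5) by blast
next
  assume "\<exists>x y z s t I f. extremal_form x y z s t I f G \<and> card I = n - 5"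
  then obtain x y z s t I f where F: "extremal_form x y z s t I f G" and cI: "card I = n - 5" by blast
  define C where "C = Graph {x, y, z} {{x, y}, {y, z}, {z, x}}"
  have d: "distinct [x, y, z, s, t]" using F by (simp add: extremal_form_def)
  have "is_cycle C" unfolding is_cycle_def
  proof (intro exI[of _ "[x, y, z]"] conjI)
    have "{{[x, y, z] ! i, [x, y, z] ! (Suc i mod length [x, y, z])} | i. i < length [x, y, z]} =
        (\<lambda>i. {[x, y, z] ! i, [x, y, z] ! (Suc i mod length [x, y, z])}) ` {i. i < length [x, y, z]}"
      by (rule setcompr_eq_image)
    moreover have "{i. i < length [x, y, z]} = {0, 1, 2}" by auto
    ultimately show "edges C = {{[x, y, z] ! i, [x, y, z] ! (Suc i mod length [x, y, z])} | i. i < length [x, y, z]}"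
      by (simp add: C_def numeral_2_eq_2)
  qed (use d in \<open>auto simp: C_def\<close>)
  moreover have "edges (join (Graph {s, t} {}) C) = base_edges x y z s t"
    by (simp add: join_def C_def join_edges base_edges_def insert_commute[of z x "{}"])
      (simp add: insert_commute)
  moreover have "verts (join (Graph {s, t} {}) C) = {x, y, z, s, t}"
    unfolding join_def C_def by auto
  ultimately have "G = Graph (verts (join (Graph {s, t} {}) C) \<union> I)
       (edges (join (Graph {s, t} {}) C) \<union> {{v, x} | v x. v \<in> I \<and> x \<in> f v})"
    "card {s, t} = 2" "is_cycle C" "card (verts C) = 3" "finite I" "card I = n - 5"
     "{s, t} \<inter> verts C = {}" "({s, t} \<union> verts C) \<inter> I = {}" "\<forall>v\<in>I. f v \<subseteq> verts C \<and> card (f v) = 2"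
    using F d cI by (auto simp: extremal_form_def C_def)
  then show "G \<in> extremal_graphs n" unfolding extremal_graphs_def by blast
qed

lemma card_base_edges:
  assumes "distinct [x, y, z, s, t]"
  shows "card (base_edges x y z s t) = 9"
proof -
  have "x \<noteq> y" "x \<noteq> z" "x \<noteq> s" "x \<noteq> t" "y \<noteq> z" "y \<noteq> s" "y \<noteq> t" "z \<noteq> s" "z \<noteq> t" "s \<noteq> t"
    "y \<noteq> x" "z \<noteq> x" "s \<noteq> x" "t \<noteq> x" "z \<noteq> y" "s \<noteq> y" "t \<noteq> y" "s \<noteq> z" "t \<noteq> z" "t \<noteq> s"
    using assms by auto
  then show ?thesis by (simp add: base_edges_def doubleton_eq_iff)
qed

lemma extremal_form_empty:
  assumes "distinct [x, y, z, s, t]"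
  shows "extremal_form x y z s t {} f (Graph {x, y, z, s, t} (base_edges x y z s t))"
  using assms by (simp add: extremal_form_def)

lemma extremal_form_insert:
  assumes F: "extremal_form x y z s t I f G" and v: "v \<notin> verts G"
    and ab: "a \<in> {x, y, z}" "b \<in> {x, y, z}" "a \<noteq> b"
  shows "extremal_form x y z s t (insert v I) (f(v := {a, b}))
    (Graph (insert v (verts G)) (edges G \<union> {{v, a}, {v, b}}))"
proof -
  have vI: "v \<notin> I" "v \<notin> {x, y, z, s, t}" using F v by (auto simp: extremal_form_def)
  have "{{w, u} | w u. w \<in> insert v I \<and> u \<in> (f(v := {a, b})) w} =
      {{w, u} | w u. w \<in> I \<and> u \<in> f w} \<union> {{v, a}, {v, b}}"
    using vI(1) by auto
  then show ?thesis using F vI ab unfolding extremal_form_def by (auto simp: card_insert_if)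
qed

lemma extremal_form_remove:
  assumes F: "extremal_form x y z s t (insert v I) f G" and v: "v \<notin> I"
  obtains H a b where "extremal_form x y z s t I f H" "v \<notin> verts H" "a \<in> {x, y, z}" "b \<in> {x, y, z}" "a \<noteq> b"
    "G = Graph (insert v (verts H)) (edges H \<union> {{v, a}, {v, b}})"
proof -
  define H where "H = Graph ({x, y, z, s, t} \<union> I) (base_edges x y z s t \<union> {{w, u} | w u. w \<in> I \<and> u \<in> f w})"
  have fv: "f v \<subseteq> {x, y, z}" "card (f v) = 2" "v \<notin> {x, y, z, s, t}" using F by (auto simp: extremal_form_def)
  obtain a b where ab: "f v = {a, b}" "a \<noteq> b" using fv(2) by (meson card_2_iff)
  have e: "{{w, u} | w u. w \<in> insert v I \<and> u \<in> f w} = {{w, u} | w u. w \<in> I \<and> u \<in> f w} \<union> {{v, a}, {v, b}}"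
    using ab(1) by auto
  have "G = Graph (insert v (verts H)) (edges H \<union> {{v, a}, {v, b}})"
    using F unfolding extremal_form_def e H_def by auto
  moreover have "extremal_form x y z s t I f H" using F by (simp add: extremal_form_def H_def)
  moreover have "v \<notin> verts H" using fv(3) v by (simp add: H_def)
  ultimately show thesis using that[of H a b] ab fv(1) by auto
qed

lemma extremal_form_base:
  assumes "extremal_form x y z s t I f G"
  shows "base_edges x y z s t \<subseteq> edges G" "{x, y, z, s, t} \<subseteq> verts G" "distinct [x, y, z, s, t]"
    "\<And>a b. a \<in> {x, y, z} \<Longrightarrow> b \<in> {x, y, z} \<Longrightarrow> a \<noteq> b \<Longrightarrow> {a, b} \<in> edges G"
    "\<And>a b. a \<in> {s, t} \<Longrightarrow> b \<in> {x, y, z} \<Longrightarrow> {a, b} \<in> edges G"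
    "\<And>a b. a \<in> I \<Longrightarrow> b \<in> f a \<Longrightarrow> {a, b} \<in> edges G"
proof -
  show B: "base_edges x y z s t \<subseteq> edges G" "{x, y, z, s, t} \<subseteq> verts G" "distinct [x, y, z, s, t]"
    using assms by (auto simp: extremal_form_def)
  show "{a, b} \<in> edges G" if "a \<in> {x, y, z}" "b \<in> {x, y, z}" "a \<noteq> b" for a b
    using that B(1) unfolding base_edges_def by (auto simp: insert_commute)
  show "{a, b} \<in> edges G" if "a \<in> {s, t}" "b \<in> {x, y, z}" for a b
    using that B(1) unfolding base_edges_def by auto
  show "{a, b} \<in> edges G" if "a \<in> I" "b \<in> f a" for a b
    using assms that by (auto simp: extremal_form_def)
qed

lemma extremal_form_props:
  assumes "extremal_form x y z s t I f G"
  shows "simple_graph G \<and> card (verts G) = card I + 5 \<and> card (edges G) = 2 * card I + 9 \<and>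
    (\<exists>p. straight p (verts G) (edges G))"
proof -
  have "finite I" using assms by (simp add: extremal_form_def)
  then show ?thesis using assms
  proof (induction I arbitrary: G rule: finite_induct)
    case empty
    have d: "distinct [x, y, z, s, t]" using extremal_form_base(3)[OF empty] .
    have G: "G = Graph {x, y, z, s, t} (base_edges x y z s t)" using empty by (simp add: extremal_form_def)
    have "\<exists>p. straight p {x, y, z, s, t} (base_edges x y z s t)" using straight_base[OF d] by blast
    moreover have "card {x, y, z, s, t} = 5" using d by simp
    moreover have "\<forall>e\<in>base_edges x y z s t. e \<subseteq> {x, y, z, s, t} \<and> card e = 2"
      using d by (auto simp: base_edges_def)
    ultimately show ?case unfolding G simple_graph_def using card_base_edges[OF d] by simp
  next
    case (insert v I)
    obtain H a b where H: "extremal_form x y z s t I f H" "v \<notin> verts H" "a \<in> {x, y, z}" "b \<in> {x, y, z}" "a \<noteq> b"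
      "G = Graph (insert v (verts H)) (edges H \<union> {{v, a}, {v, b}})"
      using extremal_form_remove[OF insert.prems insert.hyps(2)] by blast
    have sH: "simple_graph H" and cV: "card (verts H) = card I + 5" and cE: "card (edges H) = 2 * card I + 9"
      using insert.IH[OF H(1)] by blast+
    obtain p where p: "straight p (verts H) (edges H)" using insert.IH[OF H(1)] by blast
    have fin: "finite (verts H)" "finite (edges H)"
      and simple: "\<And>e. e \<in> edges H \<Longrightarrow> e \<subseteq> verts H \<and> card e = 2"
      using sH finite_subset[of "edges H" "Pow (verts H)"] by (auto simp: simple_graph_def)
    have abV: "a \<in> verts H" "b \<in> verts H" using extremal_form_base(2)[OF H(1)] H(3,4) by auto
    have ne: "v \<noteq> a" "v \<noteq> b" using abV H(2) by auto
    have "{v, a} \<notin> edges H" "{v, b} \<notin> edges H" using simple H(2) by blast+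
    moreover have "{v, a} \<noteq> {v, b}" using H(5) by (auto simp: doubleton_eq_iff)
    ultimately have "card (edges H \<union> {{v, a}, {v, b}}) = card (edges H) + 2" using fin by simp
    moreover have "{a, b} \<in> edges H" using extremal_form_base(4)[OF H(1)] H(3-5) by blast
    then obtain q where "straight (p(v := q)) (insert v (verts H)) (edges H \<union> {{v, a}, {v, b}})"
      using straight_extend[OF p fin(1) simple _ H(5,2)] by blast
    moreover have "simple_graph G" unfolding simple_graph_def H(6) using fin simple abV ne by auto
    ultimately show ?case unfolding H(6) using cV cE fin H(2) insert.hyps by auto
  qed
qed

lemma extremal_form_cover:
  assumes "extremal_form x y z s t I f G" "e \<in> edges G"
  shows "e \<inter> {x, y, z} \<noteq> {}"
  using assms by (auto simp: extremal_form_def base_edges_def)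

text \<open>The triangle is a vertex cover, so no two consecutive vertices of a cycle avoid it; a
  cycle has at least three vertices and hence at least two in the triangle.\<close>

lemma extremal_form_cycle:
  assumes F: "extremal_form x y z s t I f G" and C: "is_cycle C" "subgraph C G"
  obtains a b where "a \<in> verts C" "b \<in> verts C" "a \<in> {x, y, z}" "b \<in> {x, y, z}" "a \<noteq> b"
proof -
  obtain vs where vs: "3 \<le> length vs" "distinct vs" "verts C = set vs"
    "edges C = {{vs ! i, vs ! (Suc i mod length vs)} | i. i < length vs}"
    using C(1) unfolding is_cycle_def by blast
  have cover: "vs ! i \<in> {x, y, z} \<or> vs ! (Suc i mod length vs) \<in> {x, y, z}" if i: "i < length vs" for i
  proof -
    have "{vs ! i, vs ! (Suc i mod length vs)} \<in> edges G" using C(2) vs(4) i unfolding subgraph_def by blast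
    then show ?thesis using extremal_form_cover[OF F] by blast
  qed
  have ne: "vs \<noteq> []" using vs(1) by auto
  have in_C: "vs ! i \<in> verts C" if "i < length vs" for i using vs that by simp
  show thesis
  proof (cases "vs ! 1 \<in> {x, y, z}")
    case True
    \<comment> \<open>The successor of position 2, which wraps around to 0 for a cycle of length
      three.\<close>
    define j where "j = Suc 2 mod length vs"
    have j: "j < length vs" "j \<noteq> 1"
      using vs(1) by (cases "length vs = 3"; simp add: j_def)+
    have "vs ! 2 \<in> {x, y, z} \<or> vs ! j \<in> {x, y, z}" using cover[of 2] vs(1) by (simp add: j_def)
    moreover have "vs ! 1 \<noteq> vs ! 2" "vs ! 1 \<noteq> vs ! j"
      using vs(1,2) j by (auto simp: nth_eq_iff_index_eq)
    ultimately show thesis using that[of "vs ! 1" "vs ! 2"] that[of "vs ! 1" "vs ! j"] True in_C[of 1] in_C[of 2] in_C[of j] j vs(1)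
      by auto
  next
    case False
    then have "vs ! 0 \<in> {x, y, z}" "vs ! 2 \<in> {x, y, z}"
      using cover[of 0] cover[of 1] vs(1) ne by (auto simp: numeral_2_eq_2)
    moreover have "vs ! 0 \<noteq> vs ! 2" using vs(1,2) ne by (auto simp: nth_eq_iff_index_eq)
    ultimately show thesis using that[of "vs ! 0" "vs ! 2"] in_C[of 0] in_C[of 2] vs(1) ne by auto
  qed
qed

text \<open>Two disjoint cycles would use four different vertices of the triangle.\<close>

lemma extremal_form_free:
  assumes F: "extremal_form x y z s t I f G"
  shows "free_of two_cycles G"
proof (rule ccontr)
  assume "\<not> ?thesis"
  then obtain C D where CD: "is_cycle C" "is_cycle D" "verts C \<inter> verts D = {}"
    "subgraph (Graph (verts C \<union> verts D) (edges C \<union> edges D)) G"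
    unfolding free_of_def two_cycles_def by blast
  then have sub: "subgraph C G" "subgraph D G" by (auto simp: subgraph_def)
  obtain a b where ab: "a \<in> verts C" "b \<in> verts C" "a \<in> {x, y, z}" "b \<in> {x, y, z}" "a \<noteq> b"
    using extremal_form_cycle[OF F CD(1) sub(1)] by blast
  obtain c d where cd: "c \<in> verts D" "d \<in> verts D" "c \<in> {x, y, z}" "d \<in> {x, y, z}" "c \<noteq> d"
    using extremal_form_cycle[OF F CD(2) sub(2)] by blast
  have "a \<noteq> c" "a \<noteq> d" "b \<noteq> c" "b \<noteq> d" using ab cd CD(3) by blast+
  then have "card {a, b, c, d} = 4" using ab cd by simp
  moreover have "card {a, b, c, d} \<le> card {x, y, z}" using ab cd by (intro card_mono) auto
  moreover have "card {x, y, z} \<le> 3" by (simp add: card_insert_if)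
  ultimately show False by simp
qed

lemma extremal_graphs_sound:
  assumes "n \<ge> 5" "G \<in> extremal_graphs n"
  shows "simple_graph G" "card (verts G) = n" "planar G" "free_of two_cycles G" "card (edges G) = 2 * n - 1"
proof -
  obtain x y z s t I f where F: "extremal_form x y z s t I f G" "card I = n - 5"
    using assms(2) unfolding extremal_graphs_iff by blast
  note P = extremal_form_props[OF F(1)]
  show "simple_graph G" "card (verts G) = n" "card (edges G) = 2 * n - 1" using P F(2) assms(1) by auto
  show "planar G" using P straight_planar by blast
  show "free_of two_cycles G" by (rule extremal_form_free[OF F(1)])
qed

section \<open>The edge bound\<close>

lemma simple_ugraph: "simple_graph G \<Longrightarrow> ugraph (verts G) (\<lambda>u v. {u, v} \<in> edges G)"
proof
  assume s: "simple_graph G"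
  show "finite (verts G)" using s by (simp add: simple_graph_def)
  show "{v, u} \<in> edges G" if "{u, v} \<in> edges G" for u v using that by (simp add: insert_commute)
  show "{v, v} \<notin> edges G" for v
  proof
    assume "{v, v} \<in> edges G"
    then have "card {v, v} = 2" using s unfolding simple_graph_def by blast
    then show False by simp
  qed
  show "u \<in> verts G" if "{u, v} \<in> edges G" for u v using s that by (auto simp: simple_graph_def)
qed

lemma free_cyc_lists:
  assumes "simple_graph G" "free_of two_cycles G"
    "ugraph.cyc_list (\<lambda>u v. {u, v} \<in> edges G) vs" "ugraph.cyc_list (\<lambda>u v. {u, v} \<in> edges G) ws"
  shows "set vs \<inter> set ws \<noteq> {}"
proof
  interpret ugraph "verts G" "\<lambda>u v. {u, v} \<in> edges G" by (rule simple_ugraph[OF assms(1)])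
  assume disj: "set vs \<inter> set ws = {}"
  define C where "C us = Graph (set us) {{us ! i, us ! (Suc i mod length us)} | i. i < length us}" for us :: "'a list"
  have C: "is_cycle (C us)" "subgraph (C us) G" if us: "cyc_list us" for us
  proof -
    show "is_cycle (C us)" unfolding is_cycle_def using us by (intro exI[of _ us]) (simp add: C_def cyc_list_def)
    show "subgraph (C us) G" unfolding subgraph_def
    proof
      show "verts (C us) \<subseteq> verts G" using cyc_list_in_V[OF us] by (simp add: C_def)
      show "edges (C us) \<subseteq> edges G" using us by (auto simp: C_def cyc_list_def)
    qed
  qed
  have "verts (C vs) \<inter> verts (C ws) = {}" using disj by (simp add: C_def)
  then have "Graph (verts (C vs) \<union> verts (C ws)) (edges (C vs) \<union> edges (C ws)) \<in> two_cycles"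
    unfolding two_cycles_def using C(1)[OF assms(3)] C(1)[OF assms(4)] by blast
  moreover have "subgraph (Graph (verts (C vs) \<union> verts (C ws)) (edges (C vs) \<union> edges (C ws))) G"
    using C(2)[OF assms(3)] C(2)[OF assms(4)] by (simp add: subgraph_def)
  ultimately show False using assms(2) unfolding free_of_def by blast
qed

lemma card_edges_insert:
  assumes "simple_graph G" "finite U" "v \<notin> U"
  shows "card {e \<in> edges G. e \<subseteq> insert v U} =
    card {e \<in> edges G. e \<subseteq> U} + ugraph.cnt (\<lambda>u v. {u, v} \<in> edges G) {v} U"
proof -
  interpret ugraph "verts G" "\<lambda>u v. {u, v} \<in> edges G" by (rule simple_ugraph[OF assms(1)])
  let ?N = "{w \<in> U. {v, w} \<in> edges G}"
  have "e \<in> (\<lambda>w. {v, w}) ` ?N" if e: "e \<in> edges G" "e \<subseteq> insert v U" "v \<in> e" for e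
  proof -
    have "card e = 2" using e assms(1) by (simp add: simple_graph_def)
    then obtain w where "e = {v, w}" "w \<noteq> v" using e(3) by (auto simp: card_2_iff)
    then show ?thesis using e by auto
  qed
  then have "{e \<in> edges G. e \<subseteq> insert v U} = {e \<in> edges G. e \<subseteq> U} \<union> (\<lambda>w. {v, w}) ` ?N"
    by auto
  moreover have "{e \<in> edges G. e \<subseteq> U} \<inter> (\<lambda>w. {v, w}) ` ?N = {}" using assms(3) by auto
  moreover have "finite {e \<in> edges G. e \<subseteq> U}" using assms(2) by (auto intro: finite_subset[of _ "Pow U"])
  moreover have "card ((\<lambda>w. {v, w}) ` ?N) = card ?N"
    by (rule card_image) (auto simp: inj_on_def doubleton_eq_iff)
  ultimately show ?thesis using assms(2) by (simp add: card_Un_disjoint cnt_single_eq_card)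
qed

lemma handshake:
  assumes "simple_graph G"
  shows "ugraph.cnt (\<lambda>u v. {u, v} \<in> edges G) (verts G) (verts G) = 2 * card (edges G)"
proof -
  interpret ugraph "verts G" "\<lambda>u v. {u, v} \<in> edges G" by (rule simple_ugraph[OF assms])
  have "cnt U U = 2 * card {e \<in> edges G. e \<subseteq> U}" if "finite U" for U
    using that
  proof (induction U rule: finite_induct)
    case empty
    have "{e \<in> edges G. e \<subseteq> {}} = {}" using assms by (auto simp: simple_graph_def)
    then show ?case by (metis card.empty cnt_empty(1) mult_0_right)
  next
    case (insert v U)
    then show ?case using card_edges_insert[OF assms insert.hyps] cnt_insert_self[OF insert.hyps] by simp
  qed
  moreover have "{e \<in> edges G. e \<subseteq> verts G} = edges G" using assms by (auto simp: simple_graph_def)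
  ultimately show ?thesis using finite_V by simp
qed

lemma extremal_form_I_edge:
  assumes "extremal_form x y z s t I f G" "a \<in> I" "{a, b} \<in> edges G" "b \<in> {x, y, z}"
  shows "b \<in> f a"
proof -
  have "a \<notin> {x, y, z, s, t}" "b \<notin> I" using assms by (auto simp: extremal_form_def)
  then have "{a, b} \<notin> base_edges x y z s t" by (auto simp: base_edges_def doubleton_eq_iff)
  then obtain w u where "{a, b} = {w, u}" "w \<in> I" "u \<in> f w"
    using assms(1,3) by (auto simp: extremal_form_def)
  then show ?thesis using \<open>b \<notin> I\<close> by (auto simp: doubleton_eq_iff)
qed

lemma third_vertex:
  assumes "distinct [x, y, z]" "u \<in> {x, y, z}"
  obtains p q where "{x, y, z} = {u, p, q}" "distinct [u, p, q]"
proof -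
  consider "u = x" | "u = y" | "u = z" using assms(2) by blast
  then show thesis
  proof cases
    case 1 then show thesis using that[of y z] assms(1) by auto
  next
    case 2 then show thesis using that[of x z] assms(1) by auto
  next
    case 3 then show thesis using that[of x y] assms(1) by auto
  qed
qed

text \<open>A vertex outside the triangle has at least two neighbours on it, collected in
  \<open>nb\<close>, and at least one of \<open>s\<close>, \<open>t\<close> is usually free to close
  a second triangle. The exceptional positions of \<open>a\<close> and \<open>b\<close> are those
  where planarity is used. The conclusion for \<open>b\<close> follows by exchanging the
  two.\<close>

lemma attached_to_triangle:
  assumes F: "extremal_form x y z s t I f H" and v: "v \<notin> verts H" and ab: "a \<in> verts H" "b \<in> verts H" "a \<noteq> b"
    and G: "G = Graph (insert v (verts H)) (edges H \<union> {{v, a}, {v, b}})"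
    and G': "simple_graph G" "planar G" "free_of two_cycles G"
  shows "a \<in> {x, y, z}"
proof (rule ccontr)
  assume aT: "a \<notin> {x, y, z}"
  let ?T = "{x, y, z}"
  interpret ugraph "verts G" "\<lambda>u v. {u, v} \<in> edges G" by (rule simple_ugraph[OF G'(1)])
  note B = extremal_form_base[OF F]
  have d: "distinct [x, y, z, s, t]" "distinct [x, y, z]" using B(3) by auto
  have I: "finite I" "I \<inter> {x, y, z, s, t} = {}" "\<And>i. i \<in> I \<Longrightarrow> f i \<subseteq> ?T \<and> card (f i) = 2"
    and VH: "verts H = {x, y, z, s, t} \<union> I"
    using F by (auto simp: extremal_form_def)
  have HG: "edges H \<subseteq> edges G" "{v, a} \<in> edges G" "{v, b} \<in> edges G" using G by auto
  have va: "v \<noteq> a" "v \<noteq> b" using v ab by auto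
  have TT: "{p, q} \<in> edges G" if "p \<in> ?T" "q \<in> ?T" "p \<noteq> q" for p q using B(4) HG(1) that by blast
  have ST: "{p, q} \<in> edges G" if "p \<in> {s, t}" "q \<in> ?T" for p q using B(5) HG(1) that by blast
  define nb where "nb w = (if w \<in> I then f w else ?T)" for w
  have nb: "nb w \<subseteq> ?T \<and> 2 \<le> card (nb w) \<and> (\<forall>u\<in>nb w. {w, u} \<in> edges G)"
    if w: "w \<in> verts H" "w \<notin> ?T" for w
  proof (cases "w \<in> I")
    case True
    then show ?thesis using I(3)[OF True] B(6)[OF True] HG(1) by (auto simp: nb_def)
  next
    case False
    then have "w \<in> {s, t}" using w VH by blast
    moreover have "card ?T = 3" using d by simp
    ultimately show ?thesis using ST False by (simp add: nb_def)
  qed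
  have contra: False if "cyc_list vs" "cyc_list ws" "set vs \<inter> set ws = {}" for vs ws
    using free_cyc_lists[OF G'(1,3)] that by blast
  have third: "\<exists>r\<in>{s, t}. r \<noteq> w" for w using d by auto
  have vn: "v \<notin> ?T" "v \<notin> {s, t}" "v \<notin> I" using v VH by auto
  obtain p S where "drawing (verts G) (edges G) p S" using planar_drawing[OF G'(1,2)] by blast
  then interpret drawing "verts G" "edges G" p S .
  have old: "{q, r} \<in> {e \<in> edges G. v \<notin> e}" if "{q, r} \<in> edges G" "q \<noteq> v" "r \<noteq> v" for q r using that by auto
  show False
  proof (cases "b \<in> ?T")
    case True
    obtain q r where qr: "?T = {b, q, r}" "distinct [b, q, r]" using third_vertex[OF d(2) True] by blast
    have qrT: "q \<in> ?T" "r \<in> ?T" using qr(1) by auto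
    show False
    proof (cases "b \<in> nb a")
      case b: True
      \<comment> \<open>The triangle \<open>v a b\<close> is disjoint from the triangle on
        \<open>q\<close>, \<open>r\<close> and whichever of \<open>s\<close>, \<open>t\<close> is
        not \<open>a\<close>.\<close>
      obtain w where w: "w \<in> {s, t}" "w \<noteq> a" using third by blast
      have "{a, b} \<in> edges G" using nb[OF ab(1) aT] b by blast
      then have 1: "cyc_list [v, a, b]" using HG by (intro triangle_cyc_list) (auto simp: insert_commute)
      have 2: "cyc_list [q, r, w]"
        using TT[OF qrT] ST[OF w(1) qrT(1)] ST[OF w(1) qrT(2)] qr(2)
        by (intro triangle_cyc_list) (auto simp: insert_commute)
      have "w \<notin> ?T" using w d by auto
      then show False using contra[OF 1 2] qr(2) qrT vn w aT True by auto
    next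
      case b: False
      then have aI: "a \<in> I" using True by (auto simp: nb_def split: if_splits)
      have fa: "f a = {q, r}"
      proof (rule card_subset_eq)
        show "f a \<subseteq> {q, r}" using I(3)[OF aI] b aI qr(1) by (auto simp: nb_def)
        show "card (f a) = card {q, r}" using I(3)[OF aI] qr(2) by simp
      qed simp
      have nab: "{a, b} \<notin> edges G"
      proof
        assume "{a, b} \<in> edges G"
        then have "{a, b} \<in> edges H" using G va by (auto simp: doubleton_eq_iff)
        then have "b \<in> f a" using extremal_form_I_edge[OF F aI _ True] by blast
        then show False using b aI by (simp add: nb_def)
      qed
      \<comment> \<open>Here \<open>a\<close> sees just \<open>q\<close> and \<open>r\<close>; the
        path through \<open>v\<close> replaces its missing edge to \<open>b\<close>, giving K_{3,3}
        with sides \<open>s\<close>, \<open>t\<close>, \<open>a\<close> and \<open>b\<close>,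
        \<open>q\<close>, \<open>r\<close>.\<close>
      interpret D: drawing "verts G - {v}" "insert {a, b} {e \<in> edges G. v \<notin> e}" p
        "S({a, b} := S {v, a} \<union> S {v, b})"
        by (rule suppress[OF HG(2,3) ab(3) nab])
      show False
      proof (rule D.no_K33[of s t a b q r])
        show "distinct [s, t, a, b, q, r]" using d qr qrT aI I(2) True by auto
        fix u w assume u: "u \<in> {s, t, a}" and w: "w \<in> {b, q, r}"
        have wT: "w \<in> ?T" using w qr(1) by blast
        have wv: "w \<noteq> v" "u \<noteq> v" using wT vn u va by auto
        show "{u, w} \<in> insert {a, b} {e \<in> edges G. v \<notin> e}"
        proof (cases "u = a")
          case True
          then show ?thesis using w fa B(6)[OF aI] HG(1) wv by auto
        next
          case False
          then show ?thesis using ST[OF _ wT] u old wv by blast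
        qed
      qed
    qed
  next
    case bT: False
    show False
    proof (cases "a \<in> I \<or> b \<in> I")
      case True
      have "nb a \<inter> nb b \<noteq> {}"
      proof
        assume e: "nb a \<inter> nb b = {}"
        have fin: "finite (nb a)" "finite (nb b)"
          using nb[OF ab(1) aT] nb[OF ab(2) bT] by (meson finite.emptyI finite.insertI finite_subset)+
        have "card (nb a \<union> nb b) = card (nb a) + card (nb b)" using card_Un_disjoint[OF fin e] .
        moreover have "card (nb a \<union> nb b) \<le> card ?T" using nb[OF ab(1) aT] nb[OF ab(2) bT] by (intro card_mono) auto
        moreover have "card ?T = 3" using d by simp
        ultimately show False using nb[OF ab(1) aT] nb[OF ab(2) bT] by linarith
      qed
      then obtain c where c: "c \<in> nb a" "c \<in> nb b" by blast
      have cE: "{a, c} \<in> edges G" "{b, c} \<in> edges G" "c \<in> ?T"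
        using c nb[OF ab(1) aT] nb[OF ab(2) bT] by blast+
      obtain q r where qr: "?T = {c, q, r}" "distinct [c, q, r]" using third_vertex[OF d(2) cE(3)] by blast
      have qrT: "q \<in> ?T" "r \<in> ?T" using qr(1) by auto
      have "\<exists>w\<in>{s, t}. w \<noteq> a \<and> w \<noteq> b" using True I(2) d by auto
      then obtain w where w: "w \<in> {s, t}" "w \<noteq> a" "w \<noteq> b" by blast
      have 1: "cyc_list [v, a, c, b]"
        using HG cE vn by (intro square_cyc_list) (use ab(3) in \<open>auto simp: insert_commute\<close>)
      have 2: "cyc_list [q, r, w]"
        using TT[OF qrT] ST[OF w(1) qrT(1)] ST[OF w(1) qrT(2)] qr(2)
        by (intro triangle_cyc_list) (auto simp: insert_commute)
      have "w \<notin> ?T" using w d by auto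
      moreover have "w \<noteq> v" using w vn by blast
      ultimately have "set [v, a, c, b] \<inter> set [q, r, w] = {}"
        using qr(2) qrT vn(1) w aT bT cE(3) by auto
      then show False using contra[OF 1 2] by blast
    next
      case nI: False
      then have abS: "a \<in> {s, t}" "b \<in> {s, t}" using aT bT ab VH by blast+
      show False
      proof (cases "I = {}")
        case True
        have nab: "{a, b} \<notin> edges G"
        proof
          assume "{a, b} \<in> edges G"
          then have "{a, b} \<in> edges H" using G va by (auto simp: doubleton_eq_iff)
          then show False using extremal_form_cover[OF F] aT bT by blast
        qed
        \<comment> \<open>\<open>a\<close> and \<open>b\<close> are \<open>s\<close> and
          \<open>t\<close>, and the path through \<open>v\<close> supplies the only edge that the
          five vertices lack for K_5.\<close>
        interpret D: drawing "verts G - {v}" "insert {a, b} {e \<in> edges G. v \<notin> e}" p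
          "S({a, b} := S {v, a} \<union> S {v, b})"
          by (rule suppress[OF HG(2,3) ab(3) nab])
        show False
        proof (rule D.no_K5[of x y z a b])
          show "distinct [x, y, z, a, b]" using d aT bT ab(3) by auto
          fix u w assume uw: "u \<in> {x, y, z, a, b}" "w \<in> {x, y, z, a, b}" "u \<noteq> w"
          have nv: "u \<noteq> v" "w \<noteq> v" using uw vn(1) va by auto
          show "{u, w} \<in> insert {a, b} {e \<in> edges G. v \<notin> e}"
          proof (cases "u \<in> ?T")
            case uT: True
            have "{u, w} \<in> edges G"
            proof (cases "w \<in> ?T")
              case True then show ?thesis using TT uT uw by blast
            next
              case False
              then have "w \<in> {s, t}" using uw abS by blast
              then have "{w, u} \<in> edges G" using ST uT by blast
              then show ?thesis by (simp add: insert_commute)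
            qed
            then show ?thesis using old nv by blast
          next
            case uT: False
            then have u: "u \<in> {a, b}" using uw by blast
            show ?thesis
            proof (cases "w \<in> ?T")
              case True
              then have "{u, w} \<in> edges G" using ST u abS by blast
              then show ?thesis using old nv by blast
            next
              case False
              then have "w \<in> {a, b}" using uw by blast
              then have "{u, w} = {a, b}" using u uw(3) by auto
              then show ?thesis by simp
            qed
          qed
        qed
      next
        case False
        \<comment> \<open>Both \<open>s\<close> and \<open>t\<close> are occupied, but
          \<open>i\<close> with its two triangle neighbours forms a triangle avoiding
          \<open>v\<close>, \<open>a\<close>, \<open>b\<close> and the third triangle vertex
          \<open>c\<close>.\<close>
        then obtain i where i: "i \<in> I" by blast
        obtain q r where qr: "f i = {q, r}" "q \<noteq> r" using I(3)[OF i] by (meson card_2_iff)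
        have qrT: "q \<in> ?T" "r \<in> ?T" using I(3)[OF i] qr by auto
        have "\<exists>c\<in>?T. c \<noteq> q \<and> c \<noteq> r" using d(2) by auto
        then obtain c where c: "c \<in> ?T" "c \<noteq> q" "c \<noteq> r" by blast
        have 1: "cyc_list [v, a, c, b]"
          using HG ST[OF abS(1) c(1)] ST[OF abS(2) c(1)] vn c(1)
          by (intro square_cyc_list) (use ab(3) in \<open>auto simp: insert_commute\<close>)
        have iE: "{i, q} \<in> edges G" "{i, r} \<in> edges G" using B(6)[OF i] qr HG(1) by auto
        have 2: "cyc_list [q, r, i]"
          using TT[OF qrT qr(2)] iE by (intro triangle_cyc_list) (auto simp: insert_commute)
        have "i \<noteq> v" "i \<noteq> a" "i \<noteq> b" "i \<noteq> c" using i vn nI I(2) c by auto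
        then have "set [v, a, c, b] \<inter> set [q, r, i] = {}" using vn(1) qrT c aT bT by auto
        then show False using contra[OF 1 2] by blast
      qed
    qed
  qed
qed

lemma free_of_subgraph: "free_of \<F> G \<Longrightarrow> subgraph H G \<Longrightarrow> free_of \<F> H"
  unfolding free_of_def subgraph_def by blast

text \<open>Ten edges would be K_5. With nine, the single missing pair takes the role of
  \<open>s\<close>, \<open>t\<close> and the other three vertices form the triangle.\<close>

lemma five_vertices:
  assumes G: "simple_graph G" "planar G" "card (verts G) = 5"
  shows "card (edges G) \<le> 9 \<and> (card (edges G) = 9 \<longrightarrow> G \<in> extremal_graphs 5)"
proof -
  let ?P = "{e. e \<subseteq> verts G \<and> card e = 2}"
  have fin: "finite (verts G)" using G by (simp add: simple_graph_def)
  have cP: "card ?P = 10" using n_subsets[OF fin, of 2] G(3) by (simp add: choose_two)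
  have fP: "finite ?P" using fin by simp
  have sub: "edges G \<subseteq> ?P" using G(1) by (auto simp: simple_graph_def)
  have "edges G \<noteq> ?P"
  proof
    assume all: "edges G = ?P"
    obtain vs where vs: "set vs = verts G" "distinct vs" using finite_distinct_list[OF fin] by blast
    then have "length vs = 5" using G(3) distinct_card by metis
    then obtain a b c d e where v5: "vs = [a, b, c, d, e]" by (auto simp: length_Suc_conv numeral_eq_Suc)
    obtain p S where "drawing (verts G) (edges G) p S" using planar_drawing[OF G(1,2)] by blast
    then interpret drawing "verts G" "edges G" p S .
    show False
    proof (rule no_K5[of a b c d e])
      show "distinct [a, b, c, d, e]" using vs(2) v5 by simp
      fix u v assume "u \<in> {a, b, c, d, e}" "v \<in> {a, b, c, d, e}" "u \<noteq> v"
      then have "u \<in> verts G" "v \<in> verts G" "card {u, v} = 2" using vs(1) v5 by auto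
      then show "{u, v} \<in> edges G" unfolding all by simp
    qed
  qed
  then have "card (edges G) < 10" using psubset_card_mono[OF fP, of "edges G"] sub cP by auto
  moreover have "G \<in> extremal_graphs 5" if nine: "card (edges G) = 9"
  proof -
    have "card (?P - edges G) = 1" using card_Diff_subset[OF finite_subset[OF sub fP] sub] cP nine by simp
    then obtain e where e: "?P - edges G = {e}" by (rule card_1_singletonE)
    then have "e \<subseteq> verts G" "card e = 2" by blast+
    then obtain s t where st: "e = {s, t}" "s \<noteq> t" "s \<in> verts G" "t \<in> verts G" by (auto simp: card_2_iff)
    have "card (verts G - {s, t}) = 3" using st fin G(3) by (simp add: card_Diff_subset)
    then obtain x y z where xyz: "verts G - {s, t} = {x, y, z}" "x \<noteq> y" "y \<noteq> z" "x \<noteq> z"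
      by (auto simp: card_3_iff)
    have V: "verts G = {x, y, z, s, t}" using xyz(1) st by auto
    have d: "distinct [x, y, z, s, t]" using xyz st(2) by auto
    have nst: "{s, t} \<notin> base_edges x y z s t" using d by (auto simp: base_edges_def doubleton_eq_iff)
    have bP: "base_edges x y z s t \<subseteq> ?P" unfolding V using d by (auto simp: base_edges_def)
    have bs: "base_edges x y z s t \<subseteq> edges G"
    proof
      fix g assume g: "g \<in> base_edges x y z s t"
      show "g \<in> edges G"
      proof (rule ccontr)
        assume "g \<notin> edges G"
        then have "g \<in> ?P - edges G" using bP g by blast
        then show False using e st(1) g nst by simp
      qed
    qed
    have "base_edges x y z s t = edges G"
      by (rule card_subset_eq[OF finite_subset[OF sub fP] bs]) (simp only: card_base_edges[OF d] nine)
    then have "G = Graph {x, y, z, s, t} (base_edges x y z s t)" using V by (cases G) simp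
    then show ?thesis unfolding extremal_graphs_iff using extremal_form_empty[OF d] by fastforce
  qed
  ultimately show ?thesis by simp
qed

text \<open>The bound and the structure are carried through one induction, because equality can be
  analysed only if the smaller graph is known explicitly.\<close>

lemma edges_bound:
  assumes "n \<ge> 5" "simple_graph G" "card (verts G) = n" "planar G" "free_of two_cycles G"
  shows "card (edges G) \<le> 2 * n - 1 \<and> (card (edges G) = 2 * n - 1 \<longrightarrow> G \<in> extremal_graphs n)"
  using assms
proof (induction n arbitrary: G rule: nat_induct_at_least)
  case base
  then show ?case using five_vertices[of G] by simp
next
  case (Suc n)
  interpret ugraph "verts G" "\<lambda>u v. {u, v} \<in> edges G" by (rule simple_ugraph[OF Suc.prems(1)])
  show ?case
  proof (cases "\<exists>v\<in>verts G. cnt {v} (verts G) \<le> 2")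
    case True
    then obtain v where v: "v \<in> verts G" "cnt {v} (verts G) \<le> 2" by blast
    define H where "H = Graph (verts G - {v}) {e \<in> edges G. v \<notin> e}"
    have sH: "simple_graph H" using Suc.prems(1) by (auto simp: simple_graph_def H_def)
    have HG: "subgraph H G" by (auto simp: subgraph_def H_def)
    have cH: "card (verts H) = n" using Suc.prems(2) v(1) finite_V by (simp add: H_def)
    have IH: "card (edges H) \<le> 2 * n - 1 \<and> (card (edges H) = 2 * n - 1 \<longrightarrow> H \<in> extremal_graphs n)"
      by (rule Suc.IH[OF sH cH planar_subgraph[OF Suc.prems(3) HG sH] free_of_subgraph[OF Suc.prems(4) HG]])
    have ins: "insert v (verts G - {v}) = verts G" using v(1) by blast
    have "{e \<in> edges G. e \<subseteq> verts G} = edges G" "{e \<in> edges G. e \<subseteq> verts G - {v}} = edges H"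
      using Suc.prems(1) by (auto simp: simple_graph_def H_def)
    moreover have "cnt {v} (verts G - {v}) = cnt {v} (verts G)"
      using cnt_insert_right[of "verts G - {v}" v "{v}"] finite_V ins adj_irrefl[of v] by simp
    ultimately have cG: "card (edges G) = card (edges H) + cnt {v} (verts G)"
      using card_edges_insert[OF Suc.prems(1), of "verts G - {v}" v] finite_V unfolding ins by simp
    \<comment> \<open>The additive form avoids truncated subtraction in the arithmetic that
      follows.\<close>
    have le_H: "card (edges H) + 1 \<le> 2 * n"
      using IH[THEN conjunct1] Suc.hyps by (subst (asm) le_diff_conv2) auto
    have extremal: "G \<in> extremal_graphs (Suc n)" if eq: "card (edges G) = 2 * Suc n - 1"
    proof -
      have "card (edges G) = 2 * n + 1" using eq by simp
      \<comment> \<open>Equality forces both a deleted vertex of degree exactly two and equality for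
        the smaller graph.\<close>
      then have "card (edges H) + 1 = 2 * n" and two: "cnt {v} (verts G) = 2"
        using cG le_H v(2) by linarith+
      then have "card (edges H) = 2 * n - 1" by simp
      with two have HE: "H \<in> extremal_graphs n" and N: "card {w \<in> verts G. {v, w} \<in> edges G} = 2"
        using IH cnt_single_eq_card[OF finite_V, of v] by auto
      obtain a b where ab: "{w \<in> verts G. {v, w} \<in> edges G} = {a, b}" "a \<noteq> b" using N by (meson card_2_iff)
      have abv: "{v, a} \<in> edges G" "{v, b} \<in> edges G" "a \<in> verts G" "b \<in> verts G" using ab by blast+
      then have "a \<noteq> v" "b \<noteq> v" using adj_irrefl[of v] by auto
      then have abH: "a \<in> verts H" "b \<in> verts H" using abv by (auto simp: H_def)
      have vH: "v \<notin> verts H" by (simp add: H_def)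
      have "e = {v, a} \<or> e = {v, b}" if e: "e \<in> edges G" "v \<in> e" for e
      proof -
        have "card e = 2" "e \<subseteq> verts G" using e Suc.prems(1) by (auto simp: simple_graph_def)
        then obtain w where w: "e = {v, w}" "w \<in> verts G" using e(2) by (auto simp: card_2_iff)
        then have "w \<in> {a, b}" using e ab(1) by blast
        then show ?thesis using w by blast
      qed
      then have "edges G = edges H \<union> {{v, a}, {v, b}}" using abv by (auto simp: H_def)
      then have GH: "G = Graph (insert v (verts H)) (edges H \<union> {{v, a}, {v, b}})"
        using ins by (cases G) (simp add: H_def)
      obtain x y z s t I f where F: "extremal_form x y z s t I f H" "card I = n - 5"
        using HE unfolding extremal_graphs_iff by blast
      have aT: "a \<in> {x, y, z}"
        by (rule attached_to_triangle[OF F(1) vH abH ab(2) GH Suc.prems(1,3,4)])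
      have GH': "G = Graph (insert v (verts H)) (edges H \<union> {{v, b}, {v, a}})"
        using GH by (simp add: insert_commute)
      have bT: "b \<in> {x, y, z}"
        by (rule attached_to_triangle[OF F(1) vH abH(2,1) ab(2)[symmetric] GH' Suc.prems(1,3,4)])
      have "extremal_form x y z s t (insert v I) (f(v := {a, b})) G"
        using extremal_form_insert[OF F(1) vH aT bT ab(2)] GH by simp
      moreover have "card (insert v I) = Suc n - 5"
      proof -
        have "v \<notin> I" "finite I" using vH F(1) by (auto simp: extremal_form_def)
        then show ?thesis using F(2) Suc.hyps by simp
      qed
      ultimately show ?thesis unfolding extremal_graphs_iff by blast
    qed
    have "card (edges G) \<le> 2 * n + 1" using cG le_H v(2) by linarith
    then show ?thesis using extremal by simp
  next
    case False
    \<comment> \<open>With minimum degree three the bound is strict, so this case contributes no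
      extremal graph.\<close>
    have "card (edges G) < 2 * Suc n - 1"
    proof (rule ccontr)
      assume big: "\<not> ?thesis"
      interpret dense_ugraph "verts G" "\<lambda>u v. {u, v} \<in> edges G"
      proof
        show "3 \<le> cnt {v} (verts G)" if "v \<in> verts G" for v using False that by force
        show "U \<inter> W \<noteq> {}" if "cyclic U" "cyclic W" for U W
        proof -
          obtain vs where vs: "cyc_list vs" "set vs \<subseteq> U" using cyclic_imp_cyc_list[OF \<open>cyclic U\<close>] by blast
          obtain ws where ws: "cyc_list ws" "set ws \<subseteq> W" using cyclic_imp_cyc_list[OF \<open>cyclic W\<close>] by blast
          show ?thesis using free_cyc_lists[OF Suc.prems(1,4) vs(1) ws(1)] vs(2) ws(2) by blast
        qed
      qed
      have hs: "cnt (verts G) (verts G) = 2 * card (edges G)" by (rule handshake[OF Suc.prems(1)])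
      have "2 * n + 1 \<le> card (edges G)" using big by simp
      then have "6 \<le> card (verts G)" "4 * card (verts G) \<le> cnt (verts G) (verts G) + 2"
        unfolding hs Suc.prems(2) using Suc.hyps by simp_all
      then have K33 by (rule dense_K33)
      then obtain A B where AB: "card A = 3" "card B = 3" "A \<inter> B = {}" "\<And>a b. a \<in> A \<Longrightarrow> b \<in> B \<Longrightarrow> {a, b} \<in> edges G"
        unfolding K33_def by blast
      obtain a1 a2 a3 where A: "A = {a1, a2, a3}" "distinct [a1, a2, a3]" using AB(1) by (auto simp: card_3_iff)
      obtain b1 b2 b3 where B: "B = {b1, b2, b3}" "distinct [b1, b2, b3]" using AB(2) by (auto simp: card_3_iff)
      obtain p S where "drawing (verts G) (edges G) p S" using planar_drawing[OF Suc.prems(1,3)] by blast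
      then interpret drawing "verts G" "edges G" p S .
      show False
        by (rule no_K33[of a1 a2 a3 b1 b2 b3]) (use AB(3,4) A B in auto)
    qed
    then show ?thesis by simp
  qed
qed

theorem theorem1p4:
  fixes n :: nat
  assumes "n \<ge> 5"
  shows "ex_planar n two_cycles = 2 * n - 1 \<and>
    {G :: 'a graph. simple_graph G \<and> card (verts G) = n \<and> planar G \<and> free_of two_cycles G \<and>
       card (edges G) = 2 * n - 1} = extremal_graphs n"
proof
  let ?A = "{card (edges G) | G :: nat graph. simple_graph G \<and> card (verts G) = n \<and> planar G \<and> free_of two_cycles G}"
  have le: "k \<le> 2 * n - 1" if "k \<in> ?A" for k using that edges_bound[OF assms] by blast
  \<comment> \<open>The maximum ranges over graphs on natural numbers, so a member attaining it is
    exhibited there: all further vertices are joined to the same two triangle vertices.\<close>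
  have "extremal_form (0::nat) 1 2 3 4 {5..<n} (\<lambda>_. {0, 1})
      (Graph ({0, 1, 2, 3, 4} \<union> {5..<n}) (base_edges 0 1 2 3 4 \<union> {{v, u} | v u. v \<in> {5..<n} \<and> u \<in> {0, 1}}))"
    by (auto simp: extremal_form_def)
  moreover have "card {5..<n} = n - 5" by simp
  ultimately obtain G :: "nat graph" where "G \<in> extremal_graphs n" unfolding extremal_graphs_iff by blast
  note sound = extremal_graphs_sound[OF assms this]
  have "2 * n - 1 \<in> ?A"
  proof (intro CollectI exI[of _ G] conjI)
    show "2 * n - 1 = card (edges G)" using sound(5) by simp
  qed (fact sound)+
  moreover have "finite ?A" by (rule finite_subset[of _ "{..2 * n - 1}"]) (use le in auto)
  ultimately show "ex_planar n two_cycles = 2 * n - 1"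
    unfolding ex_planar_def using le by (intro Max_eqI) auto
next
  show "{G :: 'a graph. simple_graph G \<and> card (verts G) = n \<and> planar G \<and> free_of two_cycles G \<and>
       card (edges G) = 2 * n - 1} = extremal_graphs n"
  proof (intro subset_antisym subsetI)
    fix G :: "'a graph"
    show "G \<in> extremal_graphs n"
      if "G \<in> {G. simple_graph G \<and> card (verts G) = n \<and> planar G \<and> free_of two_cycles G \<and>
        card (edges G) = 2 * n - 1}"
      using that edges_bound[OF assms, of G] by blast
    show "G \<in> {G. simple_graph G \<and> card (verts G) = n \<and> planar G \<and> free_of two_cycles G \<and>
        card (edges G) = 2 * n - 1}" if "G \<in> extremal_graphs n"
      using extremal_graphs_sound[OF assms that] by blast
  qed
qed

end
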